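(* Let $G$ be a discrete group and let $\mathcal{F}$ be the family of finite subgroups of $G$. Consider the functor $R:\mathbf{O}_{\mathcal{F}}\to\mathbf{Cat}$ that sends every homogeneous space $G/H$ ($H\in\mathcal{F}$) to the category $G/H$ (whose objects are the elements of $G/H$ and whose only morphisms are identities), and sends every morphism to the obvious functor. Then the nerve of the Grothendieck construction $\mathbf{Gr}(R)$ is a model for $\mathrm{E}_{\mathcal{F}}G$.
   Context: A $G$-CW-complex $Y$ is a model for $\mathrm{E}_{\mathcal{F}}G$ if the isotropy group of each point of $Y$ belongs to $\mathcal{F}$ and for each $H\in\mathcal{F}$ the fixed-point space $Y^H$ is contractible. The nerve is regarded as a space through its realization, with the $G$-action induced by the left action of $G$ on the homogeneous spaces $G/H$. The orbit category $\mathbf{O}_{\mathcal{F}}$ has as objects the homogeneous spaces $G/H$ with $H\in\mathcal{F}$, and as morphisms the $G$-maps. $\mathbf{Cat}$ is the category of small categories and functors. For a functor $f:\mathcal{D}\to\mathbf{Cat}$ with $\mathcal{D}$ small, the Grothendieck construction $\mathbf{Gr}(f)$ is the category whose objects are pairs $(d,x)$ with $d\in\mathcal{D}$ and $x\in f(d)$, and where a morphism $(d,x)\to(d',x')$ is a pair $(u,v)$ with $u:d\to d'$ a morphism in $\mathcal{D}$ and $v:f(u)(x)\to x'$ a morphism in $f(d')$, with the obvious composition. *)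

theory Defs
  imports "HOL-Homology.Homology" "HOL-Algebra.Left_Coset" "HOL-Algebra.Group_Action"
begin

section \<open>Small categories and functors\<close>

text \<open>\<open>Cmp C v u\<close> is the composite \<open>v \<circ> u\<close>.\<close>

record ('o, 'm) cat =
  Ob :: "'o set"
  Ar :: "'m set"
  Src :: "'m \<Rightarrow> 'o"
  Tgt :: "'m \<Rightarrow> 'o"
  Idn :: "'o \<Rightarrow> 'm"
  Cmp :: "'m \<Rightarrow> 'm \<Rightarrow> 'm"

definition category :: "('o, 'm) cat \<Rightarrow> bool" where
  "category C \<longleftrightarrow>
     (\<forall>u\<in>Ar C. Src C u \<in> Ob C \<and> Tgt C u \<in> Ob C) \<and>
     (\<forall>x\<in>Ob C. Idn C x \<in> Ar C \<and> Src C (Idn C x) = x \<and> Tgt C (Idn C x) = x) \<and>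
     (\<forall>u\<in>Ar C. \<forall>v\<in>Ar C. Tgt C u = Src C v \<longrightarrow>
        Cmp C v u \<in> Ar C \<and> Src C (Cmp C v u) = Src C u \<and> Tgt C (Cmp C v u) = Tgt C v) \<and>
     (\<forall>u\<in>Ar C. Cmp C u (Idn C (Src C u)) = u \<and> Cmp C (Idn C (Tgt C u)) u = u) \<and>
     (\<forall>u\<in>Ar C. \<forall>v\<in>Ar C. \<forall>w\<in>Ar C. Tgt C u = Src C v \<longrightarrow> Tgt C v = Src C w \<longrightarrow>
        Cmp C w (Cmp C v u) = Cmp C (Cmp C w v) u)"

record ('o, 'm, 'p, 'q) fctr =
  FOb :: "'o \<Rightarrow> 'p"
  FAr :: "'m \<Rightarrow> 'q"

text \<open>The components of a functor are required to be extensional, so that equality of functors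
  between given categories is equality of records.\<close>

definition is_functor :: "('o, 'm) cat \<Rightarrow> ('p, 'q) cat \<Rightarrow> ('o, 'm, 'p, 'q) fctr \<Rightarrow> bool" where
  "is_functor C D F \<longleftrightarrow>
     FOb F \<in> Ob C \<rightarrow>\<^sub>E Ob D \<and> FAr F \<in> Ar C \<rightarrow>\<^sub>E Ar D \<and>
     (\<forall>u\<in>Ar C. Src D (FAr F u) = FOb F (Src C u) \<and> Tgt D (FAr F u) = FOb F (Tgt C u)) \<and>
     (\<forall>x\<in>Ob C. FAr F (Idn C x) = Idn D (FOb F x)) \<and>
     (\<forall>u\<in>Ar C. \<forall>v\<in>Ar C. Tgt C u = Src C v \<longrightarrow>
        FAr F (Cmp C v u) = Cmp D (FAr F v) (FAr F u))"

definition fctr_id :: "('o, 'm) cat \<Rightarrow> ('o, 'm, 'o, 'm) fctr" where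
  "fctr_id C = \<lparr>FOb = restrict id (Ob C), FAr = restrict id (Ar C)\<rparr>"

definition fctr_comp ::
  "('o, 'm) cat \<Rightarrow> ('p, 'q, 'r, 's) fctr \<Rightarrow> ('o, 'm, 'p, 'q) fctr \<Rightarrow> ('o, 'm, 'r, 's) fctr" where
  "fctr_comp C \<Psi> \<Phi> =
     \<lparr>FOb = compose (Ob C) (FOb \<Psi>) (FOb \<Phi>), FAr = compose (Ar C) (FAr \<Psi>) (FAr \<Phi>)\<rparr>"

text \<open>The category of those small categories whose objects and arrows are taken from the fixed
  types \<open>'o\<close> and \<open>'m\<close>.  An arrow carries its source and target.\<close>

definition Cat ::
  "(('o, 'm) cat, ('o, 'm) cat \<times> ('o, 'm, 'o, 'm) fctr \<times> ('o, 'm) cat) cat" where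
  "Cat = \<lparr>Ob = {C. category C},
          Ar = {(C, \<Phi>, D). category C \<and> category D \<and> is_functor C D \<Phi>},
          Src = (\<lambda>(C, \<Phi>, D). C),
          Tgt = (\<lambda>(C, \<Phi>, D). D),
          Idn = (\<lambda>C. (C, fctr_id C, C)),
          Cmp = (\<lambda>(D, \<Psi>, E) (C, \<Phi>, D'). (C, fctr_comp C \<Psi> \<Phi>, E))\<rparr>"

text \<open>The Grothendieck construction of \<open>F : D \<rightarrow> Cat\<close>.  A morphism \<open>(d, x) \<rightarrow> (d', x')\<close> is a pair
  \<open>(u, v)\<close>; as the pair alone does not determine \<open>x\<close>, an arrow is stored together with its source
  and target.\<close>

definition Gr ::
  "('d, 'e) cat \<Rightarrow>
   ('d, 'e, ('o, 'm) cat, ('o, 'm) cat \<times> ('o, 'm, 'o, 'm) fctr \<times> ('o, 'm) cat) fctr \<Rightarrow>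
   ('d \<times> 'o, ('d \<times> 'o) \<times> ('e \<times> 'm) \<times> ('d \<times> 'o)) cat" where
  "Gr D F =
     (let act = (\<lambda>u. fst (snd (FAr F u))) in
      \<lparr>Ob = {(d, x). d \<in> Ob D \<and> x \<in> Ob (FOb F d)},
       Ar = {((d, x), (u, v), (d', x')).
               d \<in> Ob D \<and> x \<in> Ob (FOb F d) \<and> d' \<in> Ob D \<and> x' \<in> Ob (FOb F d') \<and>
               u \<in> Ar D \<and> Src D u = d \<and> Tgt D u = d' \<and>
               v \<in> Ar (FOb F d') \<and> Src (FOb F d') v = FOb (act u) x \<and> Tgt (FOb F d') v = x'},
       Src = (\<lambda>(a, (u, v), b). a),
       Tgt = (\<lambda>(a, (u, v), b). b),
       Idn = (\<lambda>(d, x). ((d, x), (Idn D d, Idn (FOb F d) x), (d, x))),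
       Cmp = (\<lambda>(b, (u', v'), (d'', x'')) (a, (u, v), b').
                (a, (Cmp D u' u, Cmp (FOb F d'') v' (FAr (act u') v)), (d'', x'')))\<rparr>)"

text \<open>The identity arrow of \<open>x\<close> is \<open>x\<close> itself.\<close>

definition discrete_cat :: "'o set \<Rightarrow> ('o, 'o) cat" where
  "discrete_cat X = \<lparr>Ob = X, Ar = X, Src = id, Tgt = id, Idn = id, Cmp = (\<lambda>y x. x)\<rparr>"


section \<open>The orbit category and the functor \<open>R\<close>\<close>

definition finite_subgroups :: "('a, 'b) monoid_scheme \<Rightarrow> 'a set set" where
  "finite_subgroups G = {H. subgroup H G \<and> finite H}"

type_synonym 'a orbit_ar = "'a set set \<times> ('a set \<Rightarrow> 'a set) \<times> 'a set set"
type_synonym 'a GrR_ob = "'a set set \<times> 'a set"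
type_synonym 'a GrR_ar = "'a GrR_ob \<times> ('a orbit_ar \<times> 'a set) \<times> 'a GrR_ob"

definition orbit_cat ::
  "('a, 'b) monoid_scheme \<Rightarrow> 'a set set \<Rightarrow>
   ('a set set, 'a orbit_ar) cat" where
  "orbit_cat G \<F> =
     \<lparr>Ob = {lcosets\<^bsub>G\<^esub> H | H. H \<in> \<F>},
      Ar = {(X, f, Y). X \<in> {lcosets\<^bsub>G\<^esub> H | H. H \<in> \<F>} \<and> Y \<in> {lcosets\<^bsub>G\<^esub> H | H. H \<in> \<F>} \<and>
              f \<in> X \<rightarrow>\<^sub>E Y \<and> (\<forall>g\<in>carrier G. \<forall>x\<in>X. f (g <#\<^bsub>G\<^esub> x) = g <#\<^bsub>G\<^esub> f x)},
      Src = (\<lambda>(X, f, Y). X),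
      Tgt = (\<lambda>(X, f, Y). Y),
      Idn = (\<lambda>X. (X, restrict id X, X)),
      Cmp = (\<lambda>(Y, f', Z) (X, f, Y'). (X, compose X f' f, Z))\<rparr>"

definition R_functor ::
  "('a, 'b) monoid_scheme \<Rightarrow> 'a set set \<Rightarrow>
   ('a set set, 'a orbit_ar, ('a set, 'a set) cat,
    ('a set, 'a set) cat \<times> ('a set, 'a set, 'a set, 'a set) fctr \<times> ('a set, 'a set) cat) fctr" where
  "R_functor G \<F> =
     \<lparr>FOb = restrict discrete_cat (Ob (orbit_cat G \<F>)),
      FAr = restrict (\<lambda>(X, f, Y). (discrete_cat X, \<lparr>FOb = f, FAr = f\<rparr>, discrete_cat Y))
              (Ar (orbit_cat G \<F>))\<rparr>"

text \<open>The endofunctor \<open>(G/H, x) \<mapsto> (G/H, g x)\<close> of \<open>Gr R\<close> by which \<open>g\<close> acts.  The component \<open>v\<close>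
  of an arrow is an identity arrow of a discrete category, hence itself a coset.\<close>

definition GrR_translation ::
  "('a, 'b) monoid_scheme \<Rightarrow> 'a set set \<Rightarrow> 'a \<Rightarrow>
   ('a GrR_ob, 'a GrR_ar, 'a GrR_ob, 'a GrR_ar) fctr" where
  "GrR_translation G \<F> g =
     \<lparr>FOb = restrict (\<lambda>(X, x). (X, g <#\<^bsub>G\<^esub> x)) (Ob (Gr (orbit_cat G \<F>) (R_functor G \<F>))),
      FAr = restrict (\<lambda>((X, x), (u, v), (Y, y)).
                ((X, g <#\<^bsub>G\<^esub> x), (u, g <#\<^bsub>G\<^esub> v), (Y, g <#\<^bsub>G\<^esub> y)))
              (Ar (Gr (orbit_cat G \<F>) (R_functor G \<F>)))\<rparr>"


section \<open>Simplicial sets, nerve and geometric realization\<close>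

text \<open>For a monotone map \<open>\<theta> : [m] \<rightarrow> [n]\<close> and an \<open>n\<close>-simplex \<open>x\<close>, \<open>Opr X m \<theta> x\<close> is the
  \<open>m\<close>-simplex \<open>\<theta>\<^sup>* x\<close>.\<close>

record 'x sset =
  Smp :: "nat \<Rightarrow> 'x set"
  Opr :: "nat \<Rightarrow> (nat \<Rightarrow> nat) \<Rightarrow> 'x \<Rightarrow> 'x"

definition ordinal_maps :: "nat \<Rightarrow> nat \<Rightarrow> (nat \<Rightarrow> nat) set" where
  "ordinal_maps m n = {\<theta>. mono_on {..m} \<theta> \<and> \<theta> ` {..m} \<subseteq> {..n}}"

definition simplicial_set :: "'x sset \<Rightarrow> bool" where
  "simplicial_set X \<longleftrightarrow>
     (\<forall>m n. \<forall>\<theta>\<in>ordinal_maps m n. \<forall>x\<in>Smp X n. Opr X m \<theta> x \<in> Smp X m) \<and>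
     (\<forall>n. \<forall>x\<in>Smp X n. Opr X n id x = x) \<and>
     (\<forall>l m n. \<forall>\<eta>\<in>ordinal_maps l m. \<forall>\<theta>\<in>ordinal_maps m n. \<forall>x\<in>Smp X n.
        Opr X l (\<theta> \<circ> \<eta>) x = Opr X l \<eta> (Opr X m \<theta> x))"

text \<open>The poset \<open>[n] = {0 < \<dots> < n}\<close> as a category.\<close>

definition ordinal_cat :: "nat \<Rightarrow> (nat, nat \<times> nat) cat" where
  "ordinal_cat n =
     \<lparr>Ob = {..n}, Ar = {(i, j). i \<le> j \<and> j \<le> n}, Src = fst, Tgt = snd,
      Idn = (\<lambda>i. (i, i)), Cmp = (\<lambda>(j, k) (i, j'). (i, k))\<rparr>"

definition ordinal_fctr :: "nat \<Rightarrow> (nat \<Rightarrow> nat) \<Rightarrow> (nat, nat \<times> nat, nat, nat \<times> nat) fctr" where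
  "ordinal_fctr m \<theta> =
     \<lparr>FOb = restrict \<theta> (Ob (ordinal_cat m)),
      FAr = restrict (\<lambda>(i, j). (\<theta> i, \<theta> j)) (Ar (ordinal_cat m))\<rparr>"

definition nerve :: "('o, 'm) cat \<Rightarrow> (nat, nat \<times> nat, 'o, 'm) fctr sset" where
  "nerve C =
     \<lparr>Smp = (\<lambda>n. {\<sigma>. is_functor (ordinal_cat n) C \<sigma>}),
      Opr = (\<lambda>m \<theta> \<sigma>. fctr_comp (ordinal_cat m) \<sigma> (ordinal_fctr m \<theta>))\<rparr>"

definition nerve_map ::
  "('o, 'm, 'p, 'q) fctr \<Rightarrow> nat \<Rightarrow> (nat, nat \<times> nat, 'o, 'm) fctr \<Rightarrow> (nat, nat \<times> nat, 'p, 'q) fctr" where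
  "nerve_map \<Phi> n \<sigma> = fctr_comp (ordinal_cat n) \<Phi> \<sigma>"

text \<open>The equivalence relation on \<open>S\<close> generated by \<open>r \<subseteq> S \<times> S\<close>.\<close>

definition gen_equiv :: "'x set \<Rightarrow> ('x \<times> 'x) set \<Rightarrow> ('x \<times> 'x) set" where
  "gen_equiv S r = (r \<union> r\<inverse>)\<^sup>* \<inter> S \<times> S"

definition quotient_space :: "'x topology \<Rightarrow> ('x \<times> 'x) set \<Rightarrow> 'x set topology" where
  "quotient_space T E =
     topology (\<lambda>U. U \<subseteq> topspace T // E \<and> openin T {x \<in> topspace T. E `` {x} \<in> U})"

definition simplex_space :: "nat \<Rightarrow> (nat \<Rightarrow> real) topology" where
  "simplex_space n = subtopology (powertop_real UNIV) (standard_simplex n)"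

definition simplex_push :: "nat \<Rightarrow> (nat \<Rightarrow> nat) \<Rightarrow> (nat \<Rightarrow> real) \<Rightarrow> nat \<Rightarrow> real" where
  "simplex_push m \<theta> t = (\<lambda>j. \<Sum>i | i \<le> m \<and> \<theta> i = j. t i)"

text \<open>The disjoint union of the spaces \<open>X\<^sub>n \<times> \<Delta>\<^sup>n\<close>, and the gluing
  \<open>(\<theta>\<^sup>* x, t) \<sim> (x, \<theta>\<^sub>* t)\<close>.\<close>

definition simplices_space :: "'x sset \<Rightarrow> ((nat \<times> 'x) \<times> (nat \<Rightarrow> real)) topology" where
  "simplices_space X = sum_topology (\<lambda>(n, x). simplex_space n) (SIGMA n:UNIV. Smp X n)"

definition realization_rel ::
  "'x sset \<Rightarrow> (((nat \<times> 'x) \<times> (nat \<Rightarrow> real)) \<times> ((nat \<times> 'x) \<times> (nat \<Rightarrow> real))) set" where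
  "realization_rel X =
     gen_equiv (topspace (simplices_space X))
       {(((m, Opr X m \<theta> x), t), ((n, x), simplex_push m \<theta> t)) | m n \<theta> x t.
          \<theta> \<in> ordinal_maps m n \<and> x \<in> Smp X n \<and> t \<in> standard_simplex m}"

definition realization :: "'x sset \<Rightarrow> ((nat \<times> 'x) \<times> (nat \<Rightarrow> real)) set topology" where
  "realization X = quotient_space (simplices_space X) (realization_rel X)"

text \<open>The map \<open>[x, t] \<mapsto> [\<phi> x, t]\<close> induced by a simplicial map \<open>\<phi>\<close>.\<close>

definition realization_map ::
  "'x sset \<Rightarrow> 'y sset \<Rightarrow> (nat \<Rightarrow> 'x \<Rightarrow> 'y) \<Rightarrow>
   ((nat \<times> 'x) \<times> (nat \<Rightarrow> real)) set \<Rightarrow> ((nat \<times> 'y) \<times> (nat \<Rightarrow> real)) set" where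
  "realization_map X Y \<phi> =
     restrict (\<lambda>c. realization_rel Y `` ((\<lambda>((n, x), t). ((n, \<phi> n x), t)) ` c))
       (topspace (realization X))"


section \<open>\<open>G\<close>-CW-complexes and classifying spaces\<close>

text \<open>For \<open>n = 0\<close> the disc is a point and its boundary sphere is empty; for \<open>n > 0\<close> the boundary
  sphere is \<open>nsphere (n - 1)\<close>.\<close>

definition disc :: "nat \<Rightarrow> (nat \<Rightarrow> real) topology" where
  "disc n = subtopology (Euclidean_space n) {x. (\<Sum>i<n. (x i)\<^sup>2) \<le> 1}"

definition bdry_sphere :: "nat \<Rightarrow> (nat \<Rightarrow> real) topology" where
  "bdry_sphere n = subtopology (Euclidean_space n) {x. (\<Sum>i<n. (x i)\<^sup>2) = 1}"

text \<open>The square with \<open>f : A \<rightarrow> X\<close>, \<open>g : A \<rightarrow> B\<close>, \<open>p : X \<rightarrow> Y\<close>, \<open>q : B \<rightarrow> Y\<close> is a pushout of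
  topological spaces: \<open>Y\<close> is, via \<open>p\<close> and \<open>q\<close>, the quotient of the disjoint union of \<open>X\<close> and \<open>B\<close>
  by the equivalence relation generated by \<open>f a \<sim> g a\<close>.\<close>

definition is_pushout ::
  "'w topology \<Rightarrow> 'x topology \<Rightarrow> 'v topology \<Rightarrow> 'y topology \<Rightarrow>
   ('w \<Rightarrow> 'x) \<Rightarrow> ('w \<Rightarrow> 'v) \<Rightarrow> ('x \<Rightarrow> 'y) \<Rightarrow> ('v \<Rightarrow> 'y) \<Rightarrow> bool" where
  "is_pushout A X B Y f g p q \<longleftrightarrow>
     continuous_map A X f \<and> continuous_map A B g \<and> continuous_map X Y p \<and> continuous_map B Y q \<and>
     p ` topspace X \<union> q ` topspace B = topspace Y \<and>
     (\<forall>U. U \<subseteq> topspace Y \<longrightarrow>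
        (openin Y U \<longleftrightarrow>
           openin X {x \<in> topspace X. p x \<in> U} \<and> openin B {b \<in> topspace B. q b \<in> U})) \<and>
     (\<forall>s \<in> topspace X <+> topspace B. \<forall>t \<in> topspace X <+> topspace B.
        case_sum p q s = case_sum p q t \<longleftrightarrow>
          (s, t) \<in> gen_equiv (topspace X <+> topspace B) {(Inl (f a), Inr (g a)) | a. a \<in> topspace A})"

definition G_space ::
  "('a, 'b) monoid_scheme \<Rightarrow> 'y topology \<Rightarrow> ('a \<Rightarrow> 'y \<Rightarrow> 'y) \<Rightarrow> bool" where
  "G_space G Y \<alpha> \<longleftrightarrow>
     group_action G (topspace Y) \<alpha> \<and> (\<forall>g\<in>carrier G. continuous_map Y Y (\<alpha> g))"

text \<open>The disjoint union over \<open>i \<in> I\<close> of the spaces \<open>G/K\<^sub>i \<times> D\<close>, with \<open>G/K\<^sub>i\<close> discrete.\<close>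

definition G_cells ::
  "('a, 'b) monoid_scheme \<Rightarrow> 'i set \<Rightarrow> ('i \<Rightarrow> 'a set) \<Rightarrow> 'd topology \<Rightarrow>
   ('i \<times> ('a set \<times> 'd)) topology" where
  "G_cells G I K D =
     sum_topology (\<lambda>i. prod_topology (discrete_topology (lcosets\<^bsub>G\<^esub> (K i))) D) I"

text \<open>\<open>Z'\<close> arises from its subspace \<open>Z\<close> by attaching equivariant \<open>n\<close>-cells of type \<open>G/K\<^sub>i\<close>,
  \<open>i \<in> I\<close>; the attaching map is the restriction of \<open>Q\<close> to the boundary spheres.  Distinct cells
  have distinct centres, so it is no restriction to index the cells by points of \<open>Y\<close>.\<close>

definition attaches_G_cells ::
  "('a, 'b) monoid_scheme \<Rightarrow> 'y topology \<Rightarrow> ('a \<Rightarrow> 'y \<Rightarrow> 'y) \<Rightarrow> nat \<Rightarrow> 'y set \<Rightarrow> 'y set \<Rightarrow> bool" where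
  "attaches_G_cells G Y \<alpha> n Z Z' \<longleftrightarrow>
     (\<exists>(I :: 'y set) K Q.
        (\<forall>i\<in>I. subgroup (K i) G) \<and>
        (\<forall>g\<in>carrier G. \<forall>(i, x, d) \<in> topspace (G_cells G I K (disc n)).
           Q (i, g <#\<^bsub>G\<^esub> x, d) = \<alpha> g (Q (i, x, d))) \<and>
        is_pushout (G_cells G I K (bdry_sphere n)) (subtopology Y Z)
          (G_cells G I K (disc n)) (subtopology Y Z') Q id id Q)"

text \<open>In the filtration \<open>sk\<close>, \<open>sk n\<close> is the \<open>(n - 1)\<close>-skeleton.\<close>

definition G_CW_complex ::
  "('a, 'b) monoid_scheme \<Rightarrow> 'y topology \<Rightarrow> ('a \<Rightarrow> 'y \<Rightarrow> 'y) \<Rightarrow> bool" where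
  "G_CW_complex G Y \<alpha> \<longleftrightarrow>
     G_space G Y \<alpha> \<and>
     (\<exists>sk :: nat \<Rightarrow> 'y set.
        sk 0 = {} \<and> (\<Union>n. sk n) = topspace Y \<and>
        (\<forall>n. \<forall>g\<in>carrier G. \<alpha> g ` sk n \<subseteq> sk n) \<and>
        (\<forall>n. sk n \<subseteq> sk (Suc n) \<and> attaches_G_cells G Y \<alpha> n (sk n) (sk (Suc n))) \<and>
        (\<forall>U. U \<subseteq> topspace Y \<longrightarrow>
           (openin Y U \<longleftrightarrow> (\<forall>n. openin (subtopology Y (sk n)) (U \<inter> sk n)))))"

definition fixed_points ::
  "'y topology \<Rightarrow> ('a \<Rightarrow> 'y \<Rightarrow> 'y) \<Rightarrow> 'a set \<Rightarrow> 'y set" where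
  "fixed_points Y \<alpha> H = {y \<in> topspace Y. \<forall>h\<in>H. \<alpha> h y = y}"

text \<open>Nonemptiness is stated separately, because \<^const>\<open>contractible_space\<close> holds of the empty
  space.\<close>

definition is_model_E ::
  "('a, 'b) monoid_scheme \<Rightarrow> 'a set set \<Rightarrow> 'y topology \<Rightarrow> ('a \<Rightarrow> 'y \<Rightarrow> 'y) \<Rightarrow> bool" where
  "is_model_E G \<F> Y \<alpha> \<longleftrightarrow>
     G_CW_complex G Y \<alpha> \<and>
     (\<forall>y\<in>topspace Y. stabilizer G \<alpha> y \<in> \<F>) \<and>
     (\<forall>H\<in>\<F>. fixed_points Y \<alpha> H \<noteq> {} \<and> contractible_space (subtopology Y (fixed_points Y \<alpha> H)))"

definition GrR_nerve_action ::
  "('a, 'b) monoid_scheme \<Rightarrow> 'a set set \<Rightarrow> 'a \<Rightarrow>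
   ((nat \<times> (nat, nat \<times> nat, 'a GrR_ob, 'a GrR_ar) fctr) \<times> (nat \<Rightarrow> real)) set \<Rightarrow>
   ((nat \<times> (nat, nat \<times> nat, 'a GrR_ob, 'a GrR_ar) fctr) \<times> (nat \<Rightarrow> real)) set" where
  "GrR_nerve_action G \<F> g =
     (let N = nerve (Gr (orbit_cat G \<F>) (R_functor G \<F>))
      in realization_map N N (nerve_map (GrR_translation G \<F> g)))"


section \<open>Well-definedness of the constructions\<close>


lemma is_functor_id: "category C \<Longrightarrow> is_functor C C (fctr_id C)"
  unfolding is_functor_def category_def fctr_id_def by simp

lemma is_functor_comp:
  assumes "category C" "is_functor C D \<Phi>" "is_functor D E \<Psi>"
  shows "is_functor C E (fctr_comp C \<Psi> \<Phi>)"
proof -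
  have "FOb \<Phi> x \<in> Ob D" if "x \<in> Ob C" for x
    using assms(2) that by (auto simp: is_functor_def)
  moreover have "FAr \<Phi> x \<in> Ar D" if "x \<in> Ar C" for x
    using assms(2) that by (auto simp: is_functor_def)
  ultimately show ?thesis
    using assms unfolding is_functor_def category_def fctr_comp_def
    by (simp add: compose_eq PiE_iff)
qed

lemma fctr_comp_assoc:
  assumes "is_functor C D \<Phi>"
  shows "fctr_comp C X (fctr_comp C \<Psi> \<Phi>) = fctr_comp C (fctr_comp D X \<Psi>) \<Phi>"
proof -
  have "FOb \<Phi> \<in> Ob C \<rightarrow> Ob D" "FAr \<Phi> \<in> Ar C \<rightarrow> Ar D"
    using assms by (auto simp: is_functor_def)
  then show ?thesis
    by (simp add: fctr_comp_def compose_assoc)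
qed

lemma fctr_comp_id:
  assumes "is_functor C D \<Phi>"
  shows "fctr_comp C \<Phi> (fctr_id C) = \<Phi>" "fctr_comp C (fctr_id D) \<Phi> = \<Phi>"
proof -
  have *: "FOb \<Phi> \<in> Ob C \<rightarrow>\<^sub>E Ob D" "FAr \<Phi> \<in> Ar C \<rightarrow>\<^sub>E Ar D"
    using assms by (auto simp: is_functor_def)
  have 1: "compose A f (restrict id A) = f" "compose A (restrict id B) f = f"
    if "f \<in> A \<rightarrow>\<^sub>E B" for f A B
    using that by (auto simp: compose_def PiE_iff intro!: extensionalityI[of _ A])
  show "fctr_comp C \<Phi> (fctr_id C) = \<Phi>" "fctr_comp C (fctr_id D) \<Phi> = \<Phi>"
    by (simp_all add: fctr_comp_def fctr_id_def 1[OF *(1)] 1[OF *(2)])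
qed

lemma category_Cat: "category Cat"
  unfolding category_def[of Cat]
  unfolding Cat_def
  by (auto simp: is_functor_id fctr_comp_assoc intro: is_functor_comp fctr_comp_id)

lemma category_discrete_cat: "category (discrete_cat X)"
  by (simp add: category_def discrete_cat_def)

lemma category_ordinal_cat: "category (ordinal_cat n)"
  by (auto simp: category_def ordinal_cat_def)

lemma is_functor_ordinal_fctr:
  assumes "\<theta> \<in> ordinal_maps m n"
  shows "is_functor (ordinal_cat m) (ordinal_cat n) (ordinal_fctr m \<theta>)"
  using assms
  by (auto simp: is_functor_def ordinal_cat_def ordinal_fctr_def ordinal_maps_def mono_on_def
      image_subset_iff)

lemma simplicial_set_nerve: "simplicial_set (nerve C)"
proof -
  have "ordinal_fctr n id = fctr_id (ordinal_cat n)" for n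
    by (auto simp: ordinal_fctr_def fctr_id_def intro!: restrict_ext)
  moreover have "ordinal_fctr l (\<theta> \<circ> \<eta>) = fctr_comp (ordinal_cat l) (ordinal_fctr m \<theta>) (ordinal_fctr l \<eta>)"
    if "\<eta> \<in> ordinal_maps l m" for l m \<theta> \<eta>
    using that
    by (auto simp: ordinal_fctr_def fctr_comp_def ordinal_cat_def compose_def ordinal_maps_def
        mono_on_def image_subset_iff intro!: restrict_ext)
  ultimately show ?thesis
    unfolding simplicial_set_def nerve_def
    by (simp add: fctr_comp_id is_functor_comp[OF category_ordinal_cat is_functor_ordinal_fctr]
        fctr_comp_assoc[OF is_functor_ordinal_fctr])
qed

lemma (in group) lcosets_translate:
  assumes "subgroup H G" "x \<in> lcosets H" "g \<in> carrier G"
  shows "g <# x \<in> lcosets H"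
  using assms by (auto simp: LCOSETS_def lcos_m_assoc subgroup.subset)

lemma category_orbit_cat:
  assumes "group G" "\<And>H. H \<in> \<F> \<Longrightarrow> subgroup H G"
  shows "category (orbit_cat G \<F>)"
proof -
  interpret group G by fact
  have st: "g <#\<^bsub>G\<^esub> x \<in> lcosets\<^bsub>G\<^esub> H" if "H \<in> \<F>" "x \<in> lcosets\<^bsub>G\<^esub> H" "g \<in> carrier G" for H x g
    using assms(2) lcosets_translate that by blast
  have 1: "compose A f (restrict id A) = f" "compose A (restrict id B) f = f"
    if "f \<in> A \<rightarrow>\<^sub>E B" for f :: "'a set \<Rightarrow> 'a set" and A B
    using that by (auto simp: compose_def PiE_iff intro!: extensionalityI[of _ A])
  have 2: "compose A h (compose A g f) = compose A (compose B h g) f"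
    if "f \<in> A \<rightarrow>\<^sub>E B" for f g h :: "'a set \<Rightarrow> 'a set" and A B
    using that by (intro compose_assoc) auto
  have 3: "compose A g f \<in> A \<rightarrow>\<^sub>E C" if "f \<in> A \<rightarrow>\<^sub>E B" "g \<in> B \<rightarrow>\<^sub>E C"
    for f g :: "'a set \<Rightarrow> 'a set" and A B C
    unfolding PiE_def using that by (auto simp: compose_eq PiE_mem)
  let ?O = "orbit_cat G \<F>"
  have ob: "Ob ?O = {lcosets\<^bsub>G\<^esub> H | H. H \<in> \<F>}" by (simp add: orbit_cat_def)
  have st': "g <#\<^bsub>G\<^esub> x \<in> X" if "X \<in> Ob ?O" "x \<in> X" "g \<in> carrier G" for X x g
    using that st by (auto simp: ob)
  have ar: "(X, f, Y) \<in> Ar ?O \<longleftrightarrow> X \<in> Ob ?O \<and> Y \<in> Ob ?O \<and> f \<in> X \<rightarrow>\<^sub>E Y \<and>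
      (\<forall>g\<in>carrier G. \<forall>x\<in>X. f (g <#\<^bsub>G\<^esub> x) = g <#\<^bsub>G\<^esub> f x)" for X f Y
    by (simp add: orbit_cat_def)
  have rest: "Src ?O (X, f, Y) = X" "Tgt ?O (X, f, Y) = Y" "Idn ?O X = (X, restrict id X, X)"
    "Cmp ?O (Y, f', Z) (X, f, Y') = (X, compose X f' f, Z)" for X f Y f' Z Y'
    by (simp_all add: orbit_cat_def)
  have comp: "(X, compose X f' f, Z) \<in> Ar ?O" if "(X, f, Y) \<in> Ar ?O" "(Y, f', Z) \<in> Ar ?O"
    for X f Y f' Z
  proof -
    have "compose X f' f (g <#\<^bsub>G\<^esub> x) = g <#\<^bsub>G\<^esub> compose X f' f x"
      if "g \<in> carrier G" "x \<in> X" for g x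
    proof -
      have "f x \<in> Y" using \<open>(X, f, Y) \<in> Ar ?O\<close> that by (auto simp: ar)
      then show ?thesis
        using that \<open>(X, f, Y) \<in> Ar ?O\<close> \<open>(Y, f', Z) \<in> Ar ?O\<close> by (simp add: ar compose_eq st')
    qed
    moreover have "X \<in> Ob ?O" "Z \<in> Ob ?O" "f \<in> X \<rightarrow>\<^sub>E Y" "f' \<in> Y \<rightarrow>\<^sub>E Z"
      using that by (simp_all only: ar)
    ultimately show ?thesis by (simp only: ar 3[of f X Y f' Z]) simp
  qed
  show ?thesis
    unfolding category_def[of ?O]
  proof (intro conjI ballI impI)
    fix u assume "u \<in> Ar ?O"
    then obtain X f Y where u: "u = (X, f, Y)" and ufY: "(X, f, Y) \<in> Ar ?O" by (cases u) auto
    then have f: "X \<in> Ob ?O" "Y \<in> Ob ?O" "f \<in> X \<rightarrow>\<^sub>E Y" by (simp_all only: ar)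
    show "Src ?O u \<in> Ob ?O" "Tgt ?O u \<in> Ob ?O" by (simp_all only: u rest f)
    show "Cmp ?O u (Idn ?O (Src ?O u)) = u" "Cmp ?O (Idn ?O (Tgt ?O u)) u = u"
      by (simp_all only: u rest 1[OF f(3)])
  next
    fix X assume "X \<in> Ob ?O"
    then show "Idn ?O X \<in> Ar ?O" "Src ?O (Idn ?O X) = X" "Tgt ?O (Idn ?O X) = X"
      by (auto simp: ar rest st')
  next
    fix u v assume uv: "u \<in> Ar ?O" "v \<in> Ar ?O" "Tgt ?O u = Src ?O v"
    obtain X f Y Y' f' Z where e: "u = (X, f, Y)" "v = (Y', f', Z)" by (cases u, cases v) blast
    with uv have "Y' = Y" by (simp only: rest)
    with uv e have "(X, f, Y) \<in> Ar ?O" "(Y, f', Z) \<in> Ar ?O" by simp_all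
    then have "(X, compose X f' f, Z) \<in> Ar ?O" by (rule comp)
    then show "Cmp ?O v u \<in> Ar ?O" "Src ?O (Cmp ?O v u) = Src ?O u" "Tgt ?O (Cmp ?O v u) = Tgt ?O v"
      by (simp_all only: e rest)
  next
    fix u v w assume uvw: "u \<in> Ar ?O" "v \<in> Ar ?O" "w \<in> Ar ?O" "Tgt ?O u = Src ?O v" "Tgt ?O v = Src ?O w"
    obtain X f Y Y' f' Z Z' f'' W where e: "u = (X, f, Y)" "v = (Y', f', Z)" "w = (Z', f'', W)"
      by (cases u, cases v, cases w) blast
    with uvw have "Y' = Y" "f \<in> X \<rightarrow>\<^sub>E Y" by (simp_all only: rest ar)
    then show "Cmp ?O w (Cmp ?O v u) = Cmp ?O (Cmp ?O w v) u"
      by (simp add: e rest 2)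
  qed
qed

lemma is_functor_R:
  assumes "group G" "\<And>H. H \<in> \<F> \<Longrightarrow> subgroup H G"
  shows "is_functor (orbit_cat G \<F>) Cat (R_functor G \<F>)"
proof -
  let ?O = "orbit_cat G \<F>" and ?R = "R_functor G \<F>"
  have cat: "category ?O" using assms by (rule category_orbit_cat)
  have ar: "FAr ?R (X, f, Y) = (discrete_cat X, \<lparr>FOb = f, FAr = f\<rparr>, discrete_cat Y)"
    if "(X, f, Y) \<in> Ar ?O" for X f Y using that by (simp add: R_functor_def)
  have fn: "is_functor (discrete_cat X) (discrete_cat Y) \<lparr>FOb = f, FAr = f\<rparr>"
    if "(X, f, Y) \<in> Ar ?O" for X f Y
    using that by (auto simp: orbit_cat_def is_functor_def discrete_cat_def)
  show ?thesis
    unfolding is_functor_def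
  proof (intro conjI ballI impI)
    show "FOb ?R \<in> Ob ?O \<rightarrow>\<^sub>E Ob Cat"
      by (auto simp: R_functor_def Cat_def category_discrete_cat)
    show "FAr ?R \<in> Ar ?O \<rightarrow>\<^sub>E Ar Cat"
      using fn by (auto simp: R_functor_def Cat_def category_discrete_cat)
  next
    fix u assume "u \<in> Ar ?O"
    then show "Src Cat (FAr ?R u) = FOb ?R (Src ?O u)" "Tgt Cat (FAr ?R u) = FOb ?R (Tgt ?O u)"
      by (auto simp: R_functor_def Cat_def orbit_cat_def)
  next
    fix X assume X: "X \<in> Ob ?O"
    then have "Idn ?O X \<in> Ar ?O" using cat by (simp add: category_def)
    then show "FAr ?R (Idn ?O X) = Idn Cat (FOb ?R X)"
      using X by (simp add: R_functor_def Cat_def orbit_cat_def fctr_id_def discrete_cat_def)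
  next
    fix u v assume uv: "u \<in> Ar ?O" "v \<in> Ar ?O" "Tgt ?O u = Src ?O v"
    then have "Cmp ?O v u \<in> Ar ?O" using cat by (simp add: category_def)
    with uv show "FAr ?R (Cmp ?O v u) = Cmp Cat (FAr ?R v) (FAr ?R u)"
      by (cases u; cases v)
        (simp add: ar, simp add: R_functor_def Cat_def orbit_cat_def fctr_comp_def discrete_cat_def)
  qed
qed

lemma category_Gr:
  assumes D: "category D" and F: "is_functor D Cat F"
  shows "category (Gr D F)"
proof -
  define act where "act = (\<lambda>u. fst (snd (FAr F u)))"
  have cat: "category (FOb F d)" if "d \<in> Ob D" for d
    using F that by (auto simp: is_functor_def Cat_def)
  have arr: "FAr F u = (FOb F (Src D u), act u, FOb F (Tgt D u)) \<and>
      is_functor (FOb F (Src D u)) (FOb F (Tgt D u)) (act u)" if "u \<in> Ar D" for u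
  proof -
    obtain A \<Phi> B where e: "FAr F u = (A, \<Phi>, B)" by (cases "FAr F u")
    have "FAr F u \<in> Ar Cat" "Src Cat (FAr F u) = FOb F (Src D u)" "Tgt Cat (FAr F u) = FOb F (Tgt D u)"
      using F that by (auto simp: is_functor_def)
    then show ?thesis unfolding e by (auto simp: Cat_def act_def e)
  qed
  have act_id: "act (Idn D d) = fctr_id (FOb F d)" if "d \<in> Ob D" for d
  proof -
    have "FAr F (Idn D d) = Idn Cat (FOb F d)" using F that by (auto simp: is_functor_def)
    then show ?thesis by (simp add: act_def Cat_def)
  qed
  have act_comp: "act (Cmp D v u) = fctr_comp (FOb F (Src D u)) (act v) (act u)"
    if "u \<in> Ar D" "v \<in> Ar D" "Tgt D u = Src D v" for u v
  proof -
    have "FAr F (Cmp D v u) = Cmp Cat (FAr F v) (FAr F u)"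
      using F that by (auto simp: is_functor_def)
    then have "FAr F (Cmp D v u) = (FOb F (Src D u), fctr_comp (FOb F (Src D u)) (act v) (act u), FOb F (Tgt D v))"
      using arr[OF that(1)] arr[OF that(2)] by (simp add: Cat_def)
    then show ?thesis by (simp add: act_def)
  qed
  have D1: "Src D u \<in> Ob D" "Tgt D u \<in> Ob D" if "u \<in> Ar D" for u
    using D that by (auto simp: category_def)
  have D2: "Idn D x \<in> Ar D" "Src D (Idn D x) = x" "Tgt D (Idn D x) = x" if "x \<in> Ob D" for x
    using D that by (auto simp: category_def)
  have D3: "Cmp D v u \<in> Ar D" "Src D (Cmp D v u) = Src D u" "Tgt D (Cmp D v u) = Tgt D v"
    if "u \<in> Ar D" "v \<in> Ar D" "Tgt D u = Src D v" for u v
    using D that by (auto simp: category_def)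
  have D4: "Cmp D u (Idn D (Src D u)) = u" "Cmp D (Idn D (Tgt D u)) u = u" if "u \<in> Ar D" for u
    using D that by (auto simp: category_def)
  have D5: "Cmp D w (Cmp D v u) = Cmp D (Cmp D w v) u"
    if "u \<in> Ar D" "v \<in> Ar D" "w \<in> Ar D" "Tgt D u = Src D v" "Tgt D v = Src D w" for u v w
    using D that by (auto simp: category_def)
  have E2: "Idn (FOb F d) x \<in> Ar (FOb F d)" "Src (FOb F d) (Idn (FOb F d) x) = x"
    "Tgt (FOb F d) (Idn (FOb F d) x) = x" if "d \<in> Ob D" "x \<in> Ob (FOb F d)" for d x
    using cat[OF that(1)] that by (auto simp: category_def)
  have E3: "Cmp (FOb F d) v u \<in> Ar (FOb F d)" "Src (FOb F d) (Cmp (FOb F d) v u) = Src (FOb F d) u"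
    "Tgt (FOb F d) (Cmp (FOb F d) v u) = Tgt (FOb F d) v"
    if "d \<in> Ob D" "u \<in> Ar (FOb F d)" "v \<in> Ar (FOb F d)" "Tgt (FOb F d) u = Src (FOb F d) v" for d u v
    using cat[OF that(1)] that by (auto simp: category_def)
  have E4: "Cmp (FOb F d) u (Idn (FOb F d) (Src (FOb F d) u)) = u"
    "Cmp (FOb F d) (Idn (FOb F d) (Tgt (FOb F d) u)) u = u" if "d \<in> Ob D" "u \<in> Ar (FOb F d)" for d u
    using cat[OF that(1)] that by (auto simp: category_def)
  have E5: "Cmp (FOb F d) w (Cmp (FOb F d) v u) = Cmp (FOb F d) (Cmp (FOb F d) w v) u"
    if "d \<in> Ob D" "u \<in> Ar (FOb F d)" "v \<in> Ar (FOb F d)" "w \<in> Ar (FOb F d)"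
      "Tgt (FOb F d) u = Src (FOb F d) v" "Tgt (FOb F d) v = Src (FOb F d) w" for d u v w
    using cat[OF that(1)] that by (auto simp: category_def)
  have A1: "FOb (act u) x \<in> Ob (FOb F (Tgt D u))" if "u \<in> Ar D" "x \<in> Ob (FOb F (Src D u))" for u x
    using arr[OF that(1)] that(2) by (auto simp: is_functor_def)
  have A2: "FAr (act u) a \<in> Ar (FOb F d)"
    "Src (FOb F d) (FAr (act u) a) = FOb (act u) (Src (FOb F (Src D u)) a)"
    "Tgt (FOb F d) (FAr (act u) a) = FOb (act u) (Tgt (FOb F (Src D u)) a)"
    if "u \<in> Ar D" "Tgt D u = d" "a \<in> Ar (FOb F (Src D u))" for u a d
    using arr[OF that(1)] that(2,3) by (auto simp: is_functor_def)
  have A3: "FAr (act u) (Idn (FOb F (Src D u)) x) = Idn (FOb F (Tgt D u)) (FOb (act u) x)"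
    if "u \<in> Ar D" "x \<in> Ob (FOb F (Src D u))" for u x
    using arr[OF that(1)] that(2) by (auto simp: is_functor_def)
  have A4: "FAr (act u) (Cmp (FOb F (Src D u)) b a) = Cmp (FOb F (Tgt D u)) (FAr (act u) b) (FAr (act u) a)"
    if "u \<in> Ar D" "a \<in> Ar (FOb F (Src D u))" "b \<in> Ar (FOb F (Src D u))"
      "Tgt (FOb F (Src D u)) a = Src (FOb F (Src D u)) b" for u a b
    using arr[OF that(1)] that by (auto simp: is_functor_def)
  have A5: "FOb (act (Cmp D v u)) x = FOb (act v) (FOb (act u) x)"
    if "u \<in> Ar D" "v \<in> Ar D" "Tgt D u = Src D v" "x \<in> Ob (FOb F (Src D u))" for u v x
    using act_comp[OF that(1-3)] that(4) by (simp add: fctr_comp_def compose_eq)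
  have A6: "FAr (act (Cmp D v u)) x = FAr (act v) (FAr (act u) x)"
    if "u \<in> Ar D" "v \<in> Ar D" "Tgt D u = Src D v" "x \<in> Ar (FOb F (Src D u))" for u v x
    using act_comp[OF that(1-3)] that(4) by (simp add: fctr_comp_def compose_eq)
  let ?P = "Gr D F"
  have ob: "Ob ?P = {(d, x). d \<in> Ob D \<and> x \<in> Ob (FOb F d)}" by (simp add: Gr_def Let_def)
  have ars: "w \<in> Ar ?P \<longleftrightarrow> (\<exists>x u v y. w = ((Src D u, x), (u, v), (Tgt D u, y)) \<and> u \<in> Ar D \<and>
      x \<in> Ob (FOb F (Src D u)) \<and> y \<in> Ob (FOb F (Tgt D u)) \<and> v \<in> Ar (FOb F (Tgt D u)) \<and>
      Src (FOb F (Tgt D u)) v = FOb (act u) x \<and> Tgt (FOb F (Tgt D u)) v = y)" for w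
    unfolding Gr_def act_def[symmetric] using D1 by (auto simp: Let_def act_def)
  have src: "Src ?P (a, (u, v), b) = a" and tgt: "Tgt ?P (a, (u, v), b) = b" for a u v b
    by (simp_all add: Gr_def Let_def)
  have idn: "Idn ?P (d, x) = ((d, x), (Idn D d, Idn (FOb F d) x), (d, x))" for d x
    by (simp add: Gr_def Let_def)
  have cmp: "Cmp ?P (b, (u', v'), (d'', x'')) (a, (u, v), b') =
      (a, (Cmp D u' u, Cmp (FOb F d'') v' (FAr (act u') v)), (d'', x''))" for b u' v' d'' x'' a u v b'
    by (simp add: Gr_def Let_def act_def)
  show ?thesis
    unfolding category_def[of ?P]
  proof (intro conjI ballI impI)
    fix w assume "w \<in> Ar ?P"
    then show "Src ?P w \<in> Ob ?P" "Tgt ?P w \<in> Ob ?P"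
      by (auto simp: ars src tgt ob D1)
  next
    fix o1 assume "o1 \<in> Ob ?P"
    then show "Idn ?P o1 \<in> Ar ?P" "Src ?P (Idn ?P o1) = o1" "Tgt ?P (Idn ?P o1) = o1"
      by (auto simp: ars src tgt ob idn D2 E2 act_id fctr_id_def)
  next
    fix w1 w2 assume "w1 \<in> Ar ?P" "w2 \<in> Ar ?P" "Tgt ?P w1 = Src ?P w2"
    then obtain x u v y u' v' z where w: "w1 = ((Src D u, x), (u, v), (Tgt D u, y))"
      "w2 = ((Src D u', y), (u', v'), (Tgt D u', z))" "u \<in> Ar D" "u' \<in> Ar D" "Tgt D u = Src D u'"
      "x \<in> Ob (FOb F (Src D u))" "y \<in> Ob (FOb F (Src D u'))" "v \<in> Ar (FOb F (Src D u'))"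
      "Src (FOb F (Src D u')) v = FOb (act u) x" "Tgt (FOb F (Src D u')) v = y"
      "z \<in> Ob (FOb F (Tgt D u'))" "v' \<in> Ar (FOb F (Tgt D u'))"
      "Src (FOb F (Tgt D u')) v' = FOb (act u') y" "Tgt (FOb F (Tgt D u')) v' = z"
      unfolding ars by (auto simp: src tgt)
    then show "Cmp ?P w2 w1 \<in> Ar ?P" "Src ?P (Cmp ?P w2 w1) = Src ?P w1"
      "Tgt ?P (Cmp ?P w2 w1) = Tgt ?P w2"
      by (simp_all add: cmp src tgt ars D1 D3 E3 A2 A5)
  next
    fix w1 assume "w1 \<in> Ar ?P"
    then show "Cmp ?P w1 (Idn ?P (Src ?P w1)) = w1" "Cmp ?P (Idn ?P (Tgt ?P w1)) w1 = w1"
      by (auto simp: cmp src tgt ars idn D1 D2 D4 A3 act_id fctr_id_def)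
         (metis D1(2) E4)+
  next
    fix w1 w2 w3 assume "w1 \<in> Ar ?P" "w2 \<in> Ar ?P" "w3 \<in> Ar ?P" "Tgt ?P w1 = Src ?P w2"
      "Tgt ?P w2 = Src ?P w3"
    then show "Cmp ?P w3 (Cmp ?P w2 w1) = Cmp ?P (Cmp ?P w3 w2) w1"
      by (auto simp: cmp src tgt ars D1 D3 D5 E3 E5 A2 A4 A5 A6)
  qed
qed

lemma equiv_gen_equiv: "r \<subseteq> S \<times> S \<Longrightarrow> equiv S (gen_equiv S r)"
  unfolding gen_equiv_def
proof (rule equivI)
  show "sym ((r \<union> r\<inverse>)\<^sup>* \<inter> S \<times> S)"
    using sym_rtrancl[OF sym_Un_converse[of r]] by (auto simp: sym_def)
  show "trans ((r \<union> r\<inverse>)\<^sup>* \<inter> S \<times> S)"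
    using trans_rtrancl[of "r \<union> r\<inverse>"] by (auto simp: trans_def)
qed (auto simp: refl_on_def)

lemma openin_quotient_space:
  "openin (quotient_space T E) U \<longleftrightarrow>
     U \<subseteq> topspace T // E \<and> openin T {x \<in> topspace T. E `` {x} \<in> U}"
proof -
  have "istopology (\<lambda>U. U \<subseteq> topspace T // E \<and> openin T {x \<in> topspace T. E `` {x} \<in> U})"
    unfolding istopology_def
  proof (intro conjI allI impI, goal_cases)
    case (2 S U)
    have "{x \<in> topspace T. E `` {x} \<in> S \<inter> U} =
      {x \<in> topspace T. E `` {x} \<in> S} \<inter> {x \<in> topspace T. E `` {x} \<in> U}" by auto
    with 2 show ?case by auto
  next
    case (4 K)
    have "{x \<in> topspace T. E `` {x} \<in> \<Union>K} = (\<Union>U\<in>K. {x \<in> topspace T. E `` {x} \<in> U})" by auto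
    with 4 show ?case by auto
  qed auto
  then show ?thesis by (simp add: quotient_space_def)
qed

lemma topspace_quotient_space: "topspace (quotient_space T E) = topspace T // E"
proof (rule antisym)
  show "topspace (quotient_space T E) \<subseteq> topspace T // E"
    using openin_quotient_space openin_topspace by blast
  have "{x \<in> topspace T. E `` {x} \<in> topspace T // E} = topspace T" by (auto intro: quotientI)
  then have "openin (quotient_space T E) (topspace T // E)"
    by (simp add: openin_quotient_space)
  then show "topspace T // E \<subseteq> topspace (quotient_space T E)" by (rule openin_subset)
qed

lemma quotient_map_quotient_space: "quotient_map T (quotient_space T E) (\<lambda>x. E `` {x})"
  unfolding quotient_map_def topspace_quotient_space
  by (auto simp: openin_quotient_space quotient_def)

lemma bdry_sphere_Suc: "bdry_sphere (Suc n) = nsphere n"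
  by (simp add: bdry_sphere_def nsphere_def lessThan_Suc_atMost)


lemma is_functor_GrR_translation:
  assumes "group G" "\<And>H. H \<in> \<F> \<Longrightarrow> subgroup H G" and g: "g \<in> carrier G"
  defines "P \<equiv> Gr (orbit_cat G \<F>) (R_functor G \<F>)"
  shows "is_functor P P (GrR_translation G \<F> g)"
proof -
  interpret group G by fact
  let ?O = "orbit_cat G \<F>" and ?t = "GrR_translation G \<F> g"
  have "category P"
    unfolding P_def by (intro category_Gr category_orbit_cat is_functor_R assms)
  have st: "g <#\<^bsub>G\<^esub> x \<in> X" if "X \<in> Ob ?O" "x \<in> X" for X x
    using that assms(2) lcosets_translate g by (auto simp: orbit_cat_def)
  have oar: "(X, f, Y) \<in> Ar ?O \<longleftrightarrow> X \<in> Ob ?O \<and> Y \<in> Ob ?O \<and> f \<in> X \<rightarrow>\<^sub>E Y \<and>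
      (\<forall>g\<in>carrier G. \<forall>x\<in>X. f (g <#\<^bsub>G\<^esub> x) = g <#\<^bsub>G\<^esub> f x)" for X f Y
    by (simp add: orbit_cat_def)
  have ob: "Ob P = {(X, x). X \<in> Ob ?O \<and> x \<in> X}"
    by (auto simp: P_def Gr_def Let_def R_functor_def discrete_cat_def)
  have ars: "w \<in> Ar P \<longleftrightarrow> (\<exists>X f Y x. w = ((X, x), ((X, f, Y), f x), (Y, f x)) \<and>
      (X, f, Y) \<in> Ar ?O \<and> x \<in> X)" for w
  proof
    assume "w \<in> Ar P"
    then obtain X x Z f Z' v Y y where w: "w = ((X, x), ((Z, f, Z'), v), (Y, y))"
      and "((X, x), ((Z, f, Z'), v), (Y, y)) \<in> Ar P"
      by (cases w) auto
    then have "X \<in> Ob ?O" "x \<in> Ob (FOb (R_functor G \<F>) X)" "Y \<in> Ob ?O" "(Z, f, Z') \<in> Ar ?O"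
      "Src ?O (Z, f, Z') = X" "Tgt ?O (Z, f, Z') = Y" "Tgt (FOb (R_functor G \<F>) Y) v = y"
      "Src (FOb (R_functor G \<F>) Y) v = FOb (fst (snd (FAr (R_functor G \<F>) (Z, f, Z')))) x"
      by (simp_all add: P_def Gr_def Let_def)
    moreover from this have "Z = X" "Z' = Y" by (simp_all add: orbit_cat_def)
    ultimately show "\<exists>X f Y x. w = ((X, x), ((X, f, Y), f x), (Y, f x)) \<and>
      (X, f, Y) \<in> Ar ?O \<and> x \<in> X"
      unfolding w by (auto simp: R_functor_def discrete_cat_def)
  next
    assume "\<exists>X f Y x. w = ((X, x), ((X, f, Y), f x), (Y, f x)) \<and> (X, f, Y) \<in> Ar ?O \<and> x \<in> X"
    then obtain X f Y x where w: "w = ((X, x), ((X, f, Y), f x), (Y, f x))"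
      "(X, f, Y) \<in> Ar ?O" "x \<in> X" by blast
    then have "X \<in> Ob ?O" "Y \<in> Ob ?O" "f x \<in> Y" by (auto simp: oar)
    moreover have "Src ?O (X, f, Y) = X" "Tgt ?O (X, f, Y) = Y" by (simp_all add: orbit_cat_def)
    ultimately show "w \<in> Ar P"
      using w by (simp add: P_def Gr_def Let_def R_functor_def discrete_cat_def)
  qed
  have src: "Src P (a, u, b) = a" and tgt: "Tgt P (a, u, b) = b" for a u b
    by (simp_all add: P_def Gr_def Let_def split_beta)
  have idn: "Idn P (X, x) = ((X, x), ((X, restrict id X, X), x), (X, x))" if "X \<in> Ob ?O" for X x
    using that by (simp add: P_def Gr_def Let_def R_functor_def discrete_cat_def) (simp add: orbit_cat_def)
  have cmp: "Cmp P (b, ((Y, f', Z), y'), (Z, z)) (a, ((X, f, Y), y), b) =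
      (a, ((X, compose X f' f, Z), f' y), (Z, z))"
    if "(Y, f', Z) \<in> Ar ?O" for X f Y f' Z y y' z a b
  proof -
    have "Z \<in> Ob ?O" using that by (simp add: oar)
    then show ?thesis using that
      by (simp add: P_def Gr_def Let_def R_functor_def discrete_cat_def) (simp add: orbit_cat_def)
  qed
  have tob: "FOb ?t (X, x) = (X, g <#\<^bsub>G\<^esub> x)" if "(X, x) \<in> Ob P" for X x
    using that by (simp add: GrR_translation_def P_def)
  have tar: "FAr ?t ((X, x), (u, v), (Y, y)) =
      ((X, g <#\<^bsub>G\<^esub> x), (u, g <#\<^bsub>G\<^esub> v), (Y, g <#\<^bsub>G\<^esub> y))"
    if "((X, x), (u, v), (Y, y)) \<in> Ar P" for X x u v Y y
    using that by (simp add: GrR_translation_def P_def)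
  show ?thesis
    unfolding is_functor_def
  proof (intro conjI ballI impI)
    have "FOb ?t \<in> extensional (Ob P)" by (simp add: GrR_translation_def P_def)
    moreover have "FOb ?t a \<in> Ob P" if a: "a \<in> Ob P" for a
    proof (cases a)
      case (Pair X x)
      then show ?thesis using a tob[of X x] st[of X x] by (simp add: ob)
    qed
    ultimately show "FOb ?t \<in> Ob P \<rightarrow>\<^sub>E Ob P" by (simp add: PiE_iff)
    have "FAr ?t \<in> extensional (Ar P)" by (simp add: GrR_translation_def P_def)
    moreover have "FAr ?t w \<in> Ar P" if "w \<in> Ar P" for w
    proof -
      from that obtain X f Y x where w: "w = ((X, x), ((X, f, Y), f x), (Y, f x))"
        "(X, f, Y) \<in> Ar ?O" "x \<in> X" unfolding ars by blast
      then have "X \<in> Ob ?O" "f (g <#\<^bsub>G\<^esub> x) = g <#\<^bsub>G\<^esub> f x" using g by (simp_all add: oar)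
      then have "FAr ?t w = ((X, g <#\<^bsub>G\<^esub> x), ((X, f, Y), f (g <#\<^bsub>G\<^esub> x)), (Y, f (g <#\<^bsub>G\<^esub> x)))"
        using that by (simp add: w(1) tar)
      with w(2) st[OF \<open>X \<in> Ob ?O\<close> w(3)] show ?thesis unfolding ars by blast
    qed
    ultimately show "FAr ?t \<in> Ar P \<rightarrow>\<^sub>E Ar P" by (simp add: PiE_iff)
  next
    fix w assume wP: "w \<in> Ar P"
    then obtain X f Y x where w: "w = ((X, x), ((X, f, Y), f x), (Y, f x))"
      "(X, f, Y) \<in> Ar ?O" "x \<in> X" unfolding ars by blast
    then have "(X, x) \<in> Ob P" "(Y, f x) \<in> Ob P" by (auto simp: ob oar)
    then show "Src P (FAr ?t w) = FOb ?t (Src P w)" "Tgt P (FAr ?t w) = FOb ?t (Tgt P w)"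
      using wP by (simp_all add: w(1) tar tob src tgt)
  next
    fix a assume a: "a \<in> Ob P"
    then obtain X x where e: "a = (X, x)" "X \<in> Ob ?O" "x \<in> X" by (auto simp: ob)
    have "Idn P a \<in> Ar P" using \<open>category P\<close> a by (simp add: category_def)
    then show "FAr ?t (Idn P a) = Idn P (FOb ?t a)"
      using a by (simp add: e(1) idn[OF e(2)] tar tob)
  next
    fix w w' assume ww: "w \<in> Ar P" "w' \<in> Ar P" "Tgt P w = Src P w'"
    from ww(1) obtain X f Y x where w: "w = ((X, x), ((X, f, Y), f x), (Y, f x))"
      "(X, f, Y) \<in> Ar ?O" "x \<in> X" unfolding ars by blast
    from ww(2) obtain Y' f' Z y where w': "w' = ((Y', y), ((Y', f', Z), f' y), (Z, f' y))"
      "(Y', f', Z) \<in> Ar ?O" "y \<in> Y'" unfolding ars by blast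
    have [simp]: "Y' = Y" "y = f x" using ww(3) by (simp_all add: w(1) w'(1) src tgt)
    have c: "Cmp P w' w \<in> Ar P" using \<open>category P\<close> ww by (simp add: category_def)
    have o: "(Y, f', Z) \<in> Ar ?O" using w'(2) by simp
    have "f x \<in> Y" using w by (auto simp: oar)
    then have f': "f' (g <#\<^bsub>G\<^esub> f x) = g <#\<^bsub>G\<^esub> f' (f x)" using o g by (simp add: oar)
    show "FAr ?t (Cmp P w' w) = Cmp P (FAr ?t w') (FAr ?t w)"
      using c ww(1,2) by (simp add: w(1) w'(1) tar cmp[OF o] f')
  qed
qed

end

theory Submission
  imports Defs "HOL-Analysis.Abstract_Topological_Spaces"
begin

text \<open>
  A \<open>G\<close>-map out of a transitive \<open>G\<close>-set is determined by one value, so \<open>Gr R\<close> is a preorder and a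
  simplex of its nerve is determined by its vertices.  A point \<open>[x, t]\<close> of the realization of such
  a simplicial set amounts to a step function on \<open>[0,1)\<close>, which takes the value \<open>x\<^sub>i\<close> on the \<open>i\<close>-th of
  the consecutive intervals of lengths \<open>t\<^sub>0, t\<^sub>1, \<dots>\<close>.  This description gives unique normal forms
  (nondegenerate simplex, interior point), hence the \<open>G\<close>-CW-structure with one cell for each
  nondegenerate simplex, and it shows that an element of \<open>G\<close> that fixes an interior point of a simplex
  fixes its vertices.  So isotropy groups are contained in stabilizers of cosets \<open>x \<in> G/H\<close> with \<open>H\<close>
  finite, and the \<open>H\<close>-fixed points are the realization of the nerve of the full subcategory on the
  \<open>(G/K, x)\<close> with \<open>x\<close> fixed by \<open>H\<close>.  That subcategory has the initial object \<open>(G/H, H)\<close>, so its nerve is a cone.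
\<close>

section \<open>Simplices as partitions of the unit interval\<close>

text \<open>The gluing relation is given only by generators, so neither equality of two points nor
  well-definedness of a map can be read off representatives. The step function removes this
  obstacle. Its invariance is checked on a single gluing, where pushing t forward along \<theta>
  merges intervals exactly as \<theta> repeats vertices. For an interior point of a nondegenerate
  simplex every interval is nonempty and every endpoint between two intervals is a genuine jump, so
  the representative can be recovered. A map that transforms step functions is therefore well
  defined: the action changes values, the contraction at time s compresses the function into [s, 1).

  The apex of a cone becomes vertex 0, the place that an initial object can take in a chain of
  arrows. Continuity of the contraction rests on two facts: the realization of the fixed simplices
  carries the quotient topology from those simplices, and the product of that quotient map with the
  locally compact Hausdorff unit interval is again a quotient map.\<close>

lemma simplex_push_sum:
  "sum (simplex_push m \<theta> t) {..j} = sum t {i. i \<le> m \<and> \<theta> i \<le> j}"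
proof -
  have "{i. i \<le> m \<and> \<theta> i \<le> j} = (\<Union>k\<in>{..j}. {i. i \<le> m \<and> \<theta> i = k})" by auto
  then show ?thesis
    unfolding simplex_push_def by (simp add: sum.UNION_disjoint disjoint_iff)
qed

lemma simplex_push_cong:
  "(\<And>i. i \<le> m \<Longrightarrow> \<theta> i = \<eta> i) \<Longrightarrow> simplex_push m \<theta> t = simplex_push m \<eta> t"
  unfolding simplex_push_def by (intro ext arg_cong[where f = "sum t"]) auto

lemma simplex_push_comp:
  assumes "\<And>i. i \<le> l \<Longrightarrow> \<eta> i \<le> m"
  shows "simplex_push l (\<theta> \<circ> \<eta>) t = simplex_push m \<theta> (simplex_push l \<eta> t)"
proof
  fix j
  have "{i. i \<le> l \<and> \<theta> (\<eta> i) = j} = (\<Union>k\<in>{k. k \<le> m \<and> \<theta> k = j}. {i. i \<le> l \<and> \<eta> i = k})"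
    using assms by auto
  then show "simplex_push l (\<theta> \<circ> \<eta>) t j = simplex_push m \<theta> (simplex_push l \<eta> t) j"
    unfolding simplex_push_def by (simp add: sum.UNION_disjoint disjoint_iff)
qed

lemma standard_simplexD:
  assumes "t \<in> standard_simplex n"
  shows "0 \<le> t i" "t i \<le> 1" "n < i \<Longrightarrow> t i = 0" "sum t {..n} = 1"
  using assms by (auto simp: standard_simplex_def)

lemma standard_simplexI:
  assumes "\<And>i. i \<le> n \<Longrightarrow> 0 \<le> t i" "\<And>i. n < i \<Longrightarrow> t i = 0" "sum t {..n} = 1"
  shows "t \<in> standard_simplex n"
proof -
  have "t i \<le> 1" for i
  proof (cases "i \<le> n")
    case True
    then show ?thesis using member_le_sum[of i "{..n}" t] assms by auto
  qed (use assms in auto)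
  moreover have "0 \<le> t i" for i using assms(1,2)[of i] by (cases "i \<le> n") auto
  ultimately show ?thesis using assms(2,3) by (simp add: standard_simplex_def)
qed

lemma simplex_push_id:
  assumes "t \<in> standard_simplex n" shows "simplex_push n id t = t"
proof
  fix j show "simplex_push n id t j = t j"
  proof (cases "j \<le> n")
    case True
    then have "{i. i \<le> n \<and> i = j} = {j}" by auto
    then show ?thesis by (simp add: simplex_push_def)
  next
    case False
    then have "{i. i \<le> n \<and> i = j} = {}" by auto
    with False show ?thesis using standard_simplexD(3)[OF assms] by (simp add: simplex_push_def)
  qed
qed

lemma simplex_push_in_standard_simplex:
  assumes "\<theta> \<in> ordinal_maps m n" "t \<in> standard_simplex m"
  shows "simplex_push m \<theta> t \<in> standard_simplex n"
proof (rule standard_simplexI)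
  show "0 \<le> simplex_push m \<theta> t i" for i
    unfolding simplex_push_def by (intro sum_nonneg standard_simplexD(1)[OF assms(2)])
  show "simplex_push m \<theta> t i = 0" if "n < i" for i
  proof -
    have "{j. j \<le> m \<and> \<theta> j = i} = {}" using assms(1) that by (force simp: ordinal_maps_def)
    then show ?thesis unfolding simplex_push_def by (simp only: sum.empty)
  qed
  have "{i. i \<le> m \<and> \<theta> i \<le> n} = {..m}" using assms(1) by (auto simp: ordinal_maps_def)
  then show "sum (simplex_push m \<theta> t) {..n} = 1"
    unfolding simplex_push_sum using standard_simplexD(4)[OF assms(2)] by simp
qed

lemma topspace_simplex_space [simp]: "topspace (simplex_space n) = standard_simplex n"
  by (simp add: simplex_space_def)

lemma compact_simplex_space: "compact_space (simplex_space n)"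
  unfolding simplex_space_def using compactin_standard_simplex by (rule compact_space_subtopology)

lemma Hausdorff_simplex_space: "Hausdorff_space (simplex_space n)"
  unfolding simplex_space_def
  by (intro Hausdorff_space_subtopology) (simp add: Hausdorff_space_product_topology)

lemma continuous_map_into_simplex_space:
  "continuous_map X (simplex_space n) f \<longleftrightarrow>
     f ` topspace X \<subseteq> standard_simplex n \<and> (\<forall>i. continuous_map X euclideanreal (\<lambda>x. f x i))"
  unfolding simplex_space_def continuous_map_in_subtopology continuous_map_componentwise_UNIV
  by auto

lemma continuous_map_simplex_coordinate: "continuous_map (simplex_space n) euclideanreal (\<lambda>t. t i)"
  using continuous_map_into_simplex_space[of "simplex_space n" n id] by (simp add: continuous_map_id)

lemma continuous_map_simplex_push:
  assumes "\<theta> \<in> ordinal_maps m n"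
  shows "continuous_map (simplex_space m) (simplex_space n) (simplex_push m \<theta>)"
  unfolding continuous_map_into_simplex_space
  using simplex_push_in_standard_simplex[OF assms] unfolding simplex_push_def
  by (auto intro!: continuous_map_sum continuous_map_simplex_coordinate)

text \<open>A continuous map from a compact to a Hausdorff space is closed. This is what lets closed
  subsets of faces be transported into the whole simplex.\<close>

lemma closed_map_simplex_push:
  assumes "\<theta> \<in> ordinal_maps m n"
  shows "closed_map (simplex_space m) (simplex_space n) (simplex_push m \<theta>)"
  by (metis assms compact_simplex_space Hausdorff_simplex_space continuous_map_simplex_push
      continuous_imp_closed_map)

text \<open>A point \<open>t\<close> of a simplex partitions \<open>[0,1)\<close> into consecutive intervals of lengths \<open>t\<^sub>i\<close>;
  \<open>locate t r\<close> is the index of the interval that contains \<open>r\<close>.\<close>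

definition locate :: "(nat \<Rightarrow> real) \<Rightarrow> real \<Rightarrow> nat" where
  "locate t r = (LEAST i. r < sum t {..i})"

lemma locate_eqI:
  assumes "r < sum t {..i}" "\<And>j. j < i \<Longrightarrow> sum t {..j} \<le> r"
  shows "locate t r = i"
  unfolding locate_def by (rule Least_equality) (use assms in \<open>force simp: not_less[symmetric]\<close>)+

lemma locate:
  assumes "t \<in> standard_simplex n" "r < 1"
  shows "locate t r \<le> n" "r < sum t {..locate t r}" "\<And>j. j < locate t r \<Longrightarrow> sum t {..j} \<le> r"
proof -
  have "r < sum t {..n}" using standard_simplexD(4)[OF assms(1)] assms(2) by simp
  then show "locate t r \<le> n" "r < sum t {..locate t r}"
    unfolding locate_def by (auto intro: Least_le LeastI)
  show "\<And>j. j < locate t r \<Longrightarrow> sum t {..j} \<le> r"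
    unfolding locate_def using not_less_Least by force
qed

text \<open>The j-th interval of the pushed-forward partition is the union of the intervals whose
  index is sent to j by \<theta>. Monotonicity of \<theta> makes these consecutive, so the order of
  the partition is kept.\<close>

lemma locate_simplex_push:
  assumes \<theta>: "\<theta> \<in> ordinal_maps m n" and t: "t \<in> standard_simplex m" and r: "0 \<le> r" "r < 1"
  shows "locate (simplex_push m \<theta> t) r = \<theta> (locate t r)"
proof (rule locate_eqI)
  have mono: "\<theta> i \<le> \<theta> j" if "i \<le> j" "j \<le> m" for i j
    using \<theta> that by (auto simp: ordinal_maps_def mono_on_def)
  note l = locate[OF t r(2)]
  have "r < sum t {..locate t r}" by (rule l)
  also have "\<dots> \<le> sum t {i. i \<le> m \<and> \<theta> i \<le> \<theta> (locate t r)}"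
    using l(1) mono by (intro sum_mono2) (auto intro: standard_simplexD(1)[OF t])
  finally show "r < sum (simplex_push m \<theta> t) {..\<theta> (locate t r)}" by (simp add: simplex_push_sum)
  fix j assume j: "j < \<theta> (locate t r)"
  show "sum (simplex_push m \<theta> t) {..j} \<le> r"
  proof (cases "locate t r")
    \<comment> \<open>No index is sent to j or below, so the partial sum is empty; here
      \<open>0 \<le> r\<close> is used.\<close>
    case 0
    then have "{i. i \<le> m \<and> \<theta> i \<le> j} = {}" using j mono[of 0] by force
    then show ?thesis unfolding simplex_push_sum using r by (simp only: sum.empty)
  next
    case (Suc k)
    have "i \<le> k" if "i \<le> m" "\<theta> i \<le> j" for i
    proof (rule ccontr)
      assume "\<not> i \<le> k"
      with Suc have "locate t r \<le> i" by simp
      from mono[OF this that(1)] j that(2) show False by simp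
    qed
    then have "sum t {i. i \<le> m \<and> \<theta> i \<le> j} \<le> sum t {..k}"
      by (intro sum_mono2) (auto intro: standard_simplexD(1)[OF t])
    also have "\<dots> \<le> r" using l(3)[of k] Suc by simp
    finally show ?thesis by (simp add: simplex_push_sum)
  qed
qed

lemma ordinal_maps_comp:
  "\<eta> \<in> ordinal_maps l m \<Longrightarrow> \<theta> \<in> ordinal_maps m n \<Longrightarrow> \<theta> \<circ> \<eta> \<in> ordinal_maps l n"
  unfolding ordinal_maps_def mono_on_def by (auto simp: image_subset_iff)

lemma ordinal_mapsD: "\<theta> \<in> ordinal_maps m n \<Longrightarrow> i \<le> m \<Longrightarrow> \<theta> i \<le> n"
  by (auto simp: ordinal_maps_def)

text \<open>One half of the inductive comparison of two step functions. If the partitions agree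
  before index i, the i-th intervals have a common left endpoint, and evaluating there compares a i
  with b i. If the interval of u reached beyond that of t, then t would jump at a point where u is
  still constant.\<close>

lemma step_function_le:
  assumes t: "t \<in> standard_simplex n" "\<And>i. i \<le> n \<Longrightarrow> 0 < t i" "\<And>i. i < n \<Longrightarrow> a i \<noteq> a (Suc i)"
    and u: "u \<in> standard_simplex m" "\<And>i. i \<le> m \<Longrightarrow> 0 < u i"
    and eq: "\<And>r. 0 \<le> r \<Longrightarrow> r < 1 \<Longrightarrow> a (locate t r) = b (locate u r)"
    and i: "i \<le> n" "i \<le> m" and "\<And>j. j < i \<Longrightarrow> sum t {..j} = sum u {..j}"
  shows "a i = b i \<and> sum u {..i} \<le> sum t {..i}"
proof -
  \<comment> \<open>With positive coordinates no interval is empty: the left endpoint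
    \<open>sum w {..<k}\<close> lies in [0, 1) and belongs to interval k.\<close>
  have part: "locate w (sum w {..<k}) = k \<and> 0 \<le> sum w {..<k} \<and> sum w {..<k} < 1"
    if "w \<in> standard_simplex l" "\<And>i. i \<le> l \<Longrightarrow> 0 < w i" "k \<le> l" for w k l
  proof -
    have 1: "0 < w k" "\<And>i. 0 \<le> w i" using that standard_simplexD[OF that(1)] by auto
    have 2: "sum w {..k} = sum w {..<k} + w k" by (simp add: lessThan_Suc_atMost[symmetric])
    moreover have "sum w {..k} \<le> sum w {..l}" using that 1 by (intro sum_mono2) auto
    ultimately have "sum w {..<k} < 1" using 1 standard_simplexD(4)[OF that(1)] by simp
    moreover have "sum w {..j} \<le> sum w {..<k}" if "j < k" for j
      using 1 that by (intro sum_mono2) auto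
    ultimately show ?thesis using 1 2 by (auto intro!: locate_eqI sum_nonneg)
  qed
  have s: "sum t {..<i} = sum u {..<i}"
    using assms(9)[of "i - 1"] by (cases i) (auto simp: lessThan_Suc_atMost)
  have ab: "a i = b i"
    using part[OF t(1,2) i(1)] part[OF u i(2)] eq[of "sum t {..<i}"] s by simp
  moreover have "sum u {..i} \<le> sum t {..i}"
  proof (rule ccontr)
    assume "\<not> sum u {..i} \<le> sum t {..i}"
    then have lt: "sum t {..i} < sum u {..i}" by simp
    have "sum u {..i} \<le> 1"
      using i standard_simplexD[OF u(1)] sum_mono2[of "{..m}" "{..i}" u] by auto
    then have "i \<noteq> n" using lt standard_simplexD(4)[OF t(1)] by auto
    then have "i < n" using i by simp
    \<comment> \<open>At this point the function of t already has the value
      \<open>a (Suc i)\<close>, whereas that of u still has the value \<open>b i\<close>, which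
      equals \<open>a i\<close>.\<close>
    have p: "locate t (sum t {..i}) = Suc i" "0 \<le> sum t {..i}" "sum t {..i} < 1"
      using part[OF t(1,2), of "Suc i"] \<open>i < n\<close> by (auto simp: lessThan_Suc_atMost)
    have "locate u (sum t {..i}) = i"
    proof (rule locate_eqI[OF lt])
      fix j assume "j < i"
      then have "sum u {..j} = sum t {..j}" using assms(9) by simp
      also have "\<dots> \<le> sum t {..i}"
        using \<open>j < i\<close> standard_simplexD(1)[OF t(1)] by (intro sum_mono2) auto
      finally show "sum u {..j} \<le> sum t {..i}" .
    qed
    then show False using eq[OF p(2,3)] p(1) ab t(3)[OF \<open>i < n\<close>] by simp
  qed
  ultimately show ?thesis by blast
qed

text \<open>Strong induction on the index, with \<open>step_function_le\<close> applied in both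
  directions, makes the right endpoints agree; their differences are the coordinates.\<close>

lemma step_function_unique:
  assumes t: "t \<in> standard_simplex n" "\<And>i. i \<le> n \<Longrightarrow> 0 < t i" "\<And>i. i < n \<Longrightarrow> a i \<noteq> a (Suc i)"
    and u: "u \<in> standard_simplex m" "\<And>i. i \<le> m \<Longrightarrow> 0 < u i" "\<And>i. i < m \<Longrightarrow> b i \<noteq> b (Suc i)"
    and eq: "\<And>r. 0 \<le> r \<Longrightarrow> r < 1 \<Longrightarrow> a (locate t r) = b (locate u r)"
  shows "n = m \<and> t = u \<and> (\<forall>i\<le>n. a i = b i)"
proof -
  have *: "a i = b i \<and> sum t {..i} = sum u {..i}" if "i \<le> n" "i \<le> m" for i
    using that
  proof (induction i rule: less_induct)
    case (less i)
    have "\<And>j. j < i \<Longrightarrow> sum t {..j} = sum u {..j}" using less by simp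
    with step_function_le[OF t u(1,2) eq less.prems] step_function_le[OF u t(1,2) eq[symmetric] less.prems(2,1)]
    show ?case by force
  qed
  \<comment> \<open>A partial sum reaches 1 only at the last index, so neither partition can end
    before the other.\<close>
  have strict: "sum w {..k} < 1" if "w \<in> standard_simplex l" "\<And>i. i \<le> l \<Longrightarrow> 0 < w i" "k < l" for w k l
  proof -
    have "sum w {..k} < sum w {..l}" using that
      by (intro sum_strict_mono2[of _ _ "Suc k"]) (auto intro: less_imp_le)
    then show ?thesis using standard_simplexD(4)[OF that(1)] by simp
  qed
  have nm: "n = m"
  proof (cases n m rule: linorder_cases)
    case less
    then show ?thesis using *[of n] strict[OF u(1,2), of n] standard_simplexD(4)[OF t(1)] by simp
  next
    case greater
    then show ?thesis using *[of m] strict[OF t(1,2), of m] standard_simplexD(4)[OF u(1)] by simp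
  qed simp
  have "t i = u i" for i
  proof (cases "i \<le> n")
    case True
    have s: "w i = sum w {..i} - sum w {..<i}" for w :: "nat \<Rightarrow> real"
      by (simp add: lessThan_Suc_atMost[symmetric])
    have "sum t {..<i} = sum u {..<i}"
      using *[of "i - 1"] True nm by (cases i) (auto simp: lessThan_Suc_atMost)
    then show ?thesis using *[of i] True nm by (simp add: s)
  next
    case False
    then show ?thesis using standard_simplexD(3)[OF t(1)] standard_simplexD(3)[OF u(1)] nm by simp
  qed
  then show ?thesis using * nm by auto
qed

section \<open>Geometric realization and normal forms\<close>

definition realization_point ::
  "'x sset \<Rightarrow> nat \<Rightarrow> 'x \<Rightarrow> (nat \<Rightarrow> real) \<Rightarrow> ((nat \<times> 'x) \<times> (nat \<Rightarrow> real)) set" where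
  "realization_point X n x t = realization_rel X `` {((n, x), t)}"

lemma topspace_simplices_space:
  "topspace (simplices_space X) = {((n, x), t). x \<in> Smp X n \<and> t \<in> standard_simplex n}"
  unfolding simplices_space_def by auto

lemma simplicial_setD:
  assumes "simplicial_set X"
  shows "\<theta> \<in> ordinal_maps m n \<Longrightarrow> x \<in> Smp X n \<Longrightarrow> Opr X m \<theta> x \<in> Smp X m"
    "x \<in> Smp X n \<Longrightarrow> Opr X n id x = x"
    "\<eta> \<in> ordinal_maps l m \<Longrightarrow> \<theta> \<in> ordinal_maps m n \<Longrightarrow> x \<in> Smp X n \<Longrightarrow>
       Opr X l \<eta> (Opr X m \<theta> x) = Opr X l (\<theta> \<circ> \<eta>) x"
  using assms unfolding simplicial_set_def by (blast, blast, metis)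

lemma equiv_realization_rel:
  assumes "simplicial_set X"
  shows "equiv (topspace (simplices_space X)) (realization_rel X)"
  unfolding realization_rel_def
  by (rule equiv_gen_equiv)
    (auto simp: topspace_simplices_space simplicial_setD(1)[OF assms] simplex_push_in_standard_simplex)

lemma topspace_realization:
  "topspace (realization X) = {realization_point X n x t | n x t. x \<in> Smp X n \<and> t \<in> standard_simplex n}"
  unfolding realization_def topspace_quotient_space quotient_def realization_point_def
    topspace_simplices_space by blast

lemma realization_point_in_topspace:
  "x \<in> Smp X n \<Longrightarrow> t \<in> standard_simplex n \<Longrightarrow> realization_point X n x t \<in> topspace (realization X)"
  unfolding topspace_realization by blast

lemma realization_point_Opr:
  assumes X: "simplicial_set X" and "\<theta> \<in> ordinal_maps m n" "x \<in> Smp X n" "t \<in> standard_simplex m"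
  shows "realization_point X m (Opr X m \<theta> x) t = realization_point X n x (simplex_push m \<theta> t)"
proof -
  have "(((m, Opr X m \<theta> x), t), ((n, x), simplex_push m \<theta> t)) \<in> realization_rel X"
    unfolding realization_rel_def gen_equiv_def
    using assms simplicial_setD(1)[OF X assms(2,3)] simplex_push_in_standard_simplex[OF assms(2,4)]
    by (auto simp: topspace_simplices_space intro!: r_into_rtrancl)
  then show ?thesis
    unfolding realization_point_def by (rule equiv_class_eq[OF equiv_realization_rel[OF X]])
qed

lemma quotient_map_realization:
  "quotient_map (simplices_space X) (realization X) (\<lambda>((n, x), t). realization_point X n x t)"
proof -
  have "(\<lambda>((n, x), t). realization_point X n x t) = (\<lambda>p. realization_rel X `` {p})"
    by (auto simp: realization_point_def)
  then show ?thesis unfolding realization_def by (simp only: quotient_map_quotient_space)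
qed

text \<open>The quotient of a disjoint union is tested on each summand, with degenerate simplices
  among them. Closed rather than open sets are used because images of faces are under control only
  for closed sets.\<close>

lemma closedin_realization:
  "closedin (realization X) C \<longleftrightarrow> C \<subseteq> topspace (realization X) \<and>
     (\<forall>n. \<forall>x\<in>Smp X n. closedin (simplex_space n) {t \<in> standard_simplex n. realization_point X n x t \<in> C})"
proof (cases "C \<subseteq> topspace (realization X)")
  case True
  let ?P = "{p \<in> topspace (simplices_space X). (\<lambda>((n, x), t). realization_point X n x t) p \<in> C}"
  have "closedin (realization X) C \<longleftrightarrow> closedin (simplices_space X) ?P"
    using quotient_map_realization[of X] True unfolding quotient_map_closedin by blast
  also have "\<dots> \<longleftrightarrow> (\<forall>n. \<forall>x\<in>Smp X n. closedin (simplex_space n) {t. ((n, x), t) \<in> ?P})"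
    unfolding simplices_space_def closedin_sum_topology by auto
  also have "\<dots> \<longleftrightarrow> (\<forall>n. \<forall>x\<in>Smp X n. closedin (simplex_space n)
      {t \<in> standard_simplex n. realization_point X n x t \<in> C})"
    by (auto simp: topspace_simplices_space)
  finally show ?thesis using True by simp
next
  case False
  then show ?thesis using closedin_subset by blast
qed

lemma continuous_map_realization_point:
  assumes "x \<in> Smp X n"
  shows "continuous_map (simplex_space n) (realization X) (realization_point X n x)"
  unfolding continuous_map_closedin closedin_realization
  using assms realization_point_in_topspace by (auto simp: closedin_realization)

lemma continuous_map_from_realization:
  assumes "\<And>n x. x \<in> Smp X n \<Longrightarrow> continuous_map (simplex_space n) Y (\<lambda>t. f (realization_point X n x t))"
  shows "continuous_map (realization X) Y f"
  unfolding continuous_map_closedin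
proof (intro conjI allI impI)
  show "f \<in> topspace (realization X) \<rightarrow> topspace Y"
    using assms unfolding topspace_realization continuous_map_def by auto
next
  fix C assume "closedin Y C"
  then have *: "closedin (simplex_space n) {t \<in> standard_simplex n. f (realization_point X n x t) \<in> C}"
    if "x \<in> Smp X n" for n x
    using assms[OF that] unfolding continuous_map_closedin by simp
  moreover have "{t \<in> standard_simplex n. f (realization_point X n x t) \<in> C} =
    {t \<in> standard_simplex n. realization_point X n x t \<in> {c \<in> topspace (realization X). f c \<in> C}}"
    if "x \<in> Smp X n" for n x
    using realization_point_in_topspace[OF that] by auto
  ultimately show "closedin (realization X) {c \<in> topspace (realization X). f c \<in> C}"
    unfolding closedin_realization by (metis (no_types, lifting) mem_Collect_eq subsetI)
qed

section \<open>Interiors, faces and degeneracies\<close>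

definition simplex_interior :: "nat \<Rightarrow> (nat \<Rightarrow> real) set" where
  "simplex_interior n = {t \<in> standard_simplex n. \<forall>i\<le>n. 0 < t i}"

lemma id_ordinal: "id \<in> ordinal_maps n n"
  by (simp add: ordinal_maps_def mono_on_def)

definition coface :: "nat \<Rightarrow> nat \<Rightarrow> nat" where
  "coface k i = (if i < k then i else Suc i)"

definition codegeneracy :: "nat \<Rightarrow> nat \<Rightarrow> nat" where
  "codegeneracy k i = (if i \<le> k then i else i - 1)"

lemma coface_ordinal: "coface k \<in> ordinal_maps n (Suc n)"
  by (auto simp: ordinal_maps_def coface_def mono_on_def)

lemma codegeneracy_ordinal: "k \<le> n \<Longrightarrow> codegeneracy k \<in> ordinal_maps (Suc n) n"
  by (auto simp: ordinal_maps_def codegeneracy_def mono_on_def)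

lemma codegeneracy_surj: "k \<le> n \<Longrightarrow> codegeneracy k ` {..Suc n} = {..n}"
proof (intro equalityI subsetI)
  fix i assume "k \<le> n" "i \<in> {..n}"
  then have "i = codegeneracy k (if i \<le> k then i else Suc i)" "(if i \<le> k then i else Suc i) \<in> {..Suc n}"
    by (auto simp: codegeneracy_def)
  then show "i \<in> codegeneracy k ` {..Suc n}" by blast
qed (auto simp: codegeneracy_def)

text \<open>\<open>coface k\<close> is a bijection onto the indices other than k, so dropping the
  vanishing coordinate k loses no mass and pushing forward puts the zero back.\<close>

lemma simplex_push_coface:
  assumes t: "t \<in> standard_simplex (Suc n)" and k: "t k = 0" "k \<le> Suc n"
  shows "t \<circ> coface k \<in> standard_simplex n" "simplex_push n (coface k) (t \<circ> coface k) = t"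
proof -
  have im: "coface k ` {..n} = {..Suc n} - {k}"
  proof (intro equalityI subsetI)
    fix i assume "i \<in> {..Suc n} - {k}"
    then have "i = coface k (if i < k then i else i - 1)" "(if i < k then i else i - 1) \<in> {..n}"
      using k by (auto simp: coface_def)
    then show "i \<in> coface k ` {..n}" by blast
  qed (auto simp: coface_def)
  have inj: "inj (coface k)" by (auto simp: inj_def coface_def split: if_splits)
  show "t \<circ> coface k \<in> standard_simplex n"
  proof (rule standard_simplexI)
    have "sum (t \<circ> coface k) {..n} = sum t (coface k ` {..n})"
      using inj by (subst sum.reindex) (auto intro: inj_on_subset)
    also have "\<dots> = sum t {..Suc n}"
      unfolding im using k by (subst sum_diff1) auto
    finally show "sum (t \<circ> coface k) {..n} = 1" using standard_simplexD(4)[OF t] by simp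
  qed (use k standard_simplexD[OF t] in \<open>auto simp: coface_def\<close>)
  show "simplex_push n (coface k) (t \<circ> coface k) = t"
  proof
    fix j
    show "simplex_push n (coface k) (t \<circ> coface k) j = t j"
    proof (cases "j \<in> coface k ` {..n}")
      case True
      then obtain i where i: "i \<le> n" "j = coface k i" by auto
      then have "{i. i \<le> n \<and> coface k i = j} = {i}" using inj by (auto simp: inj_def)
      then show ?thesis using i by (simp add: simplex_push_def)
    next
      case False
      then have "t j = 0" using k standard_simplexD(3)[OF t, of j] unfolding im by force
      moreover have "{i. i \<le> n \<and> coface k i = j} = {}" using False by auto
      ultimately show ?thesis unfolding simplex_push_def by (simp only: sum.empty)
    qed
  qed
qed

text \<open>Vanishing coordinates are deleted one at a time; the composite of the cofaces is the
  inclusion of the face whose interior contains the point.\<close>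

lemma simplex_interior_face:
  assumes "t \<in> standard_simplex n"
  obtains l \<theta> w where "l \<le> n" "\<theta> \<in> ordinal_maps l n" "w \<in> simplex_interior l" "simplex_push l \<theta> w = t"
  using assms
proof (induction n arbitrary: t thesis)
  case 0
  then have "t \<in> simplex_interior 0" using standard_simplexD(4)[OF 0(2)] by (simp add: simplex_interior_def)
  with simplex_push_id[OF 0(2)] show ?case by (intro 0(1)[of 0 id] id_ordinal) (simp_all add: id_def)
next
  case (Suc n)
  show ?case
  proof (cases "t \<in> simplex_interior (Suc n)")
    case True
    with simplex_push_id[OF Suc.prems(2)] show ?thesis
      by (intro Suc.prems(1)[of "Suc n" id] id_ordinal) (simp_all add: id_def)
  next
    case False
    then obtain k where k: "k \<le> Suc n" "t k = 0"
      using Suc.prems(2) standard_simplexD(1)[OF Suc.prems(2)]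
      by (force simp: simplex_interior_def order_le_less)
    obtain l \<theta> w where lw: "l \<le> n" "\<theta> \<in> ordinal_maps l n" "w \<in> simplex_interior l"
      "simplex_push l \<theta> w = t \<circ> coface k"
      using Suc.IH simplex_push_coface(1)[OF Suc.prems(2) k(2,1)] by blast
    show ?thesis
    proof (rule Suc.prems(1))
      show "coface k \<circ> \<theta> \<in> ordinal_maps l (Suc n)" using lw coface_ordinal by (blast intro: ordinal_maps_comp)
      show "simplex_push l (coface k \<circ> \<theta>) w = t"
        using lw simplex_push_coface(2)[OF Suc.prems(2) k(2,1)]
        by (subst simplex_push_comp[where m = n]) (auto dest: ordinal_mapsD)
    qed (use lw in auto)
  qed
qed

text \<open>By surjectivity each new coordinate is a nonempty sum of positive ones.\<close>

lemma simplex_push_interior: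
  assumes "\<theta> \<in> ordinal_maps m n" "\<theta> ` {..m} = {..n}" "t \<in> simplex_interior m"
  shows "simplex_push m \<theta> t \<in> simplex_interior n"
proof -
  have t: "t \<in> standard_simplex m" using assms(3) by (simp add: simplex_interior_def)
  have "0 < simplex_push m \<theta> t i" if "i \<le> n" for i
  proof -
    have "i \<in> \<theta> ` {..m}" using assms(2) that by simp
    then obtain j where "j \<le> m" "\<theta> j = i" by auto
    then show ?thesis
      unfolding simplex_push_def using assms(3)
      by (intro sum_pos) (auto simp: simplex_interior_def)
  qed
  then show ?thesis using simplex_push_in_standard_simplex[OF assms(1) t] by (simp add: simplex_interior_def)
qed

text \<open>Simplicial sets, such as the nerve of a preorder, in which a simplex is determined by the
  sequence \<open>vx x 0, \<dots>, vx x n\<close> of its vertices.  A simplex is then nondegenerate if and only if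
  consecutive vertices are distinct.\<close>

locale vertex_determined_sset =
  fixes X :: "'x sset" and vx :: "'x \<Rightarrow> nat \<Rightarrow> 'v"
  assumes simplicial: "simplicial_set X"
    and vx_Opr: "\<And>m n \<theta> x i. \<theta> \<in> ordinal_maps m n \<Longrightarrow> x \<in> Smp X n \<Longrightarrow> i \<le> m \<Longrightarrow>
      vx (Opr X m \<theta> x) i = vx x (\<theta> i)"
    and simplex_eqI: "\<And>n x y. x \<in> Smp X n \<Longrightarrow> y \<in> Smp X n \<Longrightarrow> (\<And>i. i \<le> n \<Longrightarrow> vx x i = vx y i) \<Longrightarrow> x = y"
begin

section \<open>Normal forms of points\<close>

abbreviation "pt \<equiv> realization_point X"

definition nondegenerate :: "nat \<Rightarrow> 'x set" where
  "nondegenerate n = {x \<in> Smp X n. \<forall>i<n. vx x i \<noteq> vx x (Suc i)}"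

text \<open>As long as two consecutive vertices coincide, one of them can be omitted and restored by
  a degeneracy. The final clause, that y is also obtained from x by an operator, keeps y in every
  family of simplices that contains x and is closed under operators; the fixed simplices form such a
  family.\<close>

lemma degeneracy_of_nondegenerate:
  assumes "x \<in> Smp X n"
  obtains m \<eta> y where "m \<le> n" "\<eta> \<in> ordinal_maps n m" "\<eta> ` {..n} = {..m}" "y \<in> nondegenerate m" "x = Opr X n \<eta> y"
    "\<exists>\<epsilon>\<in>ordinal_maps m n. y = Opr X m \<epsilon> x"
  using assms
proof (induction n arbitrary: x thesis)
  case 0
  then have "x \<in> nondegenerate 0" by (simp add: nondegenerate_def)
  with simplicial_setD(2)[OF simplicial 0(2)] show ?case
    by (intro 0(1)[of 0 id x] bexI[of _ id] id_ordinal) (simp_all add: id_def)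
next
  case (Suc n)
  show ?case
  proof (cases "x \<in> nondegenerate (Suc n)")
    case True
    with simplicial_setD(2)[OF simplicial Suc.prems(2)] show ?thesis
      by (intro Suc.prems(1)[of "Suc n" id x] bexI[of _ id] id_ordinal) (simp_all add: id_def)
  next
    case False
    then obtain k where k: "k \<le> n" "vx x k = vx x (Suc k)"
      using Suc.prems(2) by (auto simp: nondegenerate_def less_Suc_eq_le)
    let ?x = "Opr X n (coface k) x"
    have x': "?x \<in> Smp X n" using simplicial_setD(1)[OF simplicial coface_ordinal Suc.prems(2)] .
    \<comment> \<open>\<open>coface k \<circ> codegeneracy k\<close> moves only k, to
      \<open>Suc k\<close>, and the vertices k and \<open>Suc k\<close> agree.\<close>
    have "Opr X (Suc n) (codegeneracy k) ?x = x"
    proof (rule simplex_eqI)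
      show "Opr X (Suc n) (codegeneracy k) ?x \<in> Smp X (Suc n)"
        using simplicial_setD(1)[OF simplicial codegeneracy_ordinal[OF k(1)] x'] .
      fix i assume i: "i \<le> Suc n"
      then have "codegeneracy k i \<le> n" using k by (auto simp: codegeneracy_def)
      then have "vx (Opr X (Suc n) (codegeneracy k) ?x) i = vx x (coface k (codegeneracy k i))"
        using i x' codegeneracy_ordinal[OF k(1)] coface_ordinal[of k n] Suc.prems(2) by (simp add: vx_Opr)
      also have "\<dots> = vx x i" using k by (cases "i = k") (auto simp: coface_def codegeneracy_def)
      finally show "vx (Opr X (Suc n) (codegeneracy k) ?x) i = vx x i" .
    qed fact
    moreover obtain m \<eta> y where y: "m \<le> n" "\<eta> \<in> ordinal_maps n m" "\<eta> ` {..n} = {..m}"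
      "y \<in> nondegenerate m" "?x = Opr X n \<eta> y" and "\<exists>\<epsilon>\<in>ordinal_maps m n. y = Opr X m \<epsilon> ?x"
      using Suc.IH[OF _ x'] by blast
    ultimately have "x = Opr X (Suc n) (\<eta> \<circ> codegeneracy k) y"
      using simplicial_setD(3)[OF simplicial codegeneracy_ordinal[OF k(1)] y(2)] y(4)
      by (simp add: nondegenerate_def)
    moreover have "(\<eta> \<circ> codegeneracy k) ` {..Suc n} = {..m}"
      using y(3) codegeneracy_surj[OF k(1)] by (metis image_comp)
    moreover have "\<exists>\<epsilon>\<in>ordinal_maps m (Suc n). y = Opr X m \<epsilon> x"
      using \<open>\<exists>\<epsilon>\<in>ordinal_maps m n. y = Opr X m \<epsilon> ?x\<close>
        simplicial_setD(3)[OF simplicial _ coface_ordinal Suc.prems(2)] ordinal_maps_comp[OF _ coface_ordinal]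
      by metis
    ultimately show ?thesis
      by (intro Suc.prems(1)[OF le_SucI[OF y(1)] ordinal_maps_comp[OF codegeneracy_ordinal[OF k(1)] y(2)] _ y(4)])
  qed
qed

lemma normal_form_exists:
  assumes x: "x \<in> Smp X n" and t: "t \<in> simplex_interior n"
  obtains m \<eta> y where "m \<le> n" "\<eta> \<in> ordinal_maps n m" "y \<in> nondegenerate m" "x = Opr X n \<eta> y"
    "simplex_push n \<eta> t \<in> simplex_interior m" "pt n x t = pt m y (simplex_push n \<eta> t)"
    "\<exists>\<epsilon>\<in>ordinal_maps m n. y = Opr X m \<epsilon> x"
proof -
  obtain m \<eta> y where y: "m \<le> n" "\<eta> \<in> ordinal_maps n m" "\<eta> ` {..n} = {..m}" "y \<in> nondegenerate m"
    "x = Opr X n \<eta> y" "\<exists>\<epsilon>\<in>ordinal_maps m n. y = Opr X m \<epsilon> x"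
    using degeneracy_of_nondegenerate[OF x] .
  show ?thesis
  proof (rule that[OF y(1,2,4,5)])
    show "simplex_push n \<eta> t \<in> simplex_interior m" using simplex_push_interior y t by blast
    show "pt n x t = pt m y (simplex_push n \<eta> t)"
      unfolding y(5) using y t
      by (intro realization_point_Opr[OF simplicial]) (auto simp: nondegenerate_def simplex_interior_def)
  qed (fact y(6))
qed

text \<open>First pass to the face in whose interior the point lies, then collapse repeated vertices
  of that face. The bound on m serves the skeleta, the last clause serves subfamilies of
  simplices.\<close>

lemma normal_form_bounded:
  assumes x: "x \<in> Smp X n" and t: "t \<in> standard_simplex n"
  obtains m y u where "m \<le> n" "y \<in> nondegenerate m" "u \<in> simplex_interior m" "pt n x t = pt m y u"
    "\<exists>\<epsilon>\<in>ordinal_maps m n. y = Opr X m \<epsilon> x"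
proof -
  obtain l \<theta> w where w: "l \<le> n" "\<theta> \<in> ordinal_maps l n" "w \<in> simplex_interior l" "simplex_push l \<theta> w = t"
    using simplex_interior_face[OF t] .
  have "pt n x t = pt l (Opr X l \<theta> x) w"
    using x w by (simp add: realization_point_Opr[OF simplicial] simplex_interior_def)
  moreover obtain m \<eta> y where y: "m \<le> l" "y \<in> nondegenerate m" "simplex_push l \<eta> w \<in> simplex_interior m"
    "pt l (Opr X l \<theta> x) w = pt m y (simplex_push l \<eta> w)"
    "\<exists>\<epsilon>\<in>ordinal_maps m l. y = Opr X m \<epsilon> (Opr X l \<theta> x)"
    using normal_form_exists[OF simplicial_setD(1)[OF simplicial w(2) x] w(3)] .
  moreover have "\<exists>\<epsilon>\<in>ordinal_maps m n. y = Opr X m \<epsilon> x"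
    using y(5) simplicial_setD(3)[OF simplicial _ w(2) x] ordinal_maps_comp[OF _ w(2)] by metis
  ultimately show ?thesis using w(1) by (intro that) auto
qed

lemma normal_form:
  assumes "c \<in> topspace (realization X)"
  obtains m y u where "y \<in> nondegenerate m" "u \<in> simplex_interior m" "c = pt m y u"
proof -
  obtain n x t where "x \<in> Smp X n" "t \<in> standard_simplex n" "c = pt n x t"
    using assms unfolding topspace_realization by blast
  then show ?thesis using normal_form_bounded[of x n t] that by metis
qed

text \<open>For one gluing, \<open>locate_simplex_push\<close> and \<open>vx_Opr\<close> both
  reindex by \<theta>, so the value at r is the same on both sides. Chains of gluings and inverse
  gluings follow by induction.\<close>

lemma step_function_invariant:
  assumes eq: "pt n x t = pt m y u" and x: "x \<in> Smp X n" "t \<in> standard_simplex n"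
    and y: "y \<in> Smp X m" "u \<in> standard_simplex m" and r: "0 \<le> r" "r < 1"
  shows "vx x (locate t r) = vx y (locate u r)"
proof -
  define F :: "(nat \<times> 'x) \<times> (nat \<Rightarrow> real) \<Rightarrow> 'v"
    where "F = (\<lambda>((n, x), t). vx x (locate t r))"
  let ?R = "{(((m, Opr X m \<theta> x), t), ((n, x), simplex_push m \<theta> t)) | m n \<theta> x t.
          \<theta> \<in> ordinal_maps m n \<and> x \<in> Smp X n \<and> t \<in> standard_simplex m}"
  have R: "F p = F q" if "(p, q) \<in> ?R" for p q
    using that r locate(1) by (auto simp: F_def locate_simplex_push vx_Opr)
  have "F p = F q" if "(p, q) \<in> (?R \<union> ?R\<inverse>)\<^sup>*" for p q
    using that
  proof (induction rule: rtrancl_induct)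
    case (step q q')
    then show ?case using R by (metis (no_types, lifting) UnE converseD)
  qed simp
  moreover have "(((n, x), t), ((m, y), u)) \<in> realization_rel X"
    using y by (intro eq_equiv_class[OF eq[unfolded realization_point_def] equiv_realization_rel[OF simplicial]])
      (simp add: topspace_simplices_space)
  ultimately have "F ((n, x), t) = F ((m, y), u)"
    unfolding realization_rel_def gen_equiv_def by blast
  then show ?thesis by (simp add: F_def)
qed

lemma normal_form_unique_step:
  assumes x: "x \<in> nondegenerate n" "t \<in> simplex_interior n" and y: "y \<in> nondegenerate m" "u \<in> simplex_interior m"
    and eq: "\<And>r. 0 \<le> r \<Longrightarrow> r < 1 \<Longrightarrow> vx x (locate t r) = vx y (locate u r)"
  shows "n = m \<and> x = y \<and> t = u"
proof -
  have "n = m \<and> t = u \<and> (\<forall>i\<le>n. vx x i = vx y i)"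
    using x y eq by (intro step_function_unique) (auto simp: nondegenerate_def simplex_interior_def)
  moreover from this have "x = y" using x y by (intro simplex_eqI[of x n]) (auto simp: nondegenerate_def)
  ultimately show ?thesis by blast
qed

lemma normal_form_unique:
  assumes "pt n x t = pt m y u" "x \<in> nondegenerate n" "t \<in> simplex_interior n"
    "y \<in> nondegenerate m" "u \<in> simplex_interior m"
  shows "n = m \<and> x = y \<and> t = u"
  using assms(2-) step_function_invariant[OF assms(1)]
  by (intro normal_form_unique_step) (auto simp: nondegenerate_def simplex_interior_def)

text \<open>Passing to normal forms changes neither step function, and normal forms with the same
  step function coincide. This is the criterion by which maps defined on representatives are shown
  to respect the gluing.\<close>

lemma realization_point_eqI:
  assumes x: "x \<in> Smp X n" "t \<in> standard_simplex n" and y: "y \<in> Smp X m" "u \<in> standard_simplex m"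
    and eq: "\<And>r. 0 \<le> r \<Longrightarrow> r < 1 \<Longrightarrow> vx x (locate t r) = vx y (locate u r)"
  shows "pt n x t = pt m y u"
proof -
  obtain n' x' t' where x': "x' \<in> nondegenerate n'" "t' \<in> simplex_interior n'" "pt n x t = pt n' x' t'"
    using normal_form[OF realization_point_in_topspace[OF x]] .
  obtain m' y' u' where y': "y' \<in> nondegenerate m'" "u' \<in> simplex_interior m'" "pt m y u = pt m' y' u'"
    using normal_form[OF realization_point_in_topspace[OF y]] .
  have "n' = m' \<and> x' = y' \<and> t' = u'"
  proof (rule normal_form_unique_step[OF x'(1,2) y'(1,2)])
    fix r :: real assume r: "0 \<le> r" "r < 1"
    have "vx x (locate t r) = vx x' (locate t' r)" "vx y (locate u r) = vx y' (locate u' r)"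
      using x' y' x y r by (auto intro!: step_function_invariant simp: nondegenerate_def simplex_interior_def)
    then show "vx x' (locate t' r) = vx y' (locate u' r)" using eq[OF r] by simp
  qed
  then show ?thesis using x' y' by simp
qed

text \<open>Each closed simplex is covered by its finitely many faces, on which the given set is the
  preimage of a closed set under a degeneracy.\<close>

lemma closedin_realizationI:
  assumes C: "C \<subseteq> topspace (realization X)"
    and D: "\<And>m y u. y \<in> nondegenerate m \<Longrightarrow> u \<in> simplex_interior m \<Longrightarrow> pt m y u \<in> C \<Longrightarrow>
      closedin (simplex_space m) {v \<in> standard_simplex m. pt m y v \<in> C}"
  shows "closedin (realization X) C"
  unfolding closedin_realization
proof (intro conjI allI ballI)
  fix n x assume x: "x \<in> Smp X n"
  define B where "B l \<theta> = {w \<in> standard_simplex l. pt l (Opr X l \<theta> x) w \<in> C}" for l \<theta>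
  \<comment> \<open>Only the values of \<theta> on \<open>{..l}\<close> matter, and fixing the
    others by extensionality leaves finitely many faces. Keeping just the faces with closed
    \<open>B l \<theta>\<close> loses nothing: each point over C lies in the interior of a face, and
    on that face closedness follows from the assumption on its normal form.\<close>
  define \<Theta> where "\<Theta> l = {\<theta> \<in> {..l} \<rightarrow>\<^sub>E {..n}. \<theta> \<in> ordinal_maps l n \<and> closedin (simplex_space l) (B l \<theta>)}" for l
  have "finite (\<Theta> l)" for l
    unfolding \<Theta>_def by (rule finite_subset[of _ "{..l} \<rightarrow>\<^sub>E {..n}"]) (auto intro: finite_PiE)
  moreover have "closedin (simplex_space n) (simplex_push l \<theta> ` B l \<theta>)" if "\<theta> \<in> \<Theta> l" for l \<theta>
    using that closed_map_simplex_push[of \<theta> l n] by (auto simp: \<Theta>_def closed_map_def)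
  ultimately have "closedin (simplex_space n) (\<Union>\<theta>\<in>\<Theta> l. simplex_push l \<theta> ` B l \<theta>)" for l
    by (intro closedin_Union) auto
  then have "closedin (simplex_space n) (\<Union>l\<in>{..n}. \<Union>\<theta>\<in>\<Theta> l. simplex_push l \<theta> ` B l \<theta>)"
    by (intro closedin_Union) auto
  also have "(\<Union>l\<in>{..n}. \<Union>\<theta>\<in>\<Theta> l. simplex_push l \<theta> ` B l \<theta>) = {t \<in> standard_simplex n. pt n x t \<in> C}"
  proof (intro equalityI subsetI)
    fix t assume "t \<in> (\<Union>l\<in>{..n}. \<Union>\<theta>\<in>\<Theta> l. simplex_push l \<theta> ` B l \<theta>)"
    then obtain l \<theta> w where "\<theta> \<in> ordinal_maps l n" "w \<in> B l \<theta>" "t = simplex_push l \<theta> w"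
      by (auto simp: \<Theta>_def)
    then show "t \<in> {t \<in> standard_simplex n. pt n x t \<in> C}"
      using x realization_point_Opr[OF simplicial, of \<theta> l n x w]
      by (auto simp: B_def simplex_push_in_standard_simplex)
  next
    fix t assume t: "t \<in> {t \<in> standard_simplex n. pt n x t \<in> C}"
    then obtain l \<theta>' w where l: "l \<le> n" "\<theta>' \<in> ordinal_maps l n" "w \<in> simplex_interior l" "simplex_push l \<theta>' w = t"
      using simplex_interior_face[of t n] by blast
    define \<theta> where "\<theta> = restrict \<theta>' {..l}"
    have \<theta>: "\<theta> \<in> ordinal_maps l n" "\<theta> \<in> {..l} \<rightarrow>\<^sub>E {..n}" "simplex_push l \<theta> w = t"
      using l simplex_push_cong[of l \<theta> \<theta>' w] by (auto simp: \<theta>_def ordinal_maps_def mono_on_def)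
    have w: "w \<in> standard_simplex l" using l by (simp add: simplex_interior_def)
    have c: "pt l (Opr X l \<theta> x) w = pt n x t"
      using \<theta> x w by (simp add: realization_point_Opr[OF simplicial])
    have x': "Opr X l \<theta> x \<in> Smp X l" using simplicial_setD(1)[OF simplicial \<theta>(1) x] .
    obtain m \<eta> y where "m \<le> l" "\<exists>\<epsilon>\<in>ordinal_maps m l. y = Opr X m \<epsilon> (Opr X l \<theta> x)" and y: "\<eta> \<in> ordinal_maps l m" "y \<in> nondegenerate m" "Opr X l \<theta> x = Opr X l \<eta> y"
      "simplex_push l \<eta> w \<in> simplex_interior m" "pt l (Opr X l \<theta> x) w = pt m y (simplex_push l \<eta> w)"
      using normal_form_exists[OF x' l(3)] by metis
    have "closedin (simplex_space m) {v \<in> standard_simplex m. pt m y v \<in> C}"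
      using D[OF y(2,4)] y(5) c t by simp
    then have "closedin (simplex_space l) {w \<in> topspace (simplex_space l).
        simplex_push l \<eta> w \<in> {v \<in> standard_simplex m. pt m y v \<in> C}}"
      by (intro closedin_continuous_map_preimage[OF continuous_map_simplex_push[OF y(1)]])
    also have "{w \<in> topspace (simplex_space l). simplex_push l \<eta> w \<in> {v \<in> standard_simplex m. pt m y v \<in> C}} = B l \<theta>"
      using y by (auto simp: B_def nondegenerate_def realization_point_Opr[OF simplicial] simplex_push_in_standard_simplex)
    finally have "\<theta> \<in> \<Theta> l" using \<theta> by (simp add: \<Theta>_def)
    moreover have "w \<in> B l \<theta>" using w c t by (simp add: B_def)
    ultimately show "t \<in> (\<Union>l\<in>{..n}. \<Union>\<theta>\<in>\<Theta> l. simplex_push l \<theta> ` B l \<theta>)"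
      using l(1) \<theta>(3) by blast
  qed
  finally show "closedin (simplex_space n) {t \<in> standard_simplex n. pt n x t \<in> C}" .
qed fact

end

section \<open>The disc as a simplex\<close>

text \<open>The disc is mapped homeomorphically onto the standard simplex by identifying \<open>\<real>\<^sup>n\<close> with the
  hyperplane of vectors \<open>v\<close> with coordinate sum \<open>0\<close> and rescaling along rays so that the Euclidean
  norm becomes the gauge \<open>max\<^sub>i (- v\<^sub>i)\<close>; the barycentre is the centre.\<close>

definition hyperplane_point :: "nat \<Rightarrow> (nat \<Rightarrow> real) \<Rightarrow> nat \<Rightarrow> real" where
  "hyperplane_point n d i = (if i < n then d i else if i = n then - sum d {..<n} else 0)"

definition simplex_gauge :: "nat \<Rightarrow> (nat \<Rightarrow> real) \<Rightarrow> real" where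
  "simplex_gauge n v = Max ((\<lambda>i. - v i) ` {..n})"

definition disc_norm :: "nat \<Rightarrow> (nat \<Rightarrow> real) \<Rightarrow> real" where
  "disc_norm n d = sqrt (\<Sum>i<n. (d i)\<^sup>2)"

text \<open>The factor gives the vector gauge \<open>disc_norm n d\<close>, so that the least
  coordinate of the image is \<open>(1 - disc_norm n d) / (n + 1)\<close>; the boundary sphere thus
  goes to the boundary of the simplex. At the centre 0 / 0 = 0 yields the barycentre.\<close>

definition disc_to_simplex :: "nat \<Rightarrow> (nat \<Rightarrow> real) \<Rightarrow> nat \<Rightarrow> real" where
  "disc_to_simplex n d i =
     (if i \<le> n
      then (1 + hyperplane_point n d i * (disc_norm n d / simplex_gauge n (hyperplane_point n d))) / (n + 1)
      else 0)"

lemma sum_hyperplane_point: "sum (hyperplane_point n d) {..n} = 0"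
proof -
  have "sum (hyperplane_point n d) {..<n} = sum d {..<n}"
    by (intro sum.cong) (auto simp: hyperplane_point_def)
  then show ?thesis by (simp add: lessThan_Suc_atMost[symmetric] hyperplane_point_def)
qed

lemma simplex_gauge_ge: "i \<le> n \<Longrightarrow> - v i \<le> simplex_gauge n v"
  unfolding simplex_gauge_def by (intro Max_ge) auto

lemma simplex_gauge_attained: "\<exists>i\<le>n. simplex_gauge n v = - v i"
proof -
  have "simplex_gauge n v \<in> (\<lambda>i. - v i) ` {..n}" unfolding simplex_gauge_def by (intro Max_in) auto
  then show ?thesis by auto
qed

text \<open>Negative coordinates are bounded by the gauge itself. A positive coordinate is balanced
  by the other n coordinates, each at least minus the gauge, and so is at most n times the
  gauge.\<close>

lemma abs_le_simplex_gauge: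
  assumes "sum v {..n} = 0" "i \<le> n"
  shows "\<bar>v i\<bar> \<le> (real n + 1) * simplex_gauge n v"
proof -
  let ?g = "simplex_gauge n v"
  have "0 = (\<Sum>j\<le>n. - v j)" using assms(1) by (simp add: sum_negf)
  also have "\<dots> \<le> (\<Sum>j\<le>n. ?g)" by (intro sum_mono simplex_gauge_ge) simp
  finally have g: "0 \<le> ?g" by (simp add: zero_le_mult_iff)
  have "v i = - (\<Sum>j\<in>{..n} - {i}. v j)" using assms by (simp add: sum_diff1)
  also have "\<dots> = (\<Sum>j\<in>{..n} - {i}. - v j)" by (simp add: sum_negf)
  also have "\<dots> \<le> (\<Sum>j\<in>{..n} - {i}. ?g)" by (intro sum_mono simplex_gauge_ge) simp
  also have "\<dots> = n * ?g" using assms(2) by (simp add: card_Diff_singleton)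
  finally have "v i \<le> n * ?g" .
  moreover have "- v i \<le> ?g" using assms(2) by (rule simplex_gauge_ge)
  moreover have "0 \<le> n * ?g" using g by simp
  moreover have "(real n + 1) * ?g = n * ?g + ?g" by (simp add: algebra_simps)
  ultimately show ?thesis using g by linarith
qed

lemma simplex_gauge_nonneg:
  assumes "sum v {..n} = 0" shows "0 \<le> simplex_gauge n v"
proof -
  have "0 \<le> (real n + 1) * simplex_gauge n v" using abs_le_simplex_gauge[OF assms, of 0] by linarith
  then show ?thesis by (simp add: zero_le_mult_iff)
qed

lemma simplex_gauge_pos:
  assumes "sum v {..n} = 0" "i \<le> n" "v i \<noteq> 0" shows "0 < simplex_gauge n v"
proof -
  have "0 < (real n + 1) * simplex_gauge n v"
    using abs_le_simplex_gauge[OF assms(1,2)] assms(3) by linarith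
  then show ?thesis by (simp add: zero_less_mult_iff)
qed

lemma simplex_gauge_scale:
  assumes "0 \<le> c" shows "simplex_gauge n (\<lambda>i. c * v i) = c * simplex_gauge n v"
proof -
  have "mono (\<lambda>x. c * x)" using assms by (auto intro!: monoI mult_left_mono)
  then have "c * Max ((\<lambda>i. - v i) ` {..n}) = Max ((\<lambda>x. c * x) ` (\<lambda>i. - v i) ` {..n})"
    by (intro mono_Max_commute) auto
  then show ?thesis by (simp add: simplex_gauge_def image_image)
qed

lemma disc_norm_scale: "0 \<le> c \<Longrightarrow> disc_norm n (\<lambda>i. c * d i) = c * disc_norm n d"
  unfolding disc_norm_def by (simp add: power_mult_distrib real_sqrt_mult flip: sum_distrib_left)

lemma disc_norm_nonneg: "0 \<le> disc_norm n d"
  by (simp add: disc_norm_def sum_nonneg)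

lemma disc_norm_cong: "(\<And>i. i < n \<Longrightarrow> d i = e i) \<Longrightarrow> disc_norm n d = disc_norm n e"
  by (simp add: disc_norm_def)

lemma disc_norm_eq_0: "disc_norm n d = 0 \<longleftrightarrow> (\<forall>i<n. d i = 0)"
  by (auto simp: disc_norm_def sum_nonneg_eq_0_iff)

lemma topspace_disc: "topspace (disc n) = {d. (\<forall>i\<ge>n. d i = 0) \<and> disc_norm n d \<le> 1}"
  by (auto simp: disc_def topspace_Euclidean_space disc_norm_def)

lemma topspace_bdry_sphere: "topspace (bdry_sphere n) = {d. (\<forall>i\<ge>n. d i = 0) \<and> disc_norm n d = 1}"
  by (auto simp: bdry_sphere_def topspace_Euclidean_space disc_norm_def)

lemma hyperplane_gauge_pos:
  assumes "disc_norm n d \<noteq> 0" shows "0 < simplex_gauge n (hyperplane_point n d)"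
proof -
  obtain i where "i < n" "d i \<noteq> 0" using assms by (auto simp: disc_norm_eq_0)
  then show ?thesis
    by (intro simplex_gauge_pos[OF sum_hyperplane_point, of i]) (auto simp: hyperplane_point_def)
qed

text \<open>With \<open>disc_to_simplex_min\<close> this computes the least barycentric coordinate
  of the image. That number recovers the norm of d and tells interior points from boundary
  points.\<close>

lemma disc_to_simplex_ge:
  assumes "i \<le> n" shows "(1 - disc_norm n d) / (n + 1) \<le> disc_to_simplex n d i"
proof -
  let ?g = "simplex_gauge n (hyperplane_point n d)"
  have "- disc_norm n d \<le> hyperplane_point n d i * (disc_norm n d / ?g)"
  proof (cases "disc_norm n d = 0")
    case False
    have "- hyperplane_point n d i * (disc_norm n d / ?g) \<le> ?g * (disc_norm n d / ?g)"
      using hyperplane_gauge_pos[OF False] disc_norm_nonneg[of n d] simplex_gauge_ge[OF assms]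
      by (intro mult_right_mono) auto
    then show ?thesis using hyperplane_gauge_pos[OF False] by simp
  qed simp
  then show ?thesis using assms unfolding disc_to_simplex_def by (simp add: divide_le_cancel)
qed

lemma disc_to_simplex_min: "\<exists>i\<le>n. disc_to_simplex n d i = (1 - disc_norm n d) / (n + 1)"
proof -
  let ?g = "simplex_gauge n (hyperplane_point n d)"
  obtain i where i: "i \<le> n" "?g = - hyperplane_point n d i" using simplex_gauge_attained by blast
  then have "hyperplane_point n d i * (disc_norm n d / ?g) = - disc_norm n d"
    using hyperplane_gauge_pos[of n d] by (cases "disc_norm n d = 0") auto
  then have "disc_to_simplex n d i = (1 - disc_norm n d) / (n + 1)"
    using i(1) by (simp only: disc_to_simplex_def if_True) simp
  with i show ?thesis by blast
qed

lemma disc_to_simplex_in_standard_simplex: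
  assumes "d \<in> topspace (disc n)" shows "disc_to_simplex n d \<in> standard_simplex n"
proof (rule standard_simplexI)
  fix i assume "i \<le> n"
  have "0 \<le> (1 - disc_norm n d) / (n + 1)" using assms by (simp add: topspace_disc)
  also have "\<dots> \<le> disc_to_simplex n d i" using \<open>i \<le> n\<close> by (rule disc_to_simplex_ge)
  finally show "0 \<le> disc_to_simplex n d i" .
next
  let ?c = "disc_norm n d / simplex_gauge n (hyperplane_point n d)"
  have "sum (disc_to_simplex n d) {..n} = (\<Sum>i\<le>n. (1 + hyperplane_point n d i * ?c) / (n + 1))"
    by (intro sum.cong) (auto simp: disc_to_simplex_def)
  also have "\<dots> = (\<Sum>i\<le>n. 1 + hyperplane_point n d i * ?c) / (n + 1)"
    by (rule sum_divide_distrib[symmetric])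
  also have "(\<Sum>i\<le>n. 1 + hyperplane_point n d i * ?c) = (n + 1) + sum (hyperplane_point n d) {..n} * ?c"
    unfolding sum_distrib_right by (simp add: sum.distrib)
  finally show "sum (disc_to_simplex n d) {..n} = 1" by (simp add: sum_hyperplane_point)
qed (simp add: disc_to_simplex_def)

lemma disc_to_simplex_interior_iff:
  assumes "d \<in> topspace (disc n)"
  shows "disc_to_simplex n d \<in> simplex_interior n \<longleftrightarrow> d \<notin> topspace (bdry_sphere n)"
proof -
  have n1: "0 < real n + 1" by simp
  have "disc_to_simplex n d \<in> simplex_interior n \<longleftrightarrow> (\<forall>i\<le>n. 0 < disc_to_simplex n d i)"
    using disc_to_simplex_in_standard_simplex[OF assms] by (simp add: simplex_interior_def)
  also have "\<dots> \<longleftrightarrow> 0 < (1 - disc_norm n d) / (n + 1)"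
    using disc_to_simplex_min[of n d] disc_to_simplex_ge[of _ n d] by (metis less_le_trans)
  also have "\<dots> \<longleftrightarrow> d \<notin> topspace (bdry_sphere n)"
    using assms n1 by (auto simp: topspace_disc topspace_bdry_sphere zero_less_divide_iff)
  finally show ?thesis .
qed

text \<open>Equal least coordinates give equal norms. The remaining coordinates then show that d and
  e lie on one ray, and vectors of equal norm on a ray coincide.\<close>

lemma inj_on_disc_to_simplex: "inj_on (disc_to_simplex n) (topspace (disc n))"
proof (rule inj_onI)
  fix d e assume d: "d \<in> topspace (disc n)" and e: "e \<in> topspace (disc n)"
    and eq: "disc_to_simplex n d = disc_to_simplex n e"
  let ?g = "\<lambda>d. simplex_gauge n (hyperplane_point n d)"
  have n1: "0 < real n + 1" by simp
  obtain i j where ij: "i \<le> n" "disc_to_simplex n d i = (1 - disc_norm n d) / (n + 1)"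
    "j \<le> n" "disc_to_simplex n e j = (1 - disc_norm n e) / (n + 1)"
    using disc_to_simplex_min by metis
  have "(1 - disc_norm n d) / (n + 1) = (1 - disc_norm n e) / (n + 1)"
    using disc_to_simplex_ge[OF ij(1), of e] disc_to_simplex_ge[OF ij(3), of d] ij eq by simp
  then have r: "disc_norm n d = disc_norm n e" using n1 by simp
  have "d i = e i" if "i < n" for i
  proof (cases "disc_norm n d = 0")
    case True
    then show ?thesis using r that by (metis disc_norm_eq_0)
  next
    case False
    note gd = hyperplane_gauge_pos[OF False] and ge = hyperplane_gauge_pos[OF False[unfolded r]]
    define c where "c = ?g d / ?g e"
    have c: "0 < c" using gd ge by (simp add: c_def)
    have sc: "d i = c * e i" if "i < n" for i
    proof -
      have "disc_to_simplex n d i = disc_to_simplex n e i" using eq by simp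
      then have "d i * (disc_norm n d / ?g d) = e i * (disc_norm n e / ?g e)"
        using that n1 by (simp add: disc_to_simplex_def hyperplane_point_def)
      then show ?thesis using False r gd ge by (simp add: c_def field_simps)
    qed
    then have "disc_norm n d = c * disc_norm n e"
      using disc_norm_cong[of n d "\<lambda>i. c * e i"] c by (simp add: disc_norm_scale)
    then have "c = 1" using False r by simp
    then show ?thesis using sc that by simp
  qed
  then show "d = e" using d e by (auto simp: topspace_disc) (metis ext not_le)
qed

text \<open>The inverse map: \<open>(n + 1) * t i - 1\<close> is the displacement from the
  barycentre, up to the factor n + 1, and it is rescaled so that its gauge becomes the Euclidean
  norm.\<close>

lemma disc_to_simplex_surj: "standard_simplex n \<subseteq> disc_to_simplex n ` topspace (disc n)"
proof
  fix t assume t: "t \<in> standard_simplex n"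
  define v where "v i = (if i \<le> n then (n + 1) * t i - 1 else 0)" for i
  have "sum v {..n} = (\<Sum>i\<le>n. (n + 1) * t i - 1)" by (intro sum.cong) (auto simp: v_def)
  also have "\<dots> = (n + 1) * sum t {..n} - (n + 1)"
    by (simp add: sum_subtractf sum_distrib_left)
  finally have v0: "sum v {..n} = 0" using standard_simplexD(4)[OF t] by simp
  have vn: "v n = - sum v {..<n}" using v0 by (simp add: lessThan_Suc_atMost[symmetric])
  have tv: "t i = (if i \<le> n then (1 + v i) / (n + 1) else 0)" for i
    using standard_simplexD(3)[OF t] by (auto simp: v_def field_simps)
  \<comment> \<open>This inverts the rescaling in \<open>disc_to_simplex\<close>. For the barycentre
    it is 0 by the convention on division, and d is then the centre.\<close>
  define c where "c = simplex_gauge n v / disc_norm n v"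
  define d where "d i = (if i < n then c * v i else 0)" for i
  have c0: "0 \<le> c" using simplex_gauge_nonneg[OF v0] disc_norm_nonneg by (simp add: c_def)
  have hd: "hyperplane_point n d = (\<lambda>i. c * v i)"
  proof
    fix i show "hyperplane_point n d i = c * v i"
    proof (cases i n rule: linorder_cases)
      case equal
      have "sum d {..<n} = c * sum v {..<n}" by (simp add: d_def sum_distrib_left)
      with equal show ?thesis by (simp add: hyperplane_point_def vn)
    qed (auto simp: hyperplane_point_def d_def v_def)
  qed
  have nd: "disc_norm n d = c * disc_norm n v"
    using disc_norm_cong[of n d "\<lambda>i. c * v i"] c0 by (simp add: disc_norm_scale d_def)
  have zero: "v i = 0" if "disc_norm n v = 0" for i
  proof -
    have "\<forall>i<n. v i = 0" using that by (simp add: disc_norm_eq_0)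
    then show ?thesis using vn by (cases i n rule: linorder_cases) (auto simp: v_def)
  qed
  have "disc_norm n d \<le> 1"
  proof (cases "disc_norm n v = 0")
    case False
    \<comment> \<open>The norm of d is the gauge of v, which is at most 1 because
      \<open>v i \<ge> -1\<close> is just \<open>t i \<ge> 0\<close>.\<close>
    obtain i where "i \<le> n" "simplex_gauge n v = - v i" using simplex_gauge_attained by blast
    then show ?thesis using False standard_simplexD(1)[OF t, of i] by (simp add: nd c_def v_def)
  qed (simp add: nd)
  then have "d \<in> topspace (disc n)" by (simp add: topspace_disc d_def)
  moreover have "disc_to_simplex n d i = t i" for i
  proof (cases "disc_norm n v = 0")
    case True
    then show ?thesis using zero by (simp add: disc_to_simplex_def tv nd)
  next
    case False
    then obtain j where "j < n" "v j \<noteq> 0" by (auto simp: disc_norm_eq_0)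
    then have "0 < simplex_gauge n v" using simplex_gauge_pos[OF v0, of j] by simp
    moreover from this have "0 < c" using False disc_norm_nonneg[of n v] by (simp add: c_def)
    ultimately have "c * v i * (disc_norm n d / simplex_gauge n (hyperplane_point n d)) = v i"
      using False by (simp add: hd nd simplex_gauge_scale) (simp add: c_def)
    then show ?thesis unfolding disc_to_simplex_def tv hd[symmetric] by (simp add: hd)
  qed
  then have "disc_to_simplex n d = t" by blast
  ultimately show "t \<in> disc_to_simplex n ` topspace (disc n)" by blast
qed

section \<open>Continuity and compactness for the disc\<close>

lemma continuous_map_product_coordinate:
  "continuous_map (powertop_real UNIV) euclideanreal (\<lambda>d. d i)"
  using continuous_map_product_projection[of i UNIV "\<lambda>_. euclideanreal"] by simp

lemma continuous_map_disc_coordinate: "continuous_map (disc n) euclideanreal (\<lambda>d. d i)"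
  unfolding disc_def Euclidean_space_def
  by (intro continuous_map_from_subtopology continuous_map_product_coordinate)

lemma continuous_map_Max_atMost:
  fixes f :: "nat \<Rightarrow> 'a \<Rightarrow> real"
  assumes "\<And>i. continuous_map X euclideanreal (f i)"
  shows "continuous_map X euclideanreal (\<lambda>x. Max ((\<lambda>i. f i x) ` {..n}))"
  by (induction n) (use assms in \<open>auto simp: atMost_Suc intro!: continuous_map_real_max\<close>)

text \<open>Away from the centre the gauge is nonzero and every ingredient is continuous. At the
  centre the quotient of norm and gauge has no evident limit, and a bound on the whole displacement
  takes over.\<close>

lemma continuous_map_disc_to_simplex: "continuous_map (disc n) (simplex_space n) (disc_to_simplex n)"
proof -
  let ?g = "\<lambda>d. simplex_gauge n (hyperplane_point n d)"
  have hc: "continuous_map (disc n) euclideanreal (\<lambda>d. hyperplane_point n d i)" for i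
    unfolding hyperplane_point_def
    by (cases "i < n"; cases "i = n")
      (auto intro!: continuous_intros continuous_map_disc_coordinate)
  have gc: "continuous_map (disc n) euclideanreal ?g"
    unfolding simplex_gauge_def by (intro continuous_map_Max_atMost continuous_map_minus hc)
  have nc: "continuous_map (disc n) euclideanreal (disc_norm n)"
    unfolding disc_norm_def
    by (auto intro!: continuous_map_sqrt continuous_map_sum continuous_map_real_pow continuous_map_disc_coordinate)
  have lim: "(f \<longlongrightarrow> f d) (atin (disc n) d)"
    if "continuous_map (disc n) euclideanreal f" "d \<in> topspace (disc n)" for f :: "_ \<Rightarrow> real" and d
    using that unfolding continuous_map_atin by simp
  have "((\<lambda>d. hyperplane_point n d i * (disc_norm n d / ?g d)) \<longlongrightarrow>
      hyperplane_point n d i * (disc_norm n d / ?g d)) (atin (disc n) d)"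
    if "d \<in> topspace (disc n)" "i \<le> n" for d i
  proof (cases "disc_norm n d = 0")
    case False
    then have "?g d \<noteq> 0" using hyperplane_gauge_pos by force
    then show ?thesis by (intro tendsto_mult tendsto_divide lim hc gc nc that)
  next
    case True
    \<comment> \<open>The gauge in the denominator cancels against
      \<open>abs_le_simplex_gauge\<close>, which is the origin of the factor n + 1; the bound tends
      to 0 with the norm.\<close>
    have bound: "norm (hyperplane_point n e i * (disc_norm n e / ?g e)) \<le> (real n + 1) * disc_norm n e" for e
    proof (cases "disc_norm n e = 0")
      case False
      then have g: "0 < ?g e" by (rule hyperplane_gauge_pos)
      have "norm (hyperplane_point n e i * (disc_norm n e / ?g e)) =
          \<bar>hyperplane_point n e i\<bar> * (disc_norm n e / ?g e)"
        using g disc_norm_nonneg[of n e] by (simp add: abs_mult)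
      also have "\<dots> \<le> ((real n + 1) * ?g e) * (disc_norm n e / ?g e)"
        using g disc_norm_nonneg[of n e]
        by (intro mult_right_mono abs_le_simplex_gauge sum_hyperplane_point that) auto
      finally show ?thesis using g by simp
    qed simp
    have "((\<lambda>e. (real n + 1) * disc_norm n e) \<longlongrightarrow> (real n + 1) * disc_norm n d) (atin (disc n) d)"
      by (intro tendsto_mult tendsto_const lim nc that)
    then have null: "((\<lambda>e. (real n + 1) * disc_norm n e) \<longlongrightarrow> 0) (atin (disc n) d)"
      unfolding True by (simp only: mult_zero_right)
    have "((\<lambda>d. hyperplane_point n d i * (disc_norm n d / ?g d)) \<longlongrightarrow> 0) (atin (disc n) d)"
      by (rule Lim_null_comparison[OF always_eventually null]) (intro allI bound)
    then show ?thesis using True by simp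
  qed
  then have "continuous_map (disc n) euclideanreal
      (\<lambda>d. hyperplane_point n d i * (disc_norm n d / ?g d))" if "i \<le> n" for i
    using that unfolding continuous_map_atin by simp
  then have "continuous_map (disc n) euclideanreal
      (\<lambda>d. (1 + hyperplane_point n d i * (disc_norm n d / ?g d)) / real (n + 1))" if "i \<le> n" for i
    using that by (intro continuous_map_real_divide continuous_map_add) auto
  then have "continuous_map (disc n) euclideanreal (\<lambda>d. disc_to_simplex n d i)" for i
    unfolding disc_to_simplex_def by (cases "i \<le> n") (simp_all only: if_True if_False continuous_map_const, auto)
  then show ?thesis
    using disc_to_simplex_in_standard_simplex unfolding continuous_map_into_simplex_space by blast
qed

text \<open>The disc is a closed subset of the cube with sides [-1, 1] in the space of real
  sequences, and that cube is compact by Tychonoff's theorem.\<close>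

lemma compact_space_disc: "compact_space (disc n)"
proof -
  let ?P = "powertop_real UNIV"
  have cc: "continuous_map ?P euclideanreal (\<lambda>d. d i)" for i
    by (rule continuous_map_product_coordinate)
  have "closedin ?P {d \<in> topspace ?P. d i \<in> {0}}" for i
    by (intro closedin_continuous_map_preimage[OF cc]) simp
  then have "closedin ?P (\<Inter>i\<in>{n..}. {d. d i = 0})" by (intro closedin_Inter) auto
  moreover have "closedin ?P {d \<in> topspace ?P. (\<Sum>i<n. (d i)\<^sup>2) \<in> {..1}}"
    by (intro closedin_continuous_map_preimage[where Y = euclideanreal])
      (auto intro!: continuous_map_sum continuous_map_real_pow cc)
  ultimately have cl: "closedin ?P ((\<Inter>i\<in>{n..}. {d. d i = 0}) \<inter> {d. (\<Sum>i<n. (d i)\<^sup>2) \<le> 1})"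
    by (intro closedin_Int) auto
  have eq: "(\<Inter>i\<in>{n..}. {d. d i = 0}) \<inter> {d. (\<Sum>i<n. (d i)\<^sup>2) \<le> 1} =
      {d :: nat \<Rightarrow> real. \<forall>i\<ge>n. d i = 0} \<inter> {d. (\<Sum>i<n. (d i)\<^sup>2) \<le> 1}"
    by auto
  have "d i \<in> {-1..1}" if "\<forall>i\<ge>n. d i = 0" "(\<Sum>i<n. (d i)\<^sup>2) \<le> 1" for d :: "nat \<Rightarrow> real" and i
  proof (cases "i < n")
    case True
    then have "(d i)\<^sup>2 \<le> (\<Sum>i<n. (d i)\<^sup>2)" by (intro member_le_sum) auto
    then have "\<bar>d i\<bar> \<le> 1" using that by (simp add: abs_square_le_1[symmetric])
    then show ?thesis by (simp add: abs_le_iff)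
  qed (use that in auto)
  then have "compactin ?P ((\<Inter>i\<in>{n..}. {d. d i = 0}) \<inter> {d. (\<Sum>i<n. (d i)\<^sup>2) \<le> 1})"
    by (intro closed_compactin[OF _ _ cl, of "UNIV \<rightarrow>\<^sub>E {-1..1}"])
      (auto simp: compactin_PiE eq)
  then show ?thesis
    unfolding disc_def Euclidean_space_def subtopology_subtopology eq
    by (rule compact_space_subtopology)
qed

lemma closed_map_disc_to_simplex: "closed_map (disc n) (simplex_space n) (disc_to_simplex n)"
  by (rule continuous_imp_closed_map[OF continuous_map_disc_to_simplex compact_space_disc Hausdorff_simplex_space])

lemma disc_to_simplex_image: "disc_to_simplex n ` topspace (disc n) = standard_simplex n"
  using disc_to_simplex_surj disc_to_simplex_in_standard_simplex by blast

section \<open>Equivariant cells\<close>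

definition simplex_barycentre :: "nat \<Rightarrow> nat \<Rightarrow> real" where
  "simplex_barycentre n i = (if i \<le> n then 1 / (n + 1) else 0)"

lemma simplex_barycentre_interior: "simplex_barycentre n \<in> simplex_interior n"
proof -
  have "sum (simplex_barycentre n) {..n} = (\<Sum>i\<le>n. 1 / (n + 1))"
    by (intro sum.cong) (auto simp: simplex_barycentre_def)
  then have "simplex_barycentre n \<in> standard_simplex n"
    by (intro standard_simplexI) (auto simp: simplex_barycentre_def)
  then show ?thesis by (simp add: simplex_interior_def simplex_barycentre_def)
qed

lemma topspace_G_cells:
  "topspace (G_cells G I K D) = {(i, C, d). i \<in> I \<and> C \<in> lcosets\<^bsub>G\<^esub> (K i) \<and> d \<in> topspace D}"
  by (auto simp: G_cells_def)

lemma openin_prod_discrete: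
  "openin (prod_topology (discrete_topology A) D) W \<longleftrightarrow>
     W \<subseteq> A \<times> topspace D \<and> (\<forall>a\<in>A. openin D {d. (a, d) \<in> W})"
proof (intro iffI conjI ballI)
  assume W: "openin (prod_topology (discrete_topology A) D) W"
  then show sub: "W \<subseteq> A \<times> topspace D" using openin_subset by fastforce
  fix a assume "a \<in> A"
  then have "continuous_map D (prod_topology (discrete_topology A) D) (\<lambda>d. (a, d))"
    by (intro continuous_map_pairedI) auto
  from openin_continuous_map_preimage[OF this W]
  have "openin D {d \<in> topspace D. (a, d) \<in> W}" .
  also have "{d \<in> topspace D. (a, d) \<in> W} = {d. (a, d) \<in> W}" using sub by auto
  finally show "openin D {d. (a, d) \<in> W}" .
next
  assume *: "W \<subseteq> A \<times> topspace D \<and> (\<forall>a\<in>A. openin D {d. (a, d) \<in> W})"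
  then have "openin (prod_topology (discrete_topology A) D) (\<Union>a\<in>A. {a} \<times> {d. (a, d) \<in> W})"
    by (intro openin_Union) (auto simp: openin_prod_Times_iff)
  also have "(\<Union>a\<in>A. {a} \<times> {d. (a, d) \<in> W}) = W" using * by auto
  finally show "openin (prod_topology (discrete_topology A) D) W" .
qed

lemma openin_G_cells:
  "openin (G_cells G I K D) W \<longleftrightarrow> W \<subseteq> topspace (G_cells G I K D) \<and>
     (\<forall>i\<in>I. \<forall>C\<in>lcosets\<^bsub>G\<^esub> (K i). openin D {d. (i, C, d) \<in> W})"
proof (cases "W \<subseteq> topspace (G_cells G I K D)")
  case True
  then have "W \<subseteq> Sigma I (topspace \<circ> (\<lambda>i. prod_topology (discrete_topology (lcosets\<^bsub>G\<^esub> (K i))) D))"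
    "\<And>i. i \<in> I \<Longrightarrow> {x. (i, x) \<in> W} \<subseteq> (lcosets\<^bsub>G\<^esub> (K i)) \<times> topspace D"
    by (auto simp: G_cells_def)
  then show ?thesis
    using True unfolding G_cells_def openin_sum_topology openin_prod_discrete by simp
next
  case False
  then show ?thesis using openin_subset by blast
qed

lemma continuous_map_from_G_cells:
  assumes "\<And>i C. i \<in> I \<Longrightarrow> C \<in> lcosets\<^bsub>G\<^esub> (K i) \<Longrightarrow> continuous_map D Z (\<lambda>d. f (i, C, d))"
  shows "continuous_map (G_cells G I K D) Z f"
  unfolding continuous_map
proof (intro conjI allI impI)
  show "f ` topspace (G_cells G I K D) \<subseteq> topspace Z"
    using assms by (auto simp: topspace_G_cells continuous_map_def)
  fix U assume "openin Z U"
  then have "openin D {d \<in> topspace D. f (i, C, d) \<in> U}" if "i \<in> I" "C \<in> lcosets\<^bsub>G\<^esub> (K i)" for i C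
    using assms[OF that] by (simp add: continuous_map)
  then show "openin (G_cells G I K D) {b \<in> topspace (G_cells G I K D). f b \<in> U}"
    unfolding openin_G_cells by (auto simp: topspace_G_cells)
qed

lemma bdry_sphere_subset_disc: "topspace (bdry_sphere n) \<subseteq> topspace (disc n)"
  by (auto simp: topspace_disc topspace_bdry_sphere)

lemma continuous_map_bdry_sphere:
  assumes "continuous_map (disc n) Z f" shows "continuous_map (bdry_sphere n) Z f"
  using assms unfolding disc_def bdry_sphere_def
  by (rule continuous_map_from_subtopology_mono) auto

text \<open>Compatibility with the simplicial operators is not listed: it follows from acting on all
  vertices through the one map \<open>a g\<close>, since vertices determine simplices
  (\<open>action_Opr\<close>).\<close>

locale simplicial_G_action =
  vertex_determined_sset X vx + group G
  for X :: "'x sset" and vx :: "'x \<Rightarrow> nat \<Rightarrow> 'v" and G :: "('g, 'b) monoid_scheme" (structure) +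
  fixes \<rho> :: "'g \<Rightarrow> nat \<Rightarrow> 'x \<Rightarrow> 'x" and a :: "'g \<Rightarrow> 'v \<Rightarrow> 'v"
  assumes action_simplex: "\<And>g n x. g \<in> carrier G \<Longrightarrow> x \<in> Smp X n \<Longrightarrow> \<rho> g n x \<in> Smp X n"
    and vx_action: "\<And>g n x i. g \<in> carrier G \<Longrightarrow> x \<in> Smp X n \<Longrightarrow> i \<le> n \<Longrightarrow> vx (\<rho> g n x) i = a g (vx x i)"
    and action_one: "\<And>n x. x \<in> Smp X n \<Longrightarrow> \<rho> \<one> n x = x"
    and action_mult: "\<And>g h n x. g \<in> carrier G \<Longrightarrow> h \<in> carrier G \<Longrightarrow> x \<in> Smp X n \<Longrightarrow>
      \<rho> (g \<otimes> h) n x = \<rho> g n (\<rho> h n x)"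
begin

section \<open>The action on the realization\<close>

abbreviation "Y \<equiv> realization X"

definition act :: "'g \<Rightarrow> ((nat \<times> 'x) \<times> (nat \<Rightarrow> real)) set \<Rightarrow> ((nat \<times> 'x) \<times> (nat \<Rightarrow> real)) set" where
  "act g = realization_map X X (\<rho> g)"

text \<open>\<open>realization_map\<close> saturates the image of a whole class, so all
  representatives must have images in one class. They do: equal points have equal step functions,
  and these stay equal when \<open>a g\<close> is applied to their values.\<close>

lemma act_pt:
  assumes g: "g \<in> carrier G" and x: "x \<in> Smp X n" "t \<in> standard_simplex n"
  shows "act g (pt n x t) = pt n (\<rho> g n x) t"
proof -
  let ?f = "\<lambda>((n, x), t). ((n, \<rho> g n x), t :: nat \<Rightarrow> real)"
  let ?E = "realization_rel X"
  note E = equiv_realization_rel[OF simplicial]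
  have f: "?E `` {?f q} = pt n (\<rho> g n x) t" if q: "q \<in> pt n x t" for q
  proof -
    obtain m y u where e: "q = ((m, y), u)" by (metis surj_pair)
    have "(((n, x), t), q) \<in> ?E" using q by (simp add: realization_point_def)
    then have y: "y \<in> Smp X m" "u \<in> standard_simplex m" and eq: "pt n x t = pt m y u"
      using equiv_type[OF E] equiv_class_eq[OF E] unfolding e realization_point_def
      by (auto simp: topspace_simplices_space)
    have "pt m (\<rho> g m y) u = pt n (\<rho> g n x) t"
      using y x g step_function_invariant[OF eq x y] locate(1)[OF x(2)] locate(1)[OF y(2)]
      by (intro realization_point_eqI) (auto simp: action_simplex vx_action)
    then show ?thesis unfolding e by (simp add: realization_point_def)
  qed
  have "((n, x), t) \<in> pt n x t"
    unfolding realization_point_def using x by (intro equiv_class_self[OF E]) (simp add: topspace_simplices_space)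
  then have "?E `` (?f ` pt n x t) = pt n (\<rho> g n x) t"
    using f by (force simp: Image_def)
  then show ?thesis
    using realization_point_in_topspace[OF x] by (simp add: act_def realization_map_def)
qed

lemma action_inv:
  assumes "g \<in> carrier G" "x \<in> Smp X n"
  shows "\<rho> (inv g) n (\<rho> g n x) = x" "\<rho> g n (\<rho> (inv g) n x) = x"
  using assms action_mult[of "inv g" g x n] action_mult[of g "inv g" x n] by (simp_all add: action_one)

text \<open>\<open>a g\<close> is not assumed injective, but on vertices of simplices
  \<open>a (inv g)\<close> undoes it; hence distinct neighbouring vertices stay distinct.\<close>

lemma action_nondegenerate:
  assumes g: "g \<in> carrier G" and x: "x \<in> nondegenerate n"
  shows "\<rho> g n x \<in> nondegenerate n"
proof -
  have xX: "x \<in> Smp X n" using x by (simp add: nondegenerate_def)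
  have "a (inv g) (a g (vx x i)) = vx x i" if "i \<le> n" for i
    using vx_action[of "inv g" "\<rho> g n x" n i] vx_action[OF g xX that] g xX that
    by (simp add: action_inv action_simplex)
  then have "vx (\<rho> g n x) i \<noteq> vx (\<rho> g n x) (Suc i)" if "i < n" for i
    using that x vx_action[OF g xX] unfolding nondegenerate_def
    by (metis (mono_tags, lifting) Suc_leI less_imp_le mem_Collect_eq)
  then show ?thesis using action_simplex[OF g xX] by (simp add: nondegenerate_def)
qed

text \<open>The action leaves t alone and preserves nondegeneracy, so the translate is again in
  normal form and uniqueness compares the simplices.\<close>

lemma fixes_point_iff:
  assumes g: "g \<in> carrier G" and x: "x \<in> nondegenerate n" "t \<in> simplex_interior n"
  shows "act g (pt n x t) = pt n x t \<longleftrightarrow> \<rho> g n x = x"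
proof -
  have "x \<in> Smp X n" "t \<in> standard_simplex n" using x by (auto simp: nondegenerate_def simplex_interior_def)
  then show ?thesis
    using normal_form_unique[of n "\<rho> g n x" t n x t] action_nondegenerate[OF g x(1)] x by (auto simp: act_pt[OF g])
qed

lemma act_in_topspace:
  assumes "g \<in> carrier G" "c \<in> topspace Y" shows "act g c \<in> topspace Y"
proof -
  obtain n x t where "x \<in> Smp X n" "t \<in> standard_simplex n" "c = pt n x t"
    using assms(2) unfolding topspace_realization by blast
  then show ?thesis using assms(1) by (simp add: act_pt realization_point_in_topspace action_simplex)
qed

lemma act_mult:
  assumes "g \<in> carrier G" "h \<in> carrier G" "c \<in> topspace Y" shows "act (g \<otimes> h) c = act g (act h c)"
proof -
  obtain n x t where "x \<in> Smp X n" "t \<in> standard_simplex n" "c = pt n x t"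
    using assms(3) unfolding topspace_realization by blast
  then show ?thesis using assms(1,2) by (simp add: act_pt action_simplex action_mult)
qed

lemma act_one: "c \<in> topspace Y \<Longrightarrow> act \<one> c = c"
  unfolding topspace_realization by (auto simp: act_pt action_one)

lemma group_action_act: "group_action G (topspace Y) act"
proof -
  have bij: "bij_betw (act g) (topspace Y) (topspace Y)" if g: "g \<in> carrier G" for g
    using g by (intro bij_betw_byWitness[where f' = "act (inv g)"])
      (auto simp: act_in_topspace act_one simp flip: act_mult)
  have ext: "act g \<in> extensional (topspace Y)" for g
    unfolding act_def realization_map_def by simp
  have "act \<in> hom G (BijGroup (topspace Y))"
  proof (rule homI)
    fix g h assume gh: "g \<in> carrier G" "h \<in> carrier G"
    have "act (g \<otimes> h) = compose (topspace Y) (act g) (act h)"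
      by (rule extensionalityI[OF ext]) (auto simp: compose_def act_mult[OF gh])
    then show "act (g \<otimes> h) = act g \<otimes>\<^bsub>BijGroup (topspace Y)\<^esub> act h"
      using bij gh ext by (simp add: BijGroup_def Bij_def)
  qed (use bij ext in \<open>auto simp: BijGroup_def Bij_def\<close>)
  then show ?thesis
    by (intro group_action.intro group_hom.intro group_hom_axioms.intro group_BijGroup is_group)
qed

lemma G_space_act: "G_space G Y act"
  unfolding G_space_def
proof (intro conjI ballI group_action_act continuous_map_from_realization)
  fix g n x assume g: "g \<in> carrier G" and x: "x \<in> Smp X n"
  have "continuous_map (simplex_space n) Y (pt n (\<rho> g n x))"
    using action_simplex[OF g x] by (rule continuous_map_realization_point)
  then show "continuous_map (simplex_space n) Y (\<lambda>t. act g (pt n x t))"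
    by (rule continuous_map_eq) (simp add: act_pt[OF g x])
qed

text \<open>The strict inequality makes this the (k - 1)-skeleton, as \<open>G_CW_complex\<close>
  indexes it. Restricting to normal forms makes the dimension of a point meaningful.\<close>

definition skeleton :: "nat \<Rightarrow> ((nat \<times> 'x) \<times> (nat \<Rightarrow> real)) set set" where
  "skeleton k = {pt n x t | n x t. n < k \<and> x \<in> nondegenerate n \<and> t \<in> simplex_interior n}"

lemma pt_in_skeleton:
  assumes "x \<in> Smp X n" "t \<in> standard_simplex n" "n < k" shows "pt n x t \<in> skeleton k"
proof -
  obtain m y u where "m \<le> n" "y \<in> nondegenerate m" "u \<in> simplex_interior m" "pt n x t = pt m y u"
    using normal_form_bounded[OF assms(1,2)] by metis
  moreover from this have "m < k" using assms(3) by simp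
  ultimately show ?thesis unfolding skeleton_def by blast
qed

lemma skeleton_dim:
  assumes "pt n x t \<in> skeleton k" "x \<in> nondegenerate n" "t \<in> simplex_interior n" shows "n < k"
proof -
  obtain m y u where "m < k" "y \<in> nondegenerate m" "u \<in> simplex_interior m" "pt n x t = pt m y u"
    using assms(1) unfolding skeleton_def by blast
  then show ?thesis using normal_form_unique[of n x t m y u] assms(2,3) by blast
qed

lemma skeleton_subset: "skeleton k \<subseteq> topspace Y"
  unfolding skeleton_def
  by (auto simp: nondegenerate_def simplex_interior_def intro: realization_point_in_topspace)

lemma boundary_in_skeleton:
  assumes x: "x \<in> Smp X n" and t: "t \<in> standard_simplex n" "t \<notin> simplex_interior n"
  shows "pt n x t \<in> skeleton n"
proof -
  obtain k where k: "k \<le> n" "t k = 0"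
    using t standard_simplexD(1)[OF t(1)] by (force simp: simplex_interior_def order_le_less)
  \<comment> \<open>In dimension 0 the only coordinate is 1, so a vanishing coordinate forces n >
    0.\<close>
  obtain n' where n: "n = Suc n'"
    using k standard_simplexD(4)[OF t(1)] by (cases n) auto
  note p = simplex_push_coface[OF t(1)[unfolded n] k(2) k(1)[unfolded n]]
  have "pt n' (Opr X n' (coface k) x) (t \<circ> coface k) = pt n x t"
    using realization_point_Opr[OF simplicial coface_ordinal x[unfolded n] p(1)] p(2) by (simp add: n)
  then show ?thesis
    using pt_in_skeleton[of "Opr X n' (coface k) x" n' "t \<circ> coface k" n] p(1)
      simplicial_setD(1)[OF simplicial coface_ordinal x[unfolded n]] by (simp add: n)
qed

lemma act_skeleton:
  assumes "g \<in> carrier G" shows "act g ` skeleton k \<subseteq> skeleton k"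
proof
  fix c assume "c \<in> act g ` skeleton k"
  then obtain n x t where "n < k" "x \<in> nondegenerate n" "t \<in> simplex_interior n" "c = act g (pt n x t)"
    unfolding skeleton_def by blast
  moreover from this have "c = pt n (\<rho> g n x) t"
    by (simp add: act_pt[OF assms] nondegenerate_def simplex_interior_def)
  ultimately show "c \<in> skeleton k"
    using action_nondegenerate[OF assms] unfolding skeleton_def by blast
qed

text \<open>Orbit-stabilizer for the nondegenerate n-simplices: one index per orbit, with the
  stabilizer of a chosen representative as K. The indices have to be points of the realization, so
  an orbit is labelled by the barycentre of its representative.\<close>

lemma equivariant_cells:
  obtains I :: "((nat \<times> 'x) \<times> (nat \<Rightarrow> real)) set set" and K P where
    "\<And>i. i \<in> I \<Longrightarrow> subgroup (K i) G"
    "bij_betw (\<lambda>(i, C). P i C) (SIGMA i:I. lcosets (K i)) (nondegenerate n)"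
    "\<And>i C g. i \<in> I \<Longrightarrow> C \<in> lcosets (K i) \<Longrightarrow> g \<in> carrier G \<Longrightarrow> P i (g <# C) = \<rho> g n (P i C)"
proof -
  let ?N = "nondegenerate n" and ?e = "\<lambda>x. pt n x (simplex_barycentre n)"
  have NX: "x \<in> Smp X n" if "x \<in> ?N" for x using that by (simp add: nondegenerate_def)
  define orb where "orb x = {\<rho> g n x | g. g \<in> carrier G}" for x
  \<comment> \<open>The choice depends on the orbit as a set only, so simplices in one orbit get the
    same representative.\<close>
  define rep where "rep x = (SOME y. y \<in> orb x)" for x
  have orb_self: "x \<in> orb x" if "x \<in> ?N" for x
    using action_one[OF NX[OF that]] unfolding orb_def by (metis (mono_tags, lifting) mem_Collect_eq one_closed)
  have orb_sub: "orb (\<rho> g n x) \<subseteq> orb x" if "x \<in> ?N" "g \<in> carrier G" for x g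
    using that by (auto simp: orb_def action_mult[symmetric] NX)
  have orb_eq: "orb (\<rho> g n x) = orb x" if "x \<in> ?N" "g \<in> carrier G" for x g
    using orb_sub[OF that] orb_sub[OF action_nondegenerate[OF that(2,1)], of "inv g"] that
    by (auto simp: action_inv NX)
  have rep: "\<exists>g\<in>carrier G. rep x = \<rho> g n x" if "x \<in> ?N" for x
    using someI[of "\<lambda>y. y \<in> orb x", OF orb_self[OF that]] by (auto simp: rep_def orb_def)
  have repN: "rep x \<in> ?N" if "x \<in> ?N" for x
    using rep[OF that] action_nondegenerate that by auto
  have inj: "inj_on ?e ?N"
  proof (rule inj_onI)
    fix x y assume "x \<in> ?N" "y \<in> ?N" "?e x = ?e y"
    then show "x = y"
      using normal_form_unique[of n x "simplex_barycentre n" n y "simplex_barycentre n"]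
      by (simp add: simplex_barycentre_interior)
  qed
  define I where "I = ?e ` rep ` ?N"
  define s where "s = the_inv_into ?N ?e"
  have se: "s (?e x) = x" if "x \<in> ?N" for x unfolding s_def using the_inv_into_f_f[OF inj that] .
  have sI: "\<exists>x\<in>?N. s i = rep x \<and> i = ?e (rep x)" if "i \<in> I" for i
    using that se repN by (auto simp: I_def)
  have sN: "s i \<in> ?N" if "i \<in> I" for i using sI[OF that] repN by auto
  define K where "K i = {g \<in> carrier G. \<rho> g n (s i) = s i}" for i
  have K: "subgroup (K i) G" if "i \<in> I" for i
  proof (rule subgroupI)
    show "K i \<noteq> {}" using action_one[OF NX[OF sN[OF that]]] by (auto simp: K_def)
    show "inv g \<in> K i" if "g \<in> K i" for g
      using that action_inv(1)[of g "s i" n] NX[OF sN[OF \<open>i \<in> I\<close>]] by (auto simp: K_def)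
    show "g \<otimes> h \<in> K i" if "g \<in> K i" "h \<in> K i" for g h
      using that NX[OF sN[OF \<open>i \<in> I\<close>]] by (auto simp: K_def action_mult)
  qed (auto simp: K_def)
  \<comment> \<open>Independent of the chosen element of the coset, since \<open>K i\<close> fixes
    \<open>s i\<close>.\<close>
  define P where "P i C = \<rho> (SOME g. g \<in> C) n (s i)" for i C
  have P: "P i (g <# K i) = \<rho> g n (s i)" if i: "i \<in> I" and g: "g \<in> carrier G" for i g
  proof -
    have "g \<otimes> \<one> \<in> g <# K i" using subgroup.one_closed[OF K[OF i]] unfolding l_coset_def by blast
    then have "(SOME h. h \<in> g <# K i) \<in> g <# K i" by (rule someI)
    then obtain k where "k \<in> K i" "(SOME h. h \<in> g <# K i) = g \<otimes> k" unfolding l_coset_def by blast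
    then show ?thesis using g NX[OF sN[OF i]] by (simp add: P_def action_mult K_def)
  qed
  show ?thesis
  proof (rule that[of I K P])
    show "bij_betw (\<lambda>(i, C). P i C) (SIGMA i:I. lcosets (K i)) ?N"
      unfolding bij_betw_def
    proof (intro conjI inj_onI equalityI subsetI)
      fix p q assume p: "p \<in> (SIGMA i:I. lcosets (K i))" and q: "q \<in> (SIGMA i:I. lcosets (K i))"
        and eq: "(case p of (i, C) \<Rightarrow> P i C) = (case q of (i, C) \<Rightarrow> P i C)"
      obtain i g j h where e: "p = (i, g <# K i)" "q = (j, h <# K j)" and i: "i \<in> I" "g \<in> carrier G"
        and j: "j \<in> I" "h \<in> carrier G"
        using p q by (auto simp: LCOSETS_def)
      have eq: "\<rho> g n (s i) = \<rho> h n (s j)" using eq by (simp add: e P i j)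
      obtain x y where x: "x \<in> ?N" "s i = rep x" "i = ?e (rep x)" and y: "y \<in> ?N" "s j = rep y" "j = ?e (rep y)"
        using sI[OF i(1)] sI[OF j(1)] by blast
      have "orb x = orb (s i)" using rep[OF x(1)] orb_eq[OF x(1)] x(2) by auto
      also have "\<dots> = orb (s j)" using eq orb_eq[OF sN[OF i(1)] i(2)] orb_eq[OF sN[OF j(1)] j(2)] by simp
      also have "\<dots> = orb y" using rep[OF y(1)] orb_eq[OF y(1)] y(2) by auto
      finally have "rep x = rep y" by (simp add: rep_def)
      then have ij: "i = j" using x y by simp
      have "\<rho> (inv h \<otimes> g) n (s i) = s i"
        using eq ij i j NX[OF sN[OF i(1)]] by (simp add: action_mult action_inv)
      then have "inv h \<otimes> g \<in> K i" using i j by (simp add: K_def)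
      then have "h \<otimes> (inv h \<otimes> g) \<in> h <# K i" unfolding l_coset_def by blast
      then have "g \<in> h <# K i" using i j by (simp add: m_assoc[symmetric])
      then have "h <# K i = g <# K i" using K[OF i(1)] j(2) by (intro l_repr_independence) auto
      then show "p = q" using e ij by simp
    next
      fix x assume "x \<in> (\<lambda>(i, C). P i C) ` (SIGMA i:I. lcosets (K i))"
      then show "x \<in> ?N" using P sN by (auto simp: LCOSETS_def action_nondegenerate)
    next
      fix x assume x: "x \<in> ?N"
      obtain g where g: "g \<in> carrier G" "rep x = \<rho> g n x" using rep[OF x] by blast
      let ?i = "?e (rep x)"
      have i: "?i \<in> I" using x by (simp add: I_def)
      have "x = \<rho> (inv g) n (rep x)" using g x by (simp add: action_inv NX)
      also have "\<dots> = P ?i (inv g <# K ?i)" using P[OF i, of "inv g"] g se[OF repN[OF x]] by simp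
      finally show "x \<in> (\<lambda>(i, C). P i C) ` (SIGMA i:I. lcosets (K i))"
        using i g by (intro image_eqI[of _ _ "(?i, inv g <# K ?i)"]) (auto simp: LCOSETS_def)
    qed
    show "P i (g <# C) = \<rho> g n (P i C)" if i: "i \<in> I" and C: "C \<in> lcosets (K i)" and g: "g \<in> carrier G" for i C g
    proof -
      obtain h where h: "h \<in> carrier G" "C = h <# K i" using C by (auto simp: LCOSETS_def)
      then have "g <# C = (g \<otimes> h) <# K i" using g subgroup.subset[OF K[OF i]] by (simp add: lcos_m_assoc)
      then show ?thesis using h g i NX[OF sN[OF i]] by (simp add: P action_mult)
    qed
  qed (fact K)
qed

end

section \<open>Attaching equivariant cells\<close>

context simplicial_G_action
begin

lemma skeleton_mono: "skeleton n \<subseteq> skeleton (Suc n)"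
  unfolding skeleton_def using less_SucI by blast

text \<open>Uniqueness of normal forms makes Q injective off the boundary spheres, with values
  outside \<open>skeleton n\<close>, while the boundary goes into \<open>skeleton n\<close>. So
  points are identified only through the attaching map; what remains is to compare
  topologies.\<close>

lemma skeleton_attaches_G_cells: "attaches_G_cells G Y act n (skeleton n) (skeleton (Suc n))"
proof -
  obtain I :: "((nat \<times> 'x) \<times> (nat \<Rightarrow> real)) set set" and K P where
    K: "\<And>i. i \<in> I \<Longrightarrow> subgroup (K i) G"
    and P: "bij_betw (\<lambda>(i, C). P i C) (SIGMA i:I. lcosets (K i)) (nondegenerate n)"
    and P_eqv: "\<And>i C g. i \<in> I \<Longrightarrow> C \<in> lcosets (K i) \<Longrightarrow> g \<in> carrier G \<Longrightarrow> P i (g <# C) = \<rho> g n (P i C)"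
    using equivariant_cells[of n] by blast
  define Q where "Q = (\<lambda>(i, C, d). pt n (P i C) (disc_to_simplex n d))"
  let ?A = "G_cells G I K (bdry_sphere n)" and ?B = "G_cells G I K (disc n)"
  let ?Z = "subtopology Y (skeleton n)" and ?Z' = "subtopology Y (skeleton (Suc n))"
  have topZ: "topspace (subtopology Y (skeleton k)) = skeleton k" for k
    using skeleton_subset by auto
  have PN: "P i C \<in> nondegenerate n" if "i \<in> I" "C \<in> lcosets (K i)" for i C
    using P that by (auto simp: bij_betw_def)
  have PX: "P i C \<in> Smp X n" if "i \<in> I" "C \<in> lcosets (K i)" for i C
    using PN[OF that] by (simp add: nondegenerate_def)
  have AB: "topspace ?A \<subseteq> topspace ?B"
    using bdry_sphere_subset_disc by (auto simp: topspace_G_cells)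
  have Q_interior: "\<exists>y u. Q b = pt n y u \<and> y \<in> nondegenerate n \<and> u \<in> simplex_interior n"
    if "b \<in> topspace ?B" "b \<notin> topspace ?A" for b
  proof -
    obtain i C d where b: "b = (i, C, d)" by (metis surj_pair)
    show ?thesis
      using that PN[of i C] disc_to_simplex_interior_iff[of d n] by (auto simp: b topspace_G_cells Q_def)
  qed
  have Q_boundary: "Q b \<in> skeleton n" if "b \<in> topspace ?A" for b
  proof -
    obtain i C d where b: "b = (i, C, d)" by (metis surj_pair)
    have "d \<in> topspace (disc n)" "d \<in> topspace (bdry_sphere n)"
      using that bdry_sphere_subset_disc by (auto simp: b topspace_G_cells)
    then show ?thesis
      using that PX[of i C] disc_to_simplex_interior_iff[of d n] disc_to_simplex_in_standard_simplex[of d n]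
      by (auto simp: b topspace_G_cells Q_def intro!: boundary_in_skeleton)
  qed
  have Q_skeleton: "Q b \<in> skeleton n \<longleftrightarrow> b \<in> topspace ?A" if "b \<in> topspace ?B" for b
    using Q_boundary Q_interior[OF that] skeleton_dim[of n _ _ n] by fastforce
  have Q_inj: "b = b'" if b: "b \<in> topspace ?B" "b \<notin> topspace ?A" and b': "b' \<in> topspace ?B" and eq: "Q b = Q b'" for b b'
  proof -
    obtain i C d where e: "b = (i, C, d)" by (metis surj_pair)
    obtain i' C' d' where e': "b' = (i', C', d')" by (metis surj_pair)
    have "b' \<notin> topspace ?A" using eq b Q_skeleton b' by metis
    then have i: "i \<in> I" "C \<in> lcosets (K i)" "d \<in> topspace (disc n)" "d \<notin> topspace (bdry_sphere n)"
      and i': "i' \<in> I" "C' \<in> lcosets (K i')" "d' \<in> topspace (disc n)" "d' \<notin> topspace (bdry_sphere n)"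
      using b b' by (auto simp: e e' topspace_G_cells)
    have "P i C = P i' C' \<and> disc_to_simplex n d = disc_to_simplex n d'"
      using normal_form_unique[of n "P i C" "disc_to_simplex n d" n "P i' C'" "disc_to_simplex n d'"]
        eq i i' PN disc_to_simplex_interior_iff by (auto simp: e e' Q_def)
    then have "d = d'" "(i, C) = (i', C')"
      using inj_onD[OF inj_on_disc_to_simplex, of n d d'] i i'
        inj_onD[OF bij_betw_imp_inj_on[OF P], of "(i, C)" "(i', C')"] by auto
    then show ?thesis by (simp add: e e')
  qed
  have Q_cont: "continuous_map ?B Y Q"
  proof (rule continuous_map_from_G_cells)
    fix i C assume "i \<in> I" "C \<in> lcosets (K i)"
    from continuous_map_compose[OF continuous_map_disc_to_simplex continuous_map_realization_point[OF PX[OF this]]]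
    show "continuous_map (disc n) Y (\<lambda>d. Q (i, C, d))" by (simp add: Q_def comp_def)
  qed
  have Q_in: "Q b \<in> skeleton (Suc n)" if "b \<in> topspace ?B" for b
    using that PX disc_to_simplex_in_standard_simplex
    by (auto simp: topspace_G_cells Q_def intro!: pt_in_skeleton)
  have QA_cont: "continuous_map ?A Y Q"
  proof (rule continuous_map_from_G_cells)
    fix i C assume "i \<in> I" "C \<in> lcosets (K i)"
    from continuous_map_compose[OF continuous_map_bdry_sphere[OF continuous_map_disc_to_simplex]
        continuous_map_realization_point[OF PX[OF this]]]
    show "continuous_map (bdry_sphere n) Y (\<lambda>d. Q (i, C, d))" by (simp add: Q_def comp_def)
  qed
  have idAB: "continuous_map ?A ?B id"
  proof (rule continuous_map_from_G_cells)
    fix i C assume *: "i \<in> I" "C \<in> lcosets (K i)"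
    have "continuous_map (disc n) ?B (\<lambda>d. (i, C, d))"
      unfolding continuous_map
    proof (intro conjI allI impI)
      fix U assume U: "openin ?B U"
      then have "openin (disc n) {d. (i, C, d) \<in> U}" using * by (simp add: openin_G_cells)
      moreover have "{d. (i, C, d) \<in> U} = {d \<in> topspace (disc n). (i, C, d) \<in> U}"
        using openin_subset[OF U] by (auto simp: topspace_G_cells)
      ultimately show "openin (disc n) {d \<in> topspace (disc n). (i, C, d) \<in> U}" by simp
    qed (use * in \<open>auto simp: topspace_G_cells\<close>)
    then show "continuous_map (bdry_sphere n) ?B (\<lambda>d. id (i, C, d))"
      by (simp add: continuous_map_bdry_sphere)
  qed
  have cont: "continuous_map ?A ?Z Q" "continuous_map ?B ?Z' Q" "continuous_map ?Z ?Z' id"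
    using QA_cont Q_cont Q_boundary Q_in
      skeleton_mono[of n] topZ
    by (auto simp: continuous_map_in_subtopology continuous_map_from_subtopology)
  have surj: "id ` topspace ?Z \<union> Q ` topspace ?B = topspace ?Z'"
    unfolding topZ
  proof (intro equalityI subsetI)
    fix c assume "c \<in> skeleton (Suc n)"
    then obtain m y u where c: "m < Suc n" "y \<in> nondegenerate m" "u \<in> simplex_interior m" "c = pt m y u"
      unfolding skeleton_def by blast
    show "c \<in> id ` skeleton n \<union> Q ` topspace ?B"
    proof (cases "m < n")
      case True
      then show ?thesis using c unfolding skeleton_def by auto
    next
      case False
      then have m: "m = n" using c(1) by simp
      have "y \<in> (\<lambda>(i, C). P i C) ` (SIGMA i:I. lcosets (K i))"
        using c(2) m bij_betw_imp_surj_on[OF P] by simp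
      then obtain i C where "i \<in> I" "C \<in> lcosets (K i)" "y = P i C" by auto
      moreover obtain d where "d \<in> topspace (disc n)" "u = disc_to_simplex n d"
        using c(3) m disc_to_simplex_surj[of n] by (auto simp: simplex_interior_def)
      ultimately have "c = Q (i, C, d)" "(i, C, d) \<in> topspace ?B"
        using c(4) m by (auto simp: Q_def topspace_G_cells)
      then show ?thesis by blast
    qed
  qed (use Q_in skeleton_mono[of n] in auto)
  have opn: "openin ?Z' U" if U: "U \<subseteq> topspace ?Z'" and UZ: "openin ?Z {x \<in> topspace ?Z. id x \<in> U}"
    and UB: "openin ?B {b \<in> topspace ?B. Q b \<in> U}" for U
  proof -
    \<comment> \<open>The complement is shown closed in all of Y. By
      \<open>closedin_realizationI\<close> only simplices with an interior point in C matter, and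
      these have dimension at most n.\<close>
    define C where "C = skeleton (Suc n) - U"
    have CY: "C \<subseteq> topspace Y" using skeleton_subset by (auto simp: C_def)
    have "closedin Y C"
    proof (rule closedin_realizationI[OF CY])
      fix m y u assume y: "y \<in> nondegenerate m" "u \<in> simplex_interior m" "pt m y u \<in> C"
      then have m: "m < Suc n" using skeleton_dim[of m y u "Suc n"] by (simp add: C_def)
      have yX: "y \<in> Smp X m" using y(1) by (simp add: nondegenerate_def)
      \<comment> \<open>Simplices of dimension below n map into the old skeleton, where U is open by
        assumption. An n-simplex is the closed image of a disc, on which U is open through
        Q.\<close>
      show "closedin (simplex_space m) {v \<in> standard_simplex m. pt m y v \<in> C}"
      proof (cases "m < n")
        case True
        have "continuous_map (simplex_space m) ?Z (pt m y)"
          using continuous_map_realization_point[OF yX] pt_in_skeleton[OF yX _ True]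
          by (auto simp: continuous_map_in_subtopology)
        moreover have "closedin ?Z (topspace ?Z - {x \<in> topspace ?Z. id x \<in> U})"
          using UZ by blast
        ultimately have "closedin (simplex_space m) {v \<in> topspace (simplex_space m).
            pt m y v \<in> topspace ?Z - {x \<in> topspace ?Z. id x \<in> U}}"
          by (rule closedin_continuous_map_preimage)
        also have "{v \<in> topspace (simplex_space m). pt m y v \<in> topspace ?Z - {x \<in> topspace ?Z. id x \<in> U}} =
            {v \<in> standard_simplex m. pt m y v \<in> C}"
          unfolding topZ using pt_in_skeleton[OF yX _ True] pt_in_skeleton[OF yX _ m] by (auto simp: C_def)
        finally show ?thesis .
      next
        case False
        then have mn: "m = n" using m by simp
        have "y \<in> (\<lambda>(i, C). P i C) ` (SIGMA i:I. lcosets (K i))"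
          using y(1) mn bij_betw_imp_surj_on[OF P] by simp
        then obtain i B where i: "i \<in> I" "B \<in> lcosets (K i)" "y = P i B" by auto
        have "openin (disc n) {d. (i, B, d) \<in> {b \<in> topspace ?B. Q b \<in> U}}"
          using UB i unfolding openin_G_cells by blast
        then have "closedin (disc n) (topspace (disc n) - {d. (i, B, d) \<in> {b \<in> topspace ?B. Q b \<in> U}})"
          by blast
        also have "topspace (disc n) - {d. (i, B, d) \<in> {b \<in> topspace ?B. Q b \<in> U}} =
            {d \<in> topspace (disc n). Q (i, B, d) \<in> C}"
          using i Q_in by (auto simp: C_def topspace_G_cells)
        finally have "closedin (simplex_space n) (disc_to_simplex n ` {d \<in> topspace (disc n). Q (i, B, d) \<in> C})"
          using closed_map_disc_to_simplex[of n] by (simp add: closed_map_def)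
        also have "disc_to_simplex n ` {d \<in> topspace (disc n). Q (i, B, d) \<in> C} =
            {v \<in> standard_simplex m. pt m y v \<in> C}"
          using disc_to_simplex_image[of n] by (auto simp: Q_def mn i(3))
        finally show ?thesis by (simp add: mn)
      qed
    qed
    then have "closedin ?Z' C" by (rule closedin_subset_topspace) (auto simp: C_def)
    then have "openin ?Z' (topspace ?Z' - C)" by blast
    also have "topspace ?Z' - C = U" using U unfolding topZ by (auto simp: C_def)
    finally show ?thesis .
  qed
  let ?S = "topspace ?Z <+> topspace ?B"
  let ?r = "{(Inl (Q a), Inr (id a)) | a. a \<in> topspace ?A} :: (_ + _) rel"
  let ?R = "(?r \<union> ?r\<inverse>)\<^sup>*"
  have fib1_step: "case_sum id Q s = case_sum id Q t" if "(s, t) \<in> ?r \<union> ?r\<inverse>" for s t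
    using that by auto
  have fib1: "case_sum id Q s = case_sum id Q t" if "(s, t) \<in> ?R" for s t
    using that
  proof (induction rule: rtrancl_induct)
    case (step t t')
    then show ?case using fib1_step[OF step.hyps(2)] by simp
  qed simp
  have glue: "(Inl (Q b), Inr b) \<in> ?r" if "b \<in> topspace ?A" for b
    using that by (intro CollectI exI[of _ b]) simp
  have glue1: "(Inl (Q b), Inr b) \<in> ?R" and glue2: "(Inr b, Inl (Q b)) \<in> ?R" if "b \<in> topspace ?A" for b
    by (rule r_into_rtrancl, rule UnI1, rule glue[OF that])
      (rule r_into_rtrancl, rule UnI2, rule converseI, rule glue[OF that])
  have fib2: "(s, t) \<in> ?R"
    if st: "s \<in> ?S" "t \<in> ?S" and eq: "case_sum id Q s = case_sum id Q t" for s t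
  proof (cases s; cases t)
    fix c c' assume "s = Inl c" "t = Inl c'"
    then show ?thesis using eq by simp
  next
    fix c b assume e: "s = Inl c" "t = Inr b"
    then have b: "b \<in> topspace ?B" "Q b \<in> skeleton n" "c = Q b" using st eq topZ by auto
    with glue1[of b] Q_skeleton[of b] show ?thesis unfolding e by simp
  next
    fix b c assume e: "s = Inr b" "t = Inl c"
    then have b: "b \<in> topspace ?B" "Q b \<in> skeleton n" "c = Q b" using st eq topZ by auto
    with glue2[of b] Q_skeleton[of b] show ?thesis unfolding e by simp
  next
    fix b b' assume e: "s = Inr b" "t = Inr b'"
    then have b: "b \<in> topspace ?B" "b' \<in> topspace ?B" "Q b = Q b'" using st eq by auto
    show ?thesis
    proof (cases "b \<in> topspace ?A")
      case True
      then have "b' \<in> topspace ?A" using Q_skeleton[OF b(1)] Q_skeleton[OF b(2)] b(3) by simp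
      from rtrancl_trans[OF glue2[OF True, unfolded b(3)] glue1[OF this]] show ?thesis unfolding e .
    next
      case False
      then show ?thesis using Q_inj[OF b(1) False b(2,3)] e by simp
    qed
  qed
  have "is_pushout ?A ?Z ?B ?Z' Q id id Q"
    unfolding is_pushout_def
  proof (intro conjI allI impI ballI cont idAB surj)
    fix U assume "U \<subseteq> topspace ?Z'"
    then show "openin ?Z' U \<longleftrightarrow> openin ?Z {x \<in> topspace ?Z. id x \<in> U} \<and> openin ?B {b \<in> topspace ?B. Q b \<in> U}"
      using opn[of U] openin_continuous_map_preimage[OF cont(2), of U]
        openin_continuous_map_preimage[OF cont(3), of U] by blast
  next
    fix s t assume "s \<in> ?S" "t \<in> ?S"
    then show "case_sum id Q s = case_sum id Q t \<longleftrightarrow> (s, t) \<in> gen_equiv ?S ?r"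
      using fib1[of s t] fib2[of s t] unfolding gen_equiv_def by blast
  qed
  moreover have "Q (i, g <# C, d) = act g (Q (i, C, d))"
    if "g \<in> carrier G" "(i, C, d) \<in> topspace ?B" for g i C d
    using that PX disc_to_simplex_in_standard_simplex
    by (auto simp: Q_def topspace_G_cells act_pt P_eqv)
  ultimately show ?thesis
    unfolding attaches_G_cells_def using K by (intro exI[of _ I] exI[of _ K] exI[of _ Q]) auto
qed

text \<open>For the weak topology: each closed n-simplex maps into \<open>skeleton (Suc n)\<close>,
  so relative openness in that skeleton gives openness on the simplex.\<close>

theorem G_CW_complex_realization: "G_CW_complex G Y act"
  unfolding G_CW_complex_def
proof (intro conjI exI[of _ skeleton] allI impI ballI G_space_act act_skeleton skeleton_attaches_G_cells)
  show "skeleton 0 = {}" by (simp add: skeleton_def)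
  show "(\<Union>n. skeleton n) = topspace Y"
  proof (intro equalityI subsetI)
    fix c assume "c \<in> topspace Y"
    then obtain n x t where "x \<in> Smp X n" "t \<in> standard_simplex n" "c = pt n x t"
      unfolding topspace_realization by blast
    then have "c \<in> skeleton (Suc n)" by (simp add: pt_in_skeleton)
    then show "c \<in> (\<Union>n. skeleton n)" by blast
  qed (use skeleton_subset in auto)
  show "skeleton n \<subseteq> skeleton (Suc n)" for n by (rule skeleton_mono)
  fix U assume U: "U \<subseteq> topspace Y"
  show "openin Y U \<longleftrightarrow> (\<forall>n. openin (subtopology Y (skeleton n)) (U \<inter> skeleton n))"
  proof
    assume "openin Y U"
    then show "\<forall>n. openin (subtopology Y (skeleton n)) (U \<inter> skeleton n)"
      by (auto simp: openin_subtopology)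
  next
    assume R: "\<forall>n. openin (subtopology Y (skeleton n)) (U \<inter> skeleton n)"
    have "closedin Y (topspace Y - U)"
      unfolding closedin_realization
    proof (intro conjI allI ballI)
      fix n x assume x: "x \<in> Smp X n"
      let ?Z = "subtopology Y (skeleton (Suc n))"
      have "continuous_map (simplex_space n) ?Z (pt n x)"
        using continuous_map_realization_point[OF x] pt_in_skeleton[OF x]
        by (auto simp: continuous_map_in_subtopology)
      then have "openin (simplex_space n) {t \<in> topspace (simplex_space n). pt n x t \<in> U \<inter> skeleton (Suc n)}"
        using R by (blast intro: openin_continuous_map_preimage)
      then have "closedin (simplex_space n) (topspace (simplex_space n) -
          {t \<in> topspace (simplex_space n). pt n x t \<in> U \<inter> skeleton (Suc n)})" by blast
      also have "topspace (simplex_space n) - {t \<in> topspace (simplex_space n). pt n x t \<in> U \<inter> skeleton (Suc n)} =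
          {t \<in> standard_simplex n. pt n x t \<in> topspace Y - U}"
        using pt_in_skeleton[OF x] realization_point_in_topspace[OF x] by auto
      finally show "closedin (simplex_space n) {t \<in> standard_simplex n. pt n x t \<in> topspace Y - U}" .
    qed auto
    then show "openin Y U" using U openin_closedin_eq by blast
  qed
qed

end

section \<open>Contractibility of fixed point spaces\<close>

text \<open>The point \<open>(1 - s) t + s e\<close> of the cone over a simplex, with apex \<open>e\<close> as vertex \<open>0\<close>.\<close>

definition cone_point :: "real \<Rightarrow> (nat \<Rightarrow> real) \<Rightarrow> nat \<Rightarrow> real" where
  "cone_point s t i = (case i of 0 \<Rightarrow> s | Suc j \<Rightarrow> (1 - s) * t j)"

lemma sum_cone_point: "sum (cone_point s t) {..Suc i} = s + (1 - s) * sum t {..i}"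
  by (subst sum.atMost_Suc_shift) (simp add: cone_point_def sum_distrib_left)

lemma cone_point_in_standard_simplex:
  assumes "s \<in> {0..1}" "t \<in> standard_simplex n"
  shows "cone_point s t \<in> standard_simplex (Suc n)"
proof (rule standard_simplexI)
  show "sum (cone_point s t) {..Suc n} = 1"
    unfolding sum_cone_point using standard_simplexD(4)[OF assms(2)] by simp
qed (use assms standard_simplexD[OF assms(2)] in \<open>auto simp: cone_point_def split: nat.split\<close>)

lemma locate_cone_point_apex:
  "r < s \<Longrightarrow> locate (cone_point s t) r = 0"
  by (rule locate_eqI) (simp_all add: cone_point_def)

text \<open>The affine map from [s, 1) to [0, 1) carries the intervals of the cone point behind the
  apex to those of t; \<open>Suc\<close> accounts for the apex at index 0.\<close>

lemma locate_cone_point_base: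
  assumes t: "t \<in> standard_simplex n" and r: "s \<le> r" "r < 1"
  shows "locate (cone_point s t) r = Suc (locate t ((r - s) / (1 - s)))"
proof (rule locate_eqI)
  let ?r = "(r - s) / (1 - s)"
  have s: "0 < 1 - s" using r by simp
  then have "?r < 1" using r by simp
  note l = locate[OF t this]
  have e: "s + (1 - s) * ?r = r" using s by simp
  have "?r < sum t {..locate t ?r}" by (rule l)
  then have "s + (1 - s) * ?r < s + (1 - s) * sum t {..locate t ?r}"
    using s by (intro add_strict_left_mono mult_strict_left_mono)
  then show "r < sum (cone_point s t) {..Suc (locate t ?r)}" unfolding sum_cone_point e .
  fix j assume j: "j < Suc (locate t ?r)"
  show "sum (cone_point s t) {..j} \<le> r"
  proof (cases j)
    case 0
    then show ?thesis using r by (simp add: cone_point_def)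
  next
    case (Suc i)
    then have "sum t {..i} \<le> ?r" using l(3)[of i] j by simp
    then have "s + (1 - s) * sum t {..i} \<le> s + (1 - s) * ?r"
      using s by (intro add_left_mono mult_left_mono) auto
    then show ?thesis unfolding Suc sum_cone_point e .
  qed
qed

lemma continuous_map_from_sum_topology:
  assumes "\<And>i. i \<in> I \<Longrightarrow> continuous_map (T i) Z (\<lambda>t. f (i, t))"
  shows "continuous_map (sum_topology T I) Z f"
  unfolding continuous_map
proof (intro conjI allI impI)
  show "f ` topspace (sum_topology T I) \<subseteq> topspace Z"
    using assms by (fastforce simp: continuous_map_def)
  fix U assume "openin Z U"
  then have "openin (T i) {t \<in> topspace (T i). f (i, t) \<in> U}" if "i \<in> I" for i
    using assms[OF that] by (simp add: continuous_map)
  then show "openin (sum_topology T I) {p \<in> topspace (sum_topology T I). f p \<in> U}"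
    unfolding openin_sum_topology by auto
qed

context vertex_determined_sset
begin

definition subrealization :: "(nat \<Rightarrow> 'x set) \<Rightarrow> ((nat \<times> 'x) \<times> (nat \<Rightarrow> real)) set set" where
  "subrealization A = {pt n x t | n x t. x \<in> A n \<and> t \<in> standard_simplex n}"

text \<open>The contraction moves the step function of a point to the right and fills the gap with the
  value \<open>v\<^sub>0\<close>; it is well defined because step functions determine points.\<close>

lemma contractible_subrealization:
  assumes AX: "\<And>n. A n \<subseteq> Smp X n"
    and A_Opr: "\<And>m n \<theta> x. \<theta> \<in> ordinal_maps m n \<Longrightarrow> x \<in> A n \<Longrightarrow> Opr X m \<theta> x \<in> A m"
    and A_cone: "\<And>n x. x \<in> A n \<Longrightarrow> \<exists>y\<in>A (Suc n). vx y 0 = v\<^sub>0 \<and> (\<forall>i\<le>n. vx y (Suc i) = vx x i)"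
  shows "contractible_space (subtopology (realization X) (subrealization A))"
proof (cases "\<exists>n x. x \<in> A n")
  case False
  then have "subrealization A = {}" by (simp add: subrealization_def)
  then show ?thesis by (simp add: contractible_space_empty)
next
  case True
  let ?F = "subtopology (realization X) (subrealization A)"
  let ?I = "top_of_set {0..1::real}"
  define J where "J = (SIGMA n:UNIV. A n)"
  let ?S = "sum_topology (\<lambda>(n, x). simplex_space n) J"
  let ?q = "\<lambda>((n, x), t). pt n x t"
  have topS: "topspace ?S = {((n, x), t). x \<in> A n \<and> t \<in> standard_simplex n}" by (auto simp: J_def)
  have sub: "subrealization A \<subseteq> topspace (realization X)"
    using AX by (auto simp: subrealization_def intro!: realization_point_in_topspace)
  then have topF: "topspace ?F = subrealization A" by auto
  \<comment> \<open>Normal forms stay in A because their simplices arise from members of A by an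
    operator.\<close>
  have nfA: "y \<in> A m" if "pt m y u \<in> subrealization A" "y \<in> nondegenerate m" "u \<in> simplex_interior m" for m y u
  proof -
    obtain n x t where x: "x \<in> A n" "t \<in> standard_simplex n" "pt m y u = pt n x t"
      using \<open>pt m y u \<in> subrealization A\<close> unfolding subrealization_def by blast
    obtain m' y' u' where y': "y' \<in> nondegenerate m'" "u' \<in> simplex_interior m'" "pt n x t = pt m' y' u'"
      "\<exists>\<epsilon>\<in>ordinal_maps m' n. y' = Opr X m' \<epsilon> x"
      using normal_form_bounded[of x n t] AX x by (metis subsetD)
    have "m = m'" "y = y'" using normal_form_unique[of m y u m' y' u'] x y' that by auto
    then show ?thesis using y'(4) A_Opr x(1) by blast
  qed
  \<comment> \<open>The subspace topology is the quotient topology from the simplices in A. A set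
    with closed preimages there is closed even in the whole realization: by \<open>nfA\<close>, the
    nondegenerate simplices with an interior point in it all belong to A.\<close>
  have q: "quotient_map ?S ?F ?q"
    unfolding quotient_map_closedin
  proof (intro conjI allI impI)
    have "?q ` topspace ?S = subrealization A" unfolding topS by (force simp: subrealization_def)
    then show "?q ` topspace ?S = topspace ?F" unfolding topF .
    fix U assume U: "U \<subseteq> topspace ?F"
    have cq: "continuous_map ?S ?F ?q"
    proof (rule continuous_map_from_sum_topology)
      fix k assume "k \<in> J"
      then obtain n x where k: "k = (n, x)" "x \<in> A n" by (auto simp: J_def)
      then have "x \<in> Smp X n" using AX by blast
      with k show "continuous_map (case k of (n, x) \<Rightarrow> simplex_space n) ?F (\<lambda>t. ?q (k, t))"
        by (auto simp: continuous_map_in_subtopology continuous_map_realization_point subrealization_def)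
    qed
    show "closedin ?S {p \<in> topspace ?S. ?q p \<in> U} \<longleftrightarrow> closedin ?F U"
    proof
      assume cl: "closedin ?S {p \<in> topspace ?S. ?q p \<in> U}"
      have "closedin (realization X) U"
      proof (rule closedin_realizationI)
        show "U \<subseteq> topspace (realization X)" using U by auto
        fix m y u assume y: "y \<in> nondegenerate m" "u \<in> simplex_interior m" "pt m y u \<in> U"
        then have "y \<in> A m" using U by (intro nfA) auto
        then have "closedin (simplex_space m) {v. ((m, y), v) \<in> {p \<in> topspace ?S. ?q p \<in> U}}"
          using cl unfolding closedin_sum_topology J_def by auto
        also have "{v. ((m, y), v) \<in> {p \<in> topspace ?S. ?q p \<in> U}} = {v \<in> standard_simplex m. pt m y v \<in> U}"
          using \<open>y \<in> A m\<close> by (auto simp: J_def)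
        finally show "closedin (simplex_space m) {v \<in> standard_simplex m. pt m y v \<in> U}" .
      qed
      then show "closedin ?F U" using U by (intro closedin_subset_topspace) auto
    next
      assume "closedin ?F U"
      then show "closedin ?S {p \<in> topspace ?S. ?q p \<in> U}" by (rule closedin_continuous_map_preimage[OF cq])
    qed
  qed
  define cone where "cone n x = (SOME y. y \<in> A (Suc n) \<and> vx y 0 = v\<^sub>0 \<and> (\<forall>i\<le>n. vx y (Suc i) = vx x i))" for n x
  have cone: "cone n x \<in> A (Suc n)" "vx (cone n x) 0 = v\<^sub>0" "\<And>i. i \<le> n \<Longrightarrow> vx (cone n x) (Suc i) = vx x i"
    if "x \<in> A n" for n x
    using someI_ex[of "\<lambda>y. y \<in> A (Suc n) \<and> vx y 0 = v\<^sub>0 \<and> (\<forall>i\<le>n. vx y (Suc i) = vx x i)"] A_cone[OF that]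
    unfolding cone_def[symmetric] by blast+
  have coneX: "cone n x \<in> Smp X (Suc n)" if "x \<in> A n" for n x using cone(1)[OF that] AX by blast
  obtain n\<^sub>0 x\<^sub>0 where "x\<^sub>0 \<in> A n\<^sub>0" using True by blast
  \<comment> \<open>The apex as a 0-simplex: vertex 0 of an arbitrary cone.\<close>
  define e where "e = Opr X 0 (\<lambda>_. 0) (cone n\<^sub>0 x\<^sub>0)"
  have c0: "(\<lambda>_. 0) \<in> ordinal_maps 0 (Suc n\<^sub>0)" by (auto simp: ordinal_maps_def mono_on_def)
  have e: "e \<in> A 0" "vx e 0 = v\<^sub>0"
    using A_Opr[OF c0 cone(1)[OF \<open>x\<^sub>0 \<in> A n\<^sub>0\<close>]] vx_Opr[OF c0 coneX[OF \<open>x\<^sub>0 \<in> A n\<^sub>0\<close>]]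
      cone(2)[OF \<open>x\<^sub>0 \<in> A n\<^sub>0\<close>] by (simp_all add: e_def)
  have eX: "e \<in> Smp X 0" using e AX by blast
  have b0: "simplex_barycentre 0 \<in> standard_simplex 0"
    using simplex_barycentre_interior[of 0] by (simp add: simplex_interior_def)
  have vx_cone: "vx (cone n x) (locate (cone_point s t) r) =
      (if r < s then v\<^sub>0 else vx x (locate t ((r - s) / (1 - s))))"
    if "x \<in> A n" "t \<in> standard_simplex n" "s \<in> {0..1}" "r < 1" for n x t s r
    using that cone(2,3)[OF that(1)] locate(1)[OF that(2), of "(r - s) / (1 - s)"]
    by (auto simp: locate_cone_point_apex locate_cone_point_base)
  have h_cong: "pt (Suc n) (cone n x) (cone_point s t) = pt (Suc m) (cone m y) (cone_point s u)"
    if x: "x \<in> A n" "t \<in> standard_simplex n" and y: "y \<in> A m" "u \<in> standard_simplex m"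
      and s: "s \<in> {0..1}" and eq: "pt n x t = pt m y u" for n x t m y u s
  proof (rule realization_point_eqI[OF coneX[OF x(1)] cone_point_in_standard_simplex[OF s x(2)]
        coneX[OF y(1)] cone_point_in_standard_simplex[OF s y(2)]])
    fix r :: real assume r: "0 \<le> r" "r < 1"
    have "vx x (locate t ((r - s) / (1 - s))) = vx y (locate u ((r - s) / (1 - s)))" if "\<not> r < s"
      using x y AX that r by (intro step_function_invariant[OF eq]) auto
    then show "vx (cone n x) (locate (cone_point s t) r) = vx (cone m y) (locate (cone_point s u) r)"
      using x y s r by (simp add: vx_cone)
  qed
  \<comment> \<open>The choice ranges over representatives of c; by \<open>h_cong\<close> the result
    is the same for all of them.\<close>
  define H where "H = (\<lambda>(s, c). SOME d. \<exists>n x t. x \<in> A n \<and> t \<in> standard_simplex n \<and> c = pt n x t \<and>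
      d = pt (Suc n) (cone n x) (cone_point s t))"
  have H: "H (s, pt n x t) = pt (Suc n) (cone n x) (cone_point s t)"
    if "x \<in> A n" "t \<in> standard_simplex n" "s \<in> {0..1}" for n x t s
    unfolding H_def prod.case
  proof (rule some_equality)
    fix d assume "\<exists>m y u. y \<in> A m \<and> u \<in> standard_simplex m \<and> pt n x t = pt m y u \<and>
      d = pt (Suc m) (cone m y) (cone_point s u)"
    then show "d = pt (Suc n) (cone n x) (cone_point s t)" using h_cong that by metis
  qed (use that in blast)
  \<comment> \<open>Before passing to the quotient, the domain is a union of disjoint open pieces,
    one cylinder over each simplex in A, and continuity is checked on each.\<close>
  have "continuous_map (prod_topology ?I ?S) ?F (H \<circ> (\<lambda>(s, p). (s, ?q p)))"
  proof (rule pasting_lemma[where I = J and T = "\<lambda>k. {0..1} \<times> ({k} \<times> topspace (case k of (n, x) \<Rightarrow> simplex_space n))"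
        and f = "\<lambda>(n, x) (s, (k, t)). pt (Suc n) (cone n x) (cone_point s t)"])
    fix k assume "k \<in> J"
    then obtain n x where k: "k = (n, x)" "x \<in> A n" by (auto simp: J_def)
    let ?T = "{0..1} \<times> ({k} \<times> topspace (case k of (n, x) \<Rightarrow> simplex_space n))"
    have "openin (case i of (n, x) \<Rightarrow> simplex_space n)
        {t. (i, t) \<in> {k} \<times> topspace (case k of (n, x) \<Rightarrow> simplex_space n)}" for i
      by (cases "i = k") (simp_all del: topspace_simplex_space add: openin_topspace)
    then have "openin ?S ({k} \<times> topspace (case k of (n, x) \<Rightarrow> simplex_space n))"
      unfolding openin_sum_topology using \<open>k \<in> J\<close> by auto
    moreover have "openin ?I {0..1}" by auto
    ultimately show "openin (prod_topology ?I ?S) ?T" by (simp add: openin_prod_Times_iff)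
    let ?PT = "subtopology (prod_topology ?I ?S) ?T"
    have cs: "continuous_map ?PT euclideanreal fst"
      by (intro continuous_map_from_subtopology continuous_map_into_fulltopology[OF continuous_map_fst])
    have "continuous_map ?S euclideanreal (\<lambda>p. snd p j)" for j
      by (rule continuous_map_from_sum_topology) (auto simp: continuous_map_simplex_coordinate)
    then have ct: "continuous_map ?PT euclideanreal (\<lambda>p. snd (snd p) j)" for j
      using continuous_map_compose[OF continuous_map_snd]
      by (intro continuous_map_from_subtopology) (force simp: comp_def)
    have "continuous_map ?PT euclideanreal (\<lambda>p. cone_point (fst p) (snd (snd p)) i)" for i
      unfolding cone_point_def
      by (cases i) (auto intro!: cs ct continuous_map_real_mult continuous_map_diff)
    then have "continuous_map ?PT (simplex_space (Suc n)) (\<lambda>p. cone_point (fst p) (snd (snd p)))"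
      unfolding continuous_map_into_simplex_space using k by (auto simp: cone_point_in_standard_simplex)
    then have "continuous_map ?PT (realization X) (pt (Suc n) (cone n x) \<circ> (\<lambda>p. cone_point (fst p) (snd (snd p))))"
      using continuous_map_realization_point[OF coneX[OF k(2)]] by (rule continuous_map_compose)
    then have "continuous_map ?PT ?F (pt (Suc n) (cone n x) \<circ> (\<lambda>p. cone_point (fst p) (snd (snd p))))"
      unfolding continuous_map_in_subtopology using k cone(1)[OF k(2)]
      by (auto simp: subrealization_def cone_point_in_standard_simplex) (metis cone_point_in_standard_simplex atLeastAtMost_iff)
    then show "continuous_map ?PT ?F ((\<lambda>(n, x) (s, (k, t)). pt (Suc n) (cone n x) (cone_point s t)) k)"
      by (simp add: k(1) comp_def case_prod_unfold)
  next
    fix p assume "p \<in> topspace (prod_topology ?I ?S)"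
    then obtain s n x t where p: "p = (s, ((n, x), t))" "s \<in> {0..1}" "x \<in> A n" "t \<in> standard_simplex n"
      by (auto simp: J_def)
    then show "\<exists>k. k \<in> J \<and> p \<in> {0..1} \<times> ({k} \<times> topspace (case k of (n, x) \<Rightarrow> simplex_space n)) \<and>
      (H \<circ> (\<lambda>(s, p). (s, ?q p))) p = (\<lambda>(n, x) (s, (k, t)). pt (Suc n) (cone n x) (cone_point s t)) k p"
      by (intro exI[of _ "(n, x)"]) (auto simp: J_def H)
  qed auto
  \<comment> \<open>Products need not preserve quotient maps; here the factor [0, 1] is locally
    compact Hausdorff.\<close>
  moreover have "quotient_map (prod_topology ?I ?S) (prod_topology ?I ?F) (\<lambda>(s, p). (s, ?q p))"
    by (rule quotient_map_prod_right[OF _ _ q])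
      (auto intro: compact_imp_locally_compact_space simp: compact_space_subtopology Hausdorff_space_subtopology)
  ultimately have Hc: "continuous_map (prod_topology ?I ?F) ?F H"
    by (rule continuous_compose_quotient_map[rotated])
  have "homotopic_with (\<lambda>_. True) ?F ?F id (\<lambda>_. pt 0 e (simplex_barycentre 0))"
  proof (subst homotopic_with, simp, intro exI[of _ H] conjI ballI Hc)
    fix c assume "c \<in> topspace ?F"
    then have "c \<in> subrealization A" unfolding topF .
    then obtain n x t where c: "x \<in> A n" "t \<in> standard_simplex n" "c = pt n x t"
      unfolding subrealization_def by blast
    \<comment> \<open>At s = 0 the apex has an empty interval and the step function is unchanged; at
      s = 1 it fills [0, 1), leaving the constant function \<open>v\<^sub>0\<close>.\<close>
    have "pt (Suc n) (cone n x) (cone_point 0 t) = pt n x t"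
      using c AX by (intro realization_point_eqI coneX cone_point_in_standard_simplex) (auto simp: vx_cone)
    then show "H (0, c) = id c" using c by (simp add: H)
    have "locate (simplex_barycentre 0) r = 0" if "r < 1" for r
      using locate(1)[OF b0 that] by simp
    then have "pt (Suc n) (cone n x) (cone_point 1 t) = pt 0 e (simplex_barycentre 0)"
      using c eX e b0 by (intro realization_point_eqI coneX cone_point_in_standard_simplex) (auto simp: vx_cone)
    then show "H (1, c) = pt 0 e (simplex_barycentre 0)" using c by (simp add: H)
  qed auto
  then show ?thesis unfolding contractible_space_def by blast
qed

end

section \<open>Fixed points and isotropy\<close>

context simplicial_G_action
begin

lemma action_Opr:
  assumes "g \<in> carrier G" "\<theta> \<in> ordinal_maps m n" "x \<in> Smp X n"
  shows "\<rho> g m (Opr X m \<theta> x) = Opr X m \<theta> (\<rho> g n x)"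
  using assms
  by (intro simplex_eqI[of _ m])
    (auto simp: action_simplex vx_action vx_Opr simplicial_setD(1)[OF simplicial] ordinal_mapsD)

text \<open>An arbitrary representative of a fixed point says little about its simplex; the normal
  form does, through \<open>fixes_point_iff\<close>.\<close>

lemma fixed_points_eq_subrealization:
  assumes "H \<subseteq> carrier G"
  shows "fixed_points Y act H = subrealization (\<lambda>n. {x \<in> Smp X n. \<forall>h\<in>H. \<rho> h n x = x})"
proof (intro equalityI subsetI)
  fix c assume c: "c \<in> fixed_points Y act H"
  then have "c \<in> topspace Y" by (simp add: fixed_points_def)
  then obtain n x t where x: "x \<in> nondegenerate n" "t \<in> simplex_interior n" "c = pt n x t"
    by (rule normal_form)
  have "\<forall>h\<in>H. \<rho> h n x = x"
  proof
    fix h assume h: "h \<in> H"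
    then have "act h (pt n x t) = pt n x t" using c x(3) by (simp add: fixed_points_def)
    then show "\<rho> h n x = x" using fixes_point_iff[OF _ x(1,2)] h assms by blast
  qed
  with x show "c \<in> subrealization (\<lambda>n. {x \<in> Smp X n. \<forall>h\<in>H. \<rho> h n x = x})"
    unfolding subrealization_def by (auto simp: nondegenerate_def simplex_interior_def)
next
  fix c assume "c \<in> subrealization (\<lambda>n. {x \<in> Smp X n. \<forall>h\<in>H. \<rho> h n x = x})"
  then obtain n x t where x: "x \<in> Smp X n" "\<forall>h\<in>H. \<rho> h n x = x" "t \<in> standard_simplex n" "c = pt n x t"
    unfolding subrealization_def by blast
  then show "c \<in> fixed_points Y act H"
    using assms unfolding fixed_points_def
    by (auto simp: act_pt realization_point_in_topspace subset_iff)
qed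

lemma contractible_fixed_points:
  assumes H: "H \<subseteq> carrier G"
    and cone: "\<And>n x. x \<in> Smp X n \<Longrightarrow> (\<And>h. h \<in> H \<Longrightarrow> \<rho> h n x = x) \<Longrightarrow>
      \<exists>y\<in>Smp X (Suc n). (\<forall>h\<in>H. \<rho> h (Suc n) y = y) \<and> vx y 0 = v\<^sub>0 \<and> (\<forall>i\<le>n. vx y (Suc i) = vx x i)"
  shows "contractible_space (subtopology Y (fixed_points Y act H))"
  unfolding fixed_points_eq_subrealization[OF H]
proof (rule contractible_subrealization[where v\<^sub>0 = v\<^sub>0])
  fix m n \<theta> x assume "\<theta> \<in> ordinal_maps m n" "x \<in> {x \<in> Smp X n. \<forall>h\<in>H. \<rho> h n x = x}"
  then show "Opr X m \<theta> x \<in> {x \<in> Smp X m. \<forall>h\<in>H. \<rho> h m x = x}"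
    using H by (auto simp: action_Opr simplicial_setD(1)[OF simplicial] subset_iff)
next
  fix n x assume "x \<in> {x \<in> Smp X n. \<forall>h\<in>H. \<rho> h n x = x}"
  then obtain y where "y \<in> Smp X (Suc n)" "\<forall>h\<in>H. \<rho> h (Suc n) y = y" "vx y 0 = v\<^sub>0" "\<forall>i\<le>n. vx y (Suc i) = vx x i"
    using cone[of x n] by auto
  then show "\<exists>y\<in>{x \<in> Smp X (Suc n). \<forall>h\<in>H. \<rho> h (Suc n) x = x}. vx y 0 = v\<^sub>0 \<and> (\<forall>i\<le>n. vx y (Suc i) = vx x i)"
    by blast
qed auto

lemma stabilizer_pt:
  assumes "x \<in> nondegenerate n" "t \<in> simplex_interior n"
  shows "stabilizer G act (pt n x t) = {g \<in> carrier G. \<rho> g n x = x}"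
  using fixes_point_iff[OF _ assms] by (auto simp: stabilizer_def)

end

section \<open>The nerve of the Grothendieck construction\<close>

definition thin :: "('o, 'm) cat \<Rightarrow> bool" where
  "thin C \<longleftrightarrow> (\<forall>u\<in>Ar C. \<forall>v\<in>Ar C. Src C u = Src C v \<longrightarrow> Tgt C u = Tgt C v \<longrightarrow> u = v)"

lemma thinD: "thin C \<Longrightarrow> u \<in> Ar C \<Longrightarrow> v \<in> Ar C \<Longrightarrow> Src C u = Src C v \<Longrightarrow> Tgt C u = Tgt C v \<Longrightarrow> u = v"
  by (simp add: thin_def)

lemma ordinal_cat_simps [simp]:
  "Ob (ordinal_cat n) = {..n}" "(i, j) \<in> Ar (ordinal_cat n) \<longleftrightarrow> i \<le> j \<and> j \<le> n"
  "Src (ordinal_cat n) (i, j) = i" "Tgt (ordinal_cat n) (i, j) = j"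
  "Idn (ordinal_cat n) i = (i, i)" "Cmp (ordinal_cat n) (j', k) (i, j) = (i, k)"
  by (simp_all add: ordinal_cat_def)

lemma FOb_nerve:
  assumes "\<sigma> \<in> Smp (nerve C) n" "i \<le> n" shows "FOb \<sigma> i \<in> Ob C"
  using assms by (auto simp: nerve_def is_functor_def)

lemma arrow_nerve:
  assumes "\<sigma> \<in> Smp (nerve C) n" "i \<le> j" "j \<le> n"
  shows "FAr \<sigma> (i, j) \<in> Ar C" "Src C (FAr \<sigma> (i, j)) = FOb \<sigma> i" "Tgt C (FAr \<sigma> (i, j)) = FOb \<sigma> j"
proof -
  have F: "is_functor (ordinal_cat n) C \<sigma>" and u: "(i, j) \<in> Ar (ordinal_cat n)"
    using assms by (simp_all add: nerve_def)
  then have "FAr \<sigma> \<in> Ar (ordinal_cat n) \<rightarrow>\<^sub>E Ar C" by (simp add: is_functor_def)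
  then show "FAr \<sigma> (i, j) \<in> Ar C" using u by (rule PiE_mem)
  have "Src C (FAr \<sigma> (i, j)) = FOb \<sigma> (Src (ordinal_cat n) (i, j)) \<and>
      Tgt C (FAr \<sigma> (i, j)) = FOb \<sigma> (Tgt (ordinal_cat n) (i, j))"
    using F u unfolding is_functor_def by blast
  then show "Src C (FAr \<sigma> (i, j)) = FOb \<sigma> i" "Tgt C (FAr \<sigma> (i, j)) = FOb \<sigma> j" by simp_all
qed

text \<open>Thinness determines each arrow of a simplex by its endpoints, and extensionality of both
  components turns agreement on [n] into equality of records.\<close>

lemma vertex_determined_nerve:
  assumes "thin C" shows "vertex_determined_sset (nerve C) FOb"
proof
  show "simplicial_set (nerve C)" by (rule simplicial_set_nerve)
next
  fix m n \<theta> \<sigma> i assume "\<theta> \<in> ordinal_maps m n" "\<sigma> \<in> Smp (nerve C) n" "i \<le> m"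
  then show "FOb (Opr (nerve C) m \<theta> \<sigma>) i = FOb \<sigma> (\<theta> i)"
    by (simp add: nerve_def fctr_comp_def ordinal_fctr_def compose_def)
next
  fix n \<sigma> \<tau> assume \<sigma>: "\<sigma> \<in> Smp (nerve C) n" and \<tau>: "\<tau> \<in> Smp (nerve C) n"
    and eq: "\<And>i. i \<le> n \<Longrightarrow> FOb \<sigma> i = FOb \<tau> i"
  have ext: "FOb \<phi> \<in> extensional {..n}" "FAr \<phi> \<in> extensional (Ar (ordinal_cat n))"
    if "\<phi> \<in> Smp (nerve C) n" for \<phi>
    using that by (auto simp: nerve_def is_functor_def PiE_def)
  have "FOb \<sigma> = FOb \<tau>"
    by (rule extensionalityI[OF ext(1)[OF \<sigma>] ext(1)[OF \<tau>]]) (simp add: eq)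
  moreover have "FAr \<sigma> = FAr \<tau>"
  proof (rule extensionalityI[OF ext(2)[OF \<sigma>] ext(2)[OF \<tau>]])
    fix u assume u: "u \<in> Ar (ordinal_cat n)"
    obtain i j where ij: "u = (i, j)" by fastforce
    then have "i \<le> j" "j \<le> n" using u by simp_all
    then show "FAr \<sigma> u = FAr \<tau> u"
      unfolding ij using arrow_nerve[OF \<sigma>] arrow_nerve[OF \<tau>] eq
      by (intro thinD[OF assms]) auto
  qed
  ultimately show "\<sigma> = \<tau>" by (cases \<sigma>; cases \<tau>) simp
qed

text \<open>Arrows may be chosen arbitrarily: parallel arrows coincide, so identities and composites
  are respected automatically.\<close>

lemma nerve_simplex_of_chain:
  assumes C: "category C" "thin C" and ob: "\<And>i. i \<le> n \<Longrightarrow> w i \<in> Ob C"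
    and ar: "\<And>i j. i \<le> j \<Longrightarrow> j \<le> n \<Longrightarrow> \<exists>u\<in>Ar C. Src C u = w i \<and> Tgt C u = w j"
  shows "\<exists>\<sigma>\<in>Smp (nerve C) n. \<forall>i\<le>n. FOb \<sigma> i = w i"
proof -
  define A where "A i j = (SOME u. u \<in> Ar C \<and> Src C u = w i \<and> Tgt C u = w j)" for i j
  have A: "A i j \<in> Ar C" "Src C (A i j) = w i" "Tgt C (A i j) = w j" if "i \<le> j" "j \<le> n" for i j
    using someI_ex[of "\<lambda>u. u \<in> Ar C \<and> Src C u = w i \<and> Tgt C u = w j"] ar[OF that]
    unfolding A_def[symmetric] by blast+
  define \<sigma> where "\<sigma> = \<lparr>FOb = restrict w {..n}, FAr = restrict (\<lambda>(i, j). A i j) (Ar (ordinal_cat n))\<rparr>"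
  have Id: "Idn C x \<in> Ar C" "Src C (Idn C x) = x" "Tgt C (Idn C x) = x" if "x \<in> Ob C" for x
    using C(1) that by (auto simp: category_def)
  have Cm: "Cmp C v u \<in> Ar C" "Src C (Cmp C v u) = Src C u" "Tgt C (Cmp C v u) = Tgt C v"
    if "u \<in> Ar C" "v \<in> Ar C" "Tgt C u = Src C v" for u v
    using C(1) that by (auto simp: category_def)
  have "is_functor (ordinal_cat n) C \<sigma>"
    unfolding is_functor_def
  proof (intro conjI ballI impI)
    show "FOb \<sigma> \<in> Ob (ordinal_cat n) \<rightarrow>\<^sub>E Ob C" using ob by (auto simp: \<sigma>_def)
    show "FAr \<sigma> \<in> Ar (ordinal_cat n) \<rightarrow>\<^sub>E Ar C" using A by (auto simp: \<sigma>_def)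
  next
    fix u assume "u \<in> Ar (ordinal_cat n)"
    then show "Src C (FAr \<sigma> u) = FOb \<sigma> (Src (ordinal_cat n) u)"
      "Tgt C (FAr \<sigma> u) = FOb \<sigma> (Tgt (ordinal_cat n) u)"
      using A by (cases u; simp add: \<sigma>_def)+
  next
    fix i assume "i \<in> Ob (ordinal_cat n)"
    then show "FAr \<sigma> (Idn (ordinal_cat n) i) = Idn C (FOb \<sigma> i)"
      using A[of i i] Id[OF ob[of i]] by (auto simp: \<sigma>_def intro!: thinD[OF C(2)])
  next
    fix u v assume uv: "u \<in> Ar (ordinal_cat n)" "v \<in> Ar (ordinal_cat n)"
      "Tgt (ordinal_cat n) u = Src (ordinal_cat n) v"
    obtain i j k where e: "u = (i, j)" "v = (j, k)" and le: "i \<le> j" "j \<le> k" "k \<le> n"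
      using uv by (cases u; cases v) auto
    have "A i k = Cmp C (A j k) (A i j)"
      using le A[of i j] A[of j k] A[of i k] Cm[of "A i j" "A j k"] by (intro thinD[OF C(2)]) auto
    then show "FAr \<sigma> (Cmp (ordinal_cat n) v u) = Cmp C (FAr \<sigma> v) (FAr \<sigma> u)"
      using le by (simp add: e \<sigma>_def)
  qed
  then show ?thesis by (intro bexI[of _ \<sigma>]) (simp_all add: nerve_def \<sigma>_def)
qed

section \<open>Pointed orbits: the objects and arrows of Gr R\<close>

context group
begin

abbreviation "GrR \<F> \<equiv> Gr (orbit_cat G \<F>) (R_functor G \<F>)"

lemma Ob_GrR: "Ob (GrR \<F>) = {(X, x). \<exists>H\<in>\<F>. X = lcosets H \<and> x \<in> X}"
  by (auto simp: Gr_def Let_def R_functor_def discrete_cat_def orbit_cat_def split: if_splits)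

lemma Ar_GrR:
  "w \<in> Ar (GrR \<F>) \<longleftrightarrow> (\<exists>X f Y x. w = ((X, x), ((X, f, Y), f x), (Y, f x)) \<and>
     (X, f, Y) \<in> Ar (orbit_cat G \<F>) \<and> x \<in> X)"
proof
  let ?O = "orbit_cat G \<F>" and ?R = "R_functor G \<F>"
  assume "w \<in> Ar (GrR \<F>)"
  then obtain X x Z f Z' v Y y where w: "w = ((X, x), ((Z, f, Z'), v), (Y, y))"
    and "((X, x), ((Z, f, Z'), v), (Y, y)) \<in> Ar (GrR \<F>)"
    by (cases w) auto
  then have "X \<in> Ob ?O" "x \<in> Ob (FOb ?R X)" "Y \<in> Ob ?O" "(Z, f, Z') \<in> Ar ?O"
    "Src ?O (Z, f, Z') = X" "Tgt ?O (Z, f, Z') = Y" "Tgt (FOb ?R Y) v = y"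
    "Src (FOb ?R Y) v = FOb (fst (snd (FAr ?R (Z, f, Z')))) x"
    by (simp_all add: Gr_def Let_def)
  moreover from this have "Z = X" "Z' = Y" by (simp_all add: orbit_cat_def)
  ultimately show "\<exists>X f Y x. w = ((X, x), ((X, f, Y), f x), (Y, f x)) \<and> (X, f, Y) \<in> Ar ?O \<and> x \<in> X"
    unfolding w by (auto simp: R_functor_def discrete_cat_def)
next
  let ?O = "orbit_cat G \<F>"
  assume "\<exists>X f Y x. w = ((X, x), ((X, f, Y), f x), (Y, f x)) \<and> (X, f, Y) \<in> Ar ?O \<and> x \<in> X"
  then obtain X f Y x where w: "w = ((X, x), ((X, f, Y), f x), (Y, f x))"
    "(X, f, Y) \<in> Ar ?O" "x \<in> X" by blast
  then have "X \<in> Ob ?O" "Y \<in> Ob ?O" "f x \<in> Y" by (auto simp: orbit_cat_def)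
  moreover have "Src ?O (X, f, Y) = X" "Tgt ?O (X, f, Y) = Y" by (simp_all add: orbit_cat_def)
  ultimately show "w \<in> Ar (GrR \<F>)"
    using w by (simp add: Gr_def Let_def R_functor_def discrete_cat_def)
qed

lemma Src_Tgt_GrR: "Src (GrR \<F>) (p, u, q) = p" "Tgt (GrR \<F>) (p, u, q) = q"
  by (simp_all add: Gr_def Let_def split_beta)

lemma lcosets_transitive:
  assumes "subgroup H G" "x \<in> lcosets H" "y \<in> lcosets H"
  shows "\<exists>g\<in>carrier G. y = g <# x"
proof -
  obtain a b where ab: "a \<in> carrier G" "x = a <# H" "b \<in> carrier G" "y = b <# H"
    using assms by (auto simp: LCOSETS_def)
  then have "(b \<otimes> inv a) <# x = y"
    using subgroup.subset[OF assms(1)] by (simp add: lcos_m_assoc m_assoc)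
  then show ?thesis using ab by (intro bexI[of _ "b \<otimes> inv a"]) auto
qed

lemma lcosets_subset_carrier: "subgroup H G \<Longrightarrow> x \<in> lcosets H \<Longrightarrow> x \<subseteq> carrier G"
  by (auto simp: LCOSETS_def l_coset_def dest: subgroup.mem_carrier)

lemma thin_GrR:
  assumes \<F>: "\<And>H. H \<in> \<F> \<Longrightarrow> subgroup H G"
  shows "thin (GrR \<F>)"
  unfolding thin_def
proof (intro ballI impI)
  fix u v assume uv: "u \<in> Ar (GrR \<F>)" "v \<in> Ar (GrR \<F>)" "Src (GrR \<F>) u = Src (GrR \<F>) v"
    "Tgt (GrR \<F>) u = Tgt (GrR \<F>) v"
  obtain X f Y x where u: "u = ((X, x), ((X, f, Y), f x), (Y, f x))"
    "(X, f, Y) \<in> Ar (orbit_cat G \<F>)" "x \<in> X" using uv(1) unfolding Ar_GrR by blast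
  obtain X' f' Y' x' where v: "v = ((X', x'), ((X', f', Y'), f' x'), (Y', f' x'))"
    "(X', f', Y') \<in> Ar (orbit_cat G \<F>)" "x' \<in> X'" using uv(2) unfolding Ar_GrR by blast
  have e: "X' = X" "x' = x" "Y' = Y" "f' x = f x" using uv(3,4) by (simp_all add: u(1) v(1) Src_Tgt_GrR)
  obtain H where H: "H \<in> \<F>" "X = lcosets H" using u(2) by (auto simp: orbit_cat_def)
  have f: "f \<in> X \<rightarrow>\<^sub>E Y" "\<forall>g\<in>carrier G. \<forall>x\<in>X. f (g <# x) = g <# f x"
    and f': "f' \<in> X \<rightarrow>\<^sub>E Y" "\<forall>g\<in>carrier G. \<forall>x\<in>X. f' (g <# x) = g <# f' x"
    using u(2) v(2) by (simp_all add: orbit_cat_def e)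
  have "f = f'"
  proof (rule extensionalityI[of _ X])
    show "f \<in> extensional X" "f' \<in> extensional X" using f(1) f'(1) by (simp_all add: PiE_def)
    fix y assume "y \<in> X"
    then obtain g where "g \<in> carrier G" "y = g <# x"
      using lcosets_transitive[OF \<F>[OF H(1)]] u(3) H(2) by blast
    then show "f y = f' y" using f(2) f'(2) u(3) e(4) by simp
  qed
  then show "u = v" unfolding u(1) v(1) e by simp
qed

text \<open>The universal property of G/H: a G-map out of it amounts to an H-fixed element of the
  target, the image of the coset H.\<close>

lemma orbit_map_exists:
  assumes H: "H \<in> \<F>" "subgroup H G" and K: "K \<in> \<F>" "subgroup K G" and x: "x \<in> lcosets K"
    and stab: "\<And>h. h \<in> H \<Longrightarrow> h <# x = x"
  shows "\<exists>f. (lcosets H, f, lcosets K) \<in> Ar (orbit_cat G \<F>) \<and> f H = x"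
proof -
  \<comment> \<open>Any element of the coset may be chosen, because two of them differ by an element
    of H, which fixes x.\<close>
  define f where "f = restrict (\<lambda>C. (SOME g. g \<in> C) <# x) (lcosets H)"
  have xc: "x \<subseteq> carrier G" using lcosets_subset_carrier[OF K(2) x] .
  have Hc: "H \<subseteq> carrier G" using H(2) by (rule subgroup.subset)
  have f: "f (g <# H) = g <# x" if g: "g \<in> carrier G" for g
  proof -
    have "g \<otimes> \<one> \<in> g <# H" using subgroup.one_closed[OF H(2)] unfolding l_coset_def by blast
    then have "(SOME k. k \<in> g <# H) \<in> g <# H" by (rule someI)
    then obtain h where h: "h \<in> H" "(SOME k. k \<in> g <# H) = g \<otimes> h" unfolding l_coset_def by blast
    have "(g \<otimes> h) <# x = g <# (h <# x)" using g h Hc xc by (intro lcos_m_assoc[symmetric]) auto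
    moreover have "g <# H \<in> lcosets H" using g by (auto simp: LCOSETS_def)
    ultimately show ?thesis by (simp add: f_def h(2) stab[OF h(1)])
  qed
  have "f \<in> lcosets H \<rightarrow>\<^sub>E lcosets K"
  proof (rule PiE_I)
    fix C assume "C \<in> lcosets H"
    then obtain g where "g \<in> carrier G" "C = g <# H" by (auto simp: LCOSETS_def)
    then show "f C \<in> lcosets K" using f lcosets_translate[OF K(2) x] by simp
  qed (simp add: f_def)
  moreover have "f (g <# C) = g <# f C" if g: "g \<in> carrier G" and C: "C \<in> lcosets H" for g C
  proof -
    obtain k where k: "k \<in> carrier G" "C = k <# H" using C by (auto simp: LCOSETS_def)
    have "g <# C = (g \<otimes> k) <# H" using g k Hc by (simp add: lcos_m_assoc)
    then show ?thesis using g k xc by (simp add: f lcos_m_assoc)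
  qed
  moreover have "f H = x" using f[of \<one>] Hc xc by (simp add: lcos_mult_one)
  ultimately show ?thesis using H(1) K(1) by (intro exI[of _ f]) (auto simp: orbit_cat_def)
qed

text \<open>Right multiplication by a fixed element of x embeds the stabilizer into x.\<close>

lemma finite_coset_stabilizer:
  assumes "finite x" "x \<noteq> {}" "x \<subseteq> carrier G"
  shows "finite {g \<in> carrier G. g <# x = x}"
proof -
  obtain c where c: "c \<in> x" using assms(2) by blast
  have "inj_on (\<lambda>g. g \<otimes> c) {g \<in> carrier G. g <# x = x}"
    using c assms(3) by (auto intro!: inj_onI)
  moreover have "(\<lambda>g. g \<otimes> c) ` {g \<in> carrier G. g <# x = x} \<subseteq> x"
  proof (intro image_subsetI)
    fix g assume g: "g \<in> {g \<in> carrier G. g <# x = x}"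
    have "g \<otimes> c \<in> g <# x" using c unfolding l_coset_def by blast
    then show "g \<otimes> c \<in> x" using g by simp
  qed
  ultimately show ?thesis using assms(1) by (rule inj_on_finite)
qed

lemma simplicial_G_action_GrR:
  assumes \<F>: "\<And>H. H \<in> \<F> \<Longrightarrow> subgroup H G"
  shows "simplicial_G_action (nerve (GrR \<F>)) FOb G (\<lambda>g. nerve_map (GrR_translation G \<F> g))
    (\<lambda>g (X, x). (X, g <# x))"
proof -
  let ?N = "nerve (GrR \<F>)" and ?\<rho> = "\<lambda>g. nerve_map (GrR_translation G \<F> g)"
  interpret vertex_determined_sset ?N FOb
    using thin_GrR[OF \<F>] by (rule vertex_determined_nerve)
  have simplex: "?\<rho> g n \<sigma> \<in> Smp ?N n" if "g \<in> carrier G" "\<sigma> \<in> Smp ?N n" for g n \<sigma>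
    using that is_functor_comp[OF category_ordinal_cat _ is_functor_GrR_translation[OF is_group \<F> that(1)]]
    by (simp add: nerve_def nerve_map_def)
  have vx: "FOb (?\<rho> g n \<sigma>) i = (case FOb \<sigma> i of (X, x) \<Rightarrow> (X, g <# x))"
    if "g \<in> carrier G" "\<sigma> \<in> Smp ?N n" "i \<le> n" for g n \<sigma> i
    using that FOb_nerve[OF that(2,3)]
    by (simp add: nerve_map_def fctr_comp_def compose_def GrR_translation_def)
  have ob: "\<exists>X x. FOb \<sigma> i = (X, x) \<and> x \<subseteq> carrier G" if \<sigma>: "\<sigma> \<in> Smp ?N n" "i \<le> n" for \<sigma> n i
  proof -
    obtain X x H where "FOb \<sigma> i = (X, x)" "H \<in> \<F>" "x \<in> lcosets H"
      using FOb_nerve[OF \<sigma>] by (auto simp: Ob_GrR)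
    then show ?thesis using lcosets_subset_carrier[OF \<F>] by blast
  qed
  show ?thesis
  proof
    fix n \<sigma> assume \<sigma>: "\<sigma> \<in> Smp ?N n"
    show "?\<rho> \<one> n \<sigma> = \<sigma>"
      using \<sigma> ob[OF \<sigma>] by (intro simplex_eqI[of _ n]) (fastforce simp: vx simplex lcos_mult_one)+
    show "?\<rho> (g \<otimes> h) n \<sigma> = ?\<rho> g n (?\<rho> h n \<sigma>)" if gh: "g \<in> carrier G" "h \<in> carrier G" for g h
    proof (rule simplex_eqI[of _ n])
      fix i assume i: "i \<le> n"
      obtain X x where "FOb \<sigma> i = (X, x)" "x \<subseteq> carrier G" using ob[OF \<sigma> i] by blast
      then show "FOb (?\<rho> (g \<otimes> h) n \<sigma>) i = FOb (?\<rho> g n (?\<rho> h n \<sigma>)) i"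
        using gh \<sigma> i by (simp add: vx simplex lcos_m_assoc)
    qed (use gh \<sigma> in \<open>simp_all add: simplex\<close>)
  qed (fact simplex, fact vx)
qed

lemma is_model_E_nerve_GrR:
  "is_model_E G (finite_subgroups G) (realization (nerve (GrR (finite_subgroups G))))
     (GrR_nerve_action G (finite_subgroups G))"
proof -
  let ?\<F> = "finite_subgroups G" and ?\<rho> = "\<lambda>g. nerve_map (GrR_translation G (finite_subgroups G) g)"
  let ?N = "nerve (GrR ?\<F>)"
  have \<F>: "subgroup H G" "finite H" if "H \<in> ?\<F>" for H
    using that by (simp_all add: finite_subgroups_def)
  have cat: "category (GrR ?\<F>)" using is_group \<F> by (intro category_Gr category_orbit_cat is_functor_R)
  have thin: "thin (GrR ?\<F>)" using \<F> by (intro thin_GrR)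
  interpret simplicial_G_action ?N FOb G ?\<rho> "\<lambda>g (X, x). (X, g <# x)"
    using \<F> by (intro simplicial_G_action_GrR)
  have act: "GrR_nerve_action G ?\<F> = act"
    by (simp add: fun_eq_iff GrR_nerve_action_def act_def Let_def)
  have stab: "stabilizer G act c \<in> ?\<F>" if c: "c \<in> topspace (realization ?N)" for c
  proof -
    obtain n \<sigma> t where \<sigma>: "\<sigma> \<in> nondegenerate n" "t \<in> simplex_interior n" "c = pt n \<sigma> t"
      using normal_form[OF c] .
    have \<sigma>N: "\<sigma> \<in> Smp ?N n" using \<sigma>(1) by (simp add: nondegenerate_def)
    obtain X x H where x: "FOb \<sigma> 0 = (X, x)" "H \<in> ?\<F>" "x \<in> lcosets H"
      using FOb_nerve[OF \<sigma>N, of 0] by (auto simp: Ob_GrR)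
    obtain a where a: "a \<in> carrier G" "x = a <# H" using x(3) by (auto simp: LCOSETS_def)
    have "x = (\<lambda>h. a \<otimes> h) ` H" unfolding a(2) l_coset_def by auto
    then have fx: "finite x" "x \<noteq> {}" "x \<subseteq> carrier G"
      using \<F>[OF x(2)] subgroup.one_closed lcosets_subset_carrier[OF \<F>(1)[OF x(2)] x(3)] by auto
    \<comment> \<open>Looking at vertex 0 suffices: the stabilizer of the point lies in the
      stabilizer of this finite coset.\<close>
    have "g <# x = x" if "g \<in> carrier G" "?\<rho> g n \<sigma> = \<sigma>" for g
      using vx_action[OF that(1) \<sigma>N, of 0] that(2) x(1) by simp
    then have "stabilizer G act c \<subseteq> {g \<in> carrier G. g <# x = x}"
      unfolding \<sigma>(3) stabilizer_pt[OF \<sigma>(1,2)] by blast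
    then have "finite (stabilizer G act c)" using finite_coset_stabilizer[OF fx] by (rule finite_subset)
    then show ?thesis
      using group_action.stabilizer_subgroup[OF group_action_act c] by (simp add: finite_subgroups_def)
  qed
  have contr: "fixed_points (realization ?N) act H \<noteq> {} \<and>
      contractible_space (subtopology (realization ?N) (fixed_points (realization ?N) act H))"
    if H: "H \<in> ?\<F>" for H
  proof -
    have Hc: "H \<subseteq> carrier G" using \<F>(1)[OF H] by (rule subgroup.subset)
    let ?c = "(lcosets H, H)"
    have "\<one> <# H \<in> lcosets H" by (auto simp: LCOSETS_def)
    then have c: "?c \<in> Ob (GrR ?\<F>)" using H Hc by (auto simp: Ob_GrR lcos_mult_one)
    have hH: "h <# H = H" if "h \<in> H" for h
    proof -
      have "h <# H = \<one> <# H"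
        using that Hc \<F>(1)[OF H] by (intro l_repr_independence[symmetric]) (auto simp: lcos_mult_one)
      then show ?thesis using Hc by (simp add: lcos_mult_one)
    qed
    have idn: "\<exists>u\<in>Ar (GrR ?\<F>). Src (GrR ?\<F>) u = p \<and> Tgt (GrR ?\<F>) u = p" if "p \<in> Ob (GrR ?\<F>)" for p
      using cat that by (auto simp: category_def)
    \<comment> \<open>An arrow from \<open>?c\<close> to (X, x) is a G-map sending the coset H to x,
      so being fixed by H is exactly the condition for its existence.\<close>
    have initial: "\<exists>u\<in>Ar (GrR ?\<F>). Src (GrR ?\<F>) u = ?c \<and> Tgt (GrR ?\<F>) u = (X, x)"
      if ob: "(X, x) \<in> Ob (GrR ?\<F>)" and hx: "\<And>h. h \<in> H \<Longrightarrow> h <# x = x" for X x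
    proof -
      obtain K where K: "K \<in> ?\<F>" "X = lcosets K" "x \<in> lcosets K" using ob by (auto simp: Ob_GrR)
      then obtain f where f: "(lcosets H, f, X) \<in> Ar (orbit_cat G ?\<F>)" "f H = x"
        using orbit_map_exists[OF H \<F>(1)[OF H] K(1) \<F>(1)[OF K(1)] K(3) hx] by blast
      have "H \<in> lcosets H" using c by (simp add: Ob_GrR)
      then have "(?c, ((lcosets H, f, X), f H), (X, f H)) \<in> Ar (GrR ?\<F>)"
        unfolding Ar_GrR using f(1) by blast
      then show ?thesis using f(2) by (intro bexI) (auto simp: Src_Tgt_GrR)
    qed
    have fixed: "?\<rho> h n \<sigma> = \<sigma>" if "h \<in> H" "\<sigma> \<in> Smp ?N n"
      "\<And>i X x. i \<le> n \<Longrightarrow> FOb \<sigma> i = (X, x) \<Longrightarrow> h <# x = x" for h n \<sigma>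
    proof (rule simplex_eqI[of _ n])
      show "?\<rho> h n \<sigma> \<in> Smp ?N n" using that Hc by (auto intro: action_simplex)
      fix i assume "i \<le> n"
      then show "FOb (?\<rho> h n \<sigma>) i = FOb \<sigma> i"
        using that(3)[of i] vx_action[of h \<sigma> n i] that(1,2) Hc by (cases "FOb \<sigma> i") auto
    qed fact
    \<comment> \<open>The apex alone witnesses that the fixed point set is nonempty.\<close>
    obtain \<sigma>\<^sub>0 where \<sigma>\<^sub>0: "\<sigma>\<^sub>0 \<in> Smp ?N 0" "\<forall>i\<le>0. FOb \<sigma>\<^sub>0 i = ?c"
      using nerve_simplex_of_chain[OF cat thin, of 0 "\<lambda>_. ?c", OF c idn[OF c]] by blast
    have "\<forall>h\<in>H. ?\<rho> h 0 \<sigma>\<^sub>0 = \<sigma>\<^sub>0" using \<sigma>\<^sub>0 hH by (auto intro!: fixed)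
    moreover have "simplex_barycentre 0 \<in> standard_simplex 0"
      using simplex_barycentre_interior[of 0] by (simp add: simplex_interior_def)
    ultimately have "pt 0 \<sigma>\<^sub>0 (simplex_barycentre 0) \<in> fixed_points (realization ?N) act H"
      unfolding fixed_points_eq_subrealization[OF Hc] subrealization_def using \<sigma>\<^sub>0(1) by blast
    moreover have "contractible_space (subtopology (realization ?N) (fixed_points (realization ?N) act H))"
    proof (rule contractible_fixed_points[OF Hc, where v\<^sub>0 = ?c])
      fix n \<sigma> assume \<sigma>: "\<sigma> \<in> Smp ?N n" and fx: "\<And>h. h \<in> H \<Longrightarrow> ?\<rho> h n \<sigma> = \<sigma>"
      have fxo: "h <# x = x" if "h \<in> H" "i \<le> n" "FOb \<sigma> i = (X, x)" for h i X x
        using vx_action[of h \<sigma> n i] fx[of h] that \<sigma> Hc by auto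
      \<comment> \<open>The given chain with the initial object put in front: arrows from index 0
        come from \<open>initial\<close> or are identities, the others come from \<sigma>.\<close>
      define w where "w i = (case i of 0 \<Rightarrow> ?c | Suc j \<Rightarrow> FOb \<sigma> j)" for i
      have w_ar: "\<exists>u\<in>Ar (GrR ?\<F>). Src (GrR ?\<F>) u = w i \<and> Tgt (GrR ?\<F>) u = w j"
        if "i \<le> j" "j \<le> Suc n" for i j
      proof (cases i)
        case 0
        show ?thesis
        proof (cases j)
          case (Suc j')
          then have j': "j' \<le> n" using that by simp
          obtain X x where Xx: "FOb \<sigma> j' = (X, x)" by fastforce
          then have "(X, x) \<in> Ob (GrR ?\<F>)" using FOb_nerve[OF \<sigma> j'] by simp
          then show ?thesis using initial[of X x] fxo[OF _ j' Xx] by (simp add: 0 Suc w_def Xx)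
        qed (use idn[OF c] 0 in \<open>simp add: w_def\<close>)
      next
        case (Suc i')
        then obtain j' where "j = Suc j'" "i' \<le> j'" "j' \<le> n" using \<open>i \<le> j\<close> \<open>j \<le> Suc n\<close> Suc by (cases j) auto
        then show ?thesis
          using arrow_nerve[OF \<sigma>, of i' j'] by (auto simp: Suc w_def)
      qed
      have w_ob: "w i \<in> Ob (GrR ?\<F>)" if "i \<le> Suc n" for i
        using that c FOb_nerve[OF \<sigma>] by (cases i) (auto simp: w_def)
      obtain \<tau> where \<tau>: "\<tau> \<in> Smp ?N (Suc n)" "\<forall>i\<le>Suc n. FOb \<tau> i = w i"
        using nerve_simplex_of_chain[OF cat thin, of "Suc n" w, OF w_ob w_ar] by blast
      have "?\<rho> h (Suc n) \<tau> = \<tau>" if "h \<in> H" for h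
        using that \<tau> hH fxo[OF that] by (intro fixed) (auto simp: w_def split: nat.splits)
      then show "\<exists>\<tau>\<in>Smp ?N (Suc n). (\<forall>h\<in>H. ?\<rho> h (Suc n) \<tau> = \<tau>) \<and> FOb \<tau> 0 = ?c \<and>
          (\<forall>i\<le>n. FOb \<tau> (Suc i) = FOb \<sigma> i)"
        using \<tau> by (intro bexI[of _ \<tau>]) (auto simp: w_def)
    qed
    ultimately show ?thesis by blast
  qed
  show ?thesis
    unfolding is_model_E_def act using G_CW_complex_realization stab contr by blast
qed

end

theorem proposition2p3:
  fixes G :: "('a, 'b) monoid_scheme"
  assumes "group G"
  shows "is_model_E G (finite_subgroups G)
           (realization (nerve (Gr (orbit_cat G (finite_subgroups G)) (R_functor G (finite_subgroups G)))))
           (GrR_nerve_action G (finite_subgroups G))"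
  using assms by (rule group.is_model_E_nerve_GrR)

end
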